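(* Let $k\in\mathbb{N}$ (not necessarily constant), let $\mathbb{D}$ be any set, and let $\epsilon=\epsilon(n)$ satisfy $\epsilon=\omega\left(n^{3/2}/\sqrt{n!}\right)$. Let $H_n:\{0,1\}^{\binom{n}{2}}\to\mathbb{D}$ be any function on $n$-vertex simple undirected graphs that is invariant under graph isomorphism and that can be computed in $O\left(n^{8+o(1)}/\epsilon^{4+o(1)}\right)$ time given the number of $k$-cliques in the graph. Let $O$ be an oracle sampled from the random experiment $O^{H_n}_{1/2+\epsilon}$. Then, with probability at least $1-2^{-\Omega(n^2)}$ over the randomness of $O^{H_n}_{1/2+\epsilon}$, there is an algorithm that, with access to $O$, computes $H_n$ on every input graph with high probability in time $O\left(\left(n^{8+o(1)}/\epsilon^{2+o(1)}+T_O\right)/\epsilon^2\right)$, where $T_O$ is the time complexity of an algorithm simulating the oracle $O$.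
   Context: An $n$-vertex simple undirected graph is identified with its edge indicator vector in $\{0,1\}^{\binom{n}{2}}$. A $k$-clique is a set of $k$ pairwise adjacent vertices. The random experiment $O^{H_n}_{c}$: given a set $\mathbb{D}$ and an isomorphism-invariant function $H_n:\{0,1\}^{\binom{n}{2}}\to\mathbb{D}$, select uniformly at random a set $S\subset\{0,1\}^{\binom n2}$ of size $c\,2^{\binom n2}$ and output an oracle $O$ that answers $H_n(x)$ correctly for every query $x\in S$; the answers of $O$ outside $S$ are arbitrary (they may be chosen adversarially, randomly, or to minimize the running time $T_O$ of the fastest deterministic algorithm implementing $O$), and the statement holds regardless of these answers. *)

theory Defs
  imports
    "HOL-Probability.Probability"
    "HOL-Library.Landau_Symbols"
    "HOL-Library.Discrete_Functions"
begin

section \<open>Graphs on the vertex set \<open>{0..<n}\<close>\<close>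

type_synonym graph = "nat set set"

definition graphs :: "nat \<Rightarrow> graph set" where
  "graphs n = Pow {e. e \<subseteq> {..<n} \<and> card e = 2}"

definition cliques :: "nat \<Rightarrow> nat \<Rightarrow> graph \<Rightarrow> nat set set" where
  "cliques n k x =
     {K. K \<subseteq> {..<n} \<and> card K = k \<and> (\<forall>u\<in>K. \<forall>v\<in>K. u \<noteq> v \<longrightarrow> {u, v} \<in> x)}"

definition relabel :: "(nat \<Rightarrow> nat) \<Rightarrow> graph \<Rightarrow> graph" where
  "relabel \<pi> x = (\<lambda>e. \<pi> ` e) ` x"

definition iso_invariant :: "nat \<Rightarrow> (graph \<Rightarrow> 'd) \<Rightarrow> bool" where
  "iso_invariant n h \<longleftrightarrow>
     (\<forall>x\<in>graphs n. \<forall>\<pi>. \<pi> permutes {..<n} \<longrightarrow> h (relabel \<pi> x) = h x)"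

text \<open>
  Position of the pair \<open>u < v\<close> in the edge indicator vector. The pairs below \<open>n\<close> occupy exactly
  the positions \<open>0, \<dots>, (n choose 2) - 1\<close>.
\<close>

definition edge_pos :: "nat \<Rightarrow> nat \<Rightarrow> nat" where
  "edge_pos u v = (v choose 2) + u"

definition indicator_vector :: "graph \<Rightarrow> nat \<Rightarrow> nat" where
  "indicator_vector x i = (if \<exists>u v. u < v \<and> i = edge_pos u v \<and> {u, v} \<in> x then 1 else 0)"

definition graph_of_vector :: "nat \<Rightarrow> (nat \<Rightarrow> nat) \<Rightarrow> graph" where
  "graph_of_vector n f = {{u, v} | u v. u < v \<and> v < n \<and> f (edge_pos u v) \<noteq> 0}"

section \<open>Random access machine with logarithmic cost\<close>

text \<open>
  A structured random access machine whose memory consists of arrays of natural numbers; a program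
  names finitely many arrays. An operation is charged the total bit length of the numbers it
  handles, addresses included (the logarithmic cost criterion of Aho, Hopcroft and Ullman).
  Subtraction is truncated, and tests compare with zero.
\<close>

datatype binop = Add | Sub | Mul | Div

datatype expr = Lit nat | Cell nat expr | Op binop expr expr

datatype com =
    Skip
  | Assign nat expr expr    \<comment> \<open>array, index, new value\<close>
  | Coin nat                \<comment> \<open>store a fair random bit at index 0 of the array\<close>
  | Query nat nat           \<comment> \<open>ask the oracle about the graph whose indicator vector is stored in
                                 the first array; store the answer at index 0 of the second\<close>
  | Seq com com
  | If expr com com
  | While expr com

type_synonym memory = "nat \<Rightarrow> nat \<Rightarrow> nat"

definition bitlength :: "nat \<Rightarrow> nat" where
  "bitlength m = floor_log m + 1"

fun apply_op :: "binop \<Rightarrow> nat \<Rightarrow> nat \<Rightarrow> nat" where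
  "apply_op Add i j = i + j"
| "apply_op Sub i j = i - j"
| "apply_op Mul i j = i * j"
| "apply_op Div i j = i div j"

fun val :: "expr \<Rightarrow> memory \<Rightarrow> nat" where
  "val (Lit c) m = c"
| "val (Cell a e) m = m a (val e m)"
| "val (Op f e\<^sub>1 e\<^sub>2) m = apply_op f (val e\<^sub>1 m) (val e\<^sub>2 m)"

fun cost :: "expr \<Rightarrow> memory \<Rightarrow> nat" where
  "cost (Lit c) m = bitlength c"
| "cost (Cell a e) m = cost e m + bitlength (val e m) + bitlength (val (Cell a e) m)"
| "cost (Op f e\<^sub>1 e\<^sub>2) m = cost e\<^sub>1 m + cost e\<^sub>2 m + bitlength (val e\<^sub>1 m) + bitlength (val e\<^sub>2 m)"

definition store :: "nat \<Rightarrow> nat \<Rightarrow> nat \<Rightarrow> memory \<Rightarrow> memory" where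
  "store a i v m = m(a := (m a)(i := v))"

text \<open>
  \<open>exec n orc T \<omega> c (m, p) t (m', p')\<close>: program \<open>c\<close>, started in memory \<open>m\<close> after \<open>p\<close> of the random
  bits \<open>\<omega> 0, \<omega> 1, \<dots>\<close> have been used, halts after time \<open>t\<close>. The oracle \<open>orc\<close> is about \<open>n\<close>-vertex
  graphs, and each query to it takes time \<open>T\<close>.
\<close>

inductive exec ::
    "nat \<Rightarrow> (graph \<Rightarrow> nat) \<Rightarrow> nat \<Rightarrow> (nat \<Rightarrow> bool) \<Rightarrow>
     com \<Rightarrow> memory \<times> nat \<Rightarrow> nat \<Rightarrow> memory \<times> nat \<Rightarrow> bool"
  for n :: nat and orc :: "graph \<Rightarrow> nat" and T :: nat and \<omega> :: "nat \<Rightarrow> bool" where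
  exec_Skip: "exec n orc T \<omega> Skip s 1 s"
| exec_Assign:
    "exec n orc T \<omega> (Assign a e\<^sub>1 e\<^sub>2) (m, p)
       (cost e\<^sub>1 m + cost e\<^sub>2 m + bitlength (val e\<^sub>1 m) + bitlength (val e\<^sub>2 m))
       (store a (val e\<^sub>1 m) (val e\<^sub>2 m) m, p)"
| exec_Coin: "exec n orc T \<omega> (Coin a) (m, p) 1 (store a 0 (of_bool (\<omega> p)) m, Suc p)"
| exec_Query: "exec n orc T \<omega> (Query a b) (m, p) T (store b 0 (orc (graph_of_vector n (m a))) m, p)"
| exec_Seq:
    "\<lbrakk>exec n orc T \<omega> c\<^sub>1 s t\<^sub>1 s'; exec n orc T \<omega> c\<^sub>2 s' t\<^sub>2 s''\<rbrakk>
     \<Longrightarrow> exec n orc T \<omega> (Seq c\<^sub>1 c\<^sub>2) s (t\<^sub>1 + t\<^sub>2) s''"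
| exec_If:
    "exec n orc T \<omega> (if val e m \<noteq> 0 then c\<^sub>1 else c\<^sub>2) (m, p) t s'
     \<Longrightarrow> exec n orc T \<omega> (If e c\<^sub>1 c\<^sub>2) (m, p) (cost e m + bitlength (val e m) + t) s'"
| exec_While_done:
    "val e m = 0
     \<Longrightarrow> exec n orc T \<omega> (While e c) (m, p) (cost e m + bitlength (val e m)) (m, p)"
| exec_While_step:
    "\<lbrakk>val e m \<noteq> 0; exec n orc T \<omega> c (m, p) t s'; exec n orc T \<omega> (While e c) s' t' s''\<rbrakk>
     \<Longrightarrow> exec n orc T \<omega> (While e c) (m, p) (cost e m + bitlength (val e m) + t + t') s''"

fun deterministic :: "com \<Rightarrow> bool" where
  "deterministic (Coin a) \<longleftrightarrow> False"
| "deterministic (Query a b) \<longleftrightarrow> False"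
| "deterministic (Seq c\<^sub>1 c\<^sub>2) \<longleftrightarrow> deterministic c\<^sub>1 \<and> deterministic c\<^sub>2"
| "deterministic (If e c\<^sub>1 c\<^sub>2) \<longleftrightarrow> deterministic c\<^sub>1 \<and> deterministic c\<^sub>2"
| "deterministic (While e c) \<longleftrightarrow> deterministic c"
| "deterministic _ \<longleftrightarrow> True"

text \<open>
  Array 0 receives the output (at index 0), array 1 holds numerical inputs, array 2 the indicator
  vector of the input graph; everything else is initially zero.
\<close>

definition input :: "nat list \<Rightarrow> graph \<Rightarrow> memory" where
  "input ps x = (\<lambda>a i.
     if a = 1 then (if i < length ps then ps ! i else 0)
     else if a = 2 then indicator_vector x i
     else 0)"

definition result :: "memory \<times> nat \<Rightarrow> nat" where
  "result s = fst s 0 0"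

text \<open>The oracle and the random bits are irrelevant for a deterministic program, hence dummies.\<close>

definition det_computes :: "com \<Rightarrow> memory \<Rightarrow> nat \<Rightarrow> real \<Rightarrow> bool" where
  "det_computes c m v B \<longleftrightarrow> deterministic c \<and>
     (\<exists>t s. exec 0 (\<lambda>_. 0) 0 (\<lambda>_. False) c (m, 0) t s \<and> real t \<le> B \<and> result s = v)"

definition coins :: "(nat \<Rightarrow> bool) measure" where
  "coins = PiM UNIV (\<lambda>_. measure_pmf (bernoulli_pmf (1/2)))"

definition rand_computes ::
    "real \<Rightarrow> nat \<Rightarrow> (graph \<Rightarrow> nat) \<Rightarrow> nat \<Rightarrow> com \<Rightarrow> memory \<Rightarrow> nat \<Rightarrow> real \<Rightarrow> bool" where
  "rand_computes \<delta> n orc T c m v B \<longleftrightarrow>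
     (\<forall>\<omega>. \<exists>t s. exec n orc T \<omega> c (m, 0) t s \<and> real t \<le> B) \<and>
     measure coins {\<omega>. \<exists>t s. exec n orc T \<omega> c (m, 0) t s \<and> result s = v} \<ge> 1 - \<delta>"

section \<open>The oracle experiment\<close>

text \<open>\<open>c * 2 ^ (n choose 2)\<close> need not be an integer, so it is rounded down.\<close>

definition random_subset :: "nat \<Rightarrow> real \<Rightarrow> graph set pmf" where
  "random_subset n c =
     pmf_of_set {S. S \<subseteq> graphs n \<and> card S = nat \<lfloor>c * 2 ^ (n choose 2)\<rfloor>}"

definition oracle_for :: "nat \<Rightarrow> 'd set \<Rightarrow> (graph \<Rightarrow> 'd) \<Rightarrow> graph set \<Rightarrow> (graph \<Rightarrow> 'd) \<Rightarrow> bool" where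
  "oracle_for n D h S O' \<longleftrightarrow> (\<forall>x\<in>graphs n. O' x \<in> D) \<and> (\<forall>x\<in>S. O' x = h x)"

text \<open>
  Elements of \<open>D\<close> are output as numbers via \<open>enc\<close>. Some deterministic algorithm simulates the oracle
  on \<open>n\<close>-vertex graphs in time \<open>T\<close>.
\<close>

definition simulable :: "nat \<Rightarrow> ('d \<Rightarrow> nat) \<Rightarrow> (graph \<Rightarrow> 'd) \<Rightarrow> nat \<Rightarrow> bool" where
  "simulable n enc O' T \<longleftrightarrow>
     (\<exists>Q. \<forall>x\<in>graphs n. det_computes Q (input [n] x) (enc (O' x)) (real T))"

text \<open>
  Numerical inputs of the algorithms: \<open>n\<close>, \<open>k\<close>, and \<open>\<epsilon>\<close> in the form \<open>\<lceil>1/\<epsilon>\<rceil>\<close>. Since no \<open>n\<close>-vertex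
  graph has a \<open>k\<close>-clique with \<open>k > n\<close>, all such \<open>k\<close> are presented as \<open>n + 1\<close>; otherwise the mere
  bit length of \<open>k\<close> could exceed any time bound in \<open>n\<close> and \<open>\<epsilon>\<close>.
\<close>

definition params :: "nat \<Rightarrow> nat \<Rightarrow> real \<Rightarrow> nat list" where
  "params n k \<epsilon> = [n, min k (n + 1), nat \<lceil>1 / \<epsilon>\<rceil>]"

end

theory Submission
  imports Defs "HOL-Real_Asymp.Real_Asymp"
begin

text \<open>
  Let \<open>N\<close> be the least power of two above \<open>64 n\<^sup>2 / \<epsilon>\<^sup>2\<close> (with \<open>1 / \<epsilon>\<close> rounded up). Apply transpositions
  to enumerate the isomorphism class of the input \<open>x\<close> until it is exhausted or \<open>N\<close> distinct graphs have
  been found; comparing each new graph with all previous ones costs about \<open>N\<^sup>2 n\<^sup>4 \<approx> n\<^sup>8 / \<epsilon>\<^sup>4\<close>.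

  If the class is exhausted, the number of \<open>k\<close>-cliques of \<open>x\<close> follows by double counting from the number
  of graphs in the class in which the first \<open>k\<close> vertices form a clique, and the given algorithm
  computes the answer. Otherwise query the oracle at \<open>O(1 / \<epsilon>\<^sup>2)\<close> random graphs among the first \<open>N\<close>
  found and take the majority of the answers. This is correct with high probability if the random set
  contains at least a fraction \<open>1/2 + \<epsilon>/2\<close> of these \<open>N\<close> graphs, which fails with probability
  at most \<open>exp (- 2 n\<^sup>2)\<close> for each \<open>x\<close>, small enough for a union bound over all \<open>x\<close>.
\<close>

section \<open>Execution of programs\<close>

text \<open>The answers outside the random set \<open>S\<close> may depend on \<open>S\<close> in
  any way, so the union bound must range over events that mention \<open>S\<close> alone. This works
  because the \<open>N\<close> graphs sampled for an input \<open>x\<close> are found from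
  \<open>x\<close> without any query: the event that at most a fraction 1/2 - \<epsilon>/2 of them
  lies outside \<open>S\<close> is fixed before the answers are, and a wrong answer can occur only
  at a graph outside \<open>S\<close>. One half of the advantage \<epsilon> pays for this
  concentration (including the rounding of the size of \<open>S\<close>), the other half for the
  majority vote. \<open>N\<close> is a power of two because the time bound has to hold for every
  sequence of coins: a uniform index is then exactly log2 \<open>N\<close> coins, without rejection.
  Oracle answers can be as long as the time \<open>T\<close> of the oracle, so they are not bounded
  like all other numbers; they are kept in separate arrays, and each query leads to a constant
  number of operations on them. The logarithmic factors of the cost model are absorbed into the o(1)
  exponents of \<open>n\<close> and \<epsilon>.\<close>

fun arrays_of :: "expr \<Rightarrow> nat set" where
  "arrays_of (Lit c) = {}"
| "arrays_of (Cell a e) = insert a (arrays_of e)"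
| "arrays_of (Op f e1 e2) = arrays_of e1 \<union> arrays_of e2"

fun writes :: "com \<Rightarrow> nat set" where
  "writes Skip = {}"
| "writes (Assign a e1 e2) = {a}"
| "writes (Coin a) = {a}"
| "writes (Query a b) = {b}"
| "writes (Seq c1 c2) = writes c1 \<union> writes c2"
| "writes (If e c1 c2) = writes c1 \<union> writes c2"
| "writes (While e c) = writes c"

fun mentions :: "com \<Rightarrow> nat set" where
  "mentions Skip = {}"
| "mentions (Assign a e1 e2) = {a} \<union> arrays_of e1 \<union> arrays_of e2"
| "mentions (Coin a) = {a}"
| "mentions (Query a b) = {a, b}"
| "mentions (Seq c1 c2) = mentions c1 \<union> mentions c2"
| "mentions (If e c1 c2) = arrays_of e \<union> mentions c1 \<union> mentions c2"
| "mentions (While e c) = arrays_of e \<union> mentions c"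

lemma finite_arrays_of: "finite (arrays_of e)"
  by (induction e) auto

lemma finite_mentions: "finite (mentions c)"
  by (induction c) (auto simp: finite_arrays_of)

lemma val_cong: "(\<And>a. a \<in> arrays_of e \<Longrightarrow> m a = m' a) \<Longrightarrow> val e m = val e m'"
  by (induction e) auto

lemma cost_cong: "(\<And>a. a \<in> arrays_of e \<Longrightarrow> m a = m' a) \<Longrightarrow> cost e m = cost e m'"
proof (induction e)
  case (Cell a e)
  then show ?case using val_cong[of e m m'] by auto
next
  case (Op f e1 e2)
  then show ?case using val_cong[of e1 m m'] val_cong[of e2 m m'] by auto
qed auto

lemma exec_writes:
  assumes "exec n orc T \<omega> c s t s'"
  shows "a \<notin> writes c \<Longrightarrow> fst s' a = fst s a"
  using assms by (induction rule: exec.induct) (auto simp: store_def split: if_splits)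

text \<open>For a fixed oracle and coin sequence the semantics is a partial function. This turns the
  event "some halting run returns \<open>v\<close>" into an event about the one run that is
  constructed.\<close>

lemma exec_determ:
  assumes "exec n orc T \<omega> c s t s'"
  shows "exec n orc T \<omega> c s t2 s\<^sub>2 \<Longrightarrow> t2 = t \<and> s\<^sub>2 = s'"
  using assms
proof (induction arbitrary: t2 s\<^sub>2 rule: exec.induct)
  case (exec_Seq c1 s t1 s' c2 t2 s'')
  from exec_Seq.prems show ?case
    by (cases rule: exec.cases) (use exec_Seq.IH in blast)+
next
  case (exec_If e m c1 c2 p t s')
  from exec_If.prems show ?case
    by (cases rule: exec.cases) (use exec_If.IH in blast)+
next
  case (exec_While_step e m c p t s' t' s'')
  from exec_While_step.prems show ?case
    by (cases rule: exec.cases) (use exec_While_step.hyps exec_While_step.IH in blast)+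
next
  case (exec_While_done e m c p)
  from exec_While_done.prems show ?case
    by (cases rule: exec.cases) (use exec_While_done.hyps in auto)
qed (auto elim: exec.cases)

text \<open>\<open>det_computes\<close> runs a program with a dummy oracle, dummy coins and a clean
  memory, whereas inside \<open>main_prog\<close> the given algorithm meets the true oracle, the
  true coins and a memory full of leftovers. Time and values stay the same, as only arrays in
  \<open>V\<close> are ever read.\<close>

lemma deterministic_transfer:
  assumes "exec n orc T \<omega> c s t s'" "deterministic c" "mentions c \<subseteq> V"
    and "\<And>a. a \<in> V \<Longrightarrow> fst s a = m a"
  shows "\<exists>m'. exec n' orc' T' \<omega>' c (m, p) t (m', p) \<and> (\<forall>a\<in>V. fst s' a = m' a)"
  using assms
proof (induction arbitrary: m rule: exec.induct)
  case (exec_Skip s)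
  then show ?case by (intro exI[of _ m] conjI exec.exec_Skip) auto
next
  case (exec_Assign a e1 e2 m0 p0)
  have [simp]: "val e1 m0 = val e1 m" "val e2 m0 = val e2 m" "cost e1 m0 = cost e1 m" "cost e2 m0 = cost e2 m"
    using exec_Assign.prems by (auto intro!: val_cong cost_cong)
  show ?case
    using exec.exec_Assign[of n' orc' T' \<omega>' a e1 e2 m p] exec_Assign.prems
    by (auto simp: store_def intro!: exI)
next
  case (exec_Seq c1 s t1 s' c2 t2 s'')
  obtain m1 where 1: "exec n' orc' T' \<omega>' c1 (m, p) t1 (m1, p)" "\<forall>a\<in>V. fst s' a = m1 a"
    using exec_Seq.IH(1)[of m] exec_Seq.prems by auto
  then obtain m2 where 2: "exec n' orc' T' \<omega>' c2 (m1, p) t2 (m2, p)" "\<forall>a\<in>V. fst s'' a = m2 a"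
    using exec_Seq.IH(2)[of m1] exec_Seq.prems by auto
  then show ?case using 1 by (auto intro: exec.exec_Seq)
next
  case (exec_If e m0 c1 c2 p0 t s')
  have [simp]: "val e m0 = val e m" "cost e m0 = cost e m"
    using exec_If.prems by (auto intro!: val_cong cost_cong)
  obtain m1 where 1: "exec n' orc' T' \<omega>' (if val e m0 \<noteq> 0 then c1 else c2) (m, p) t (m1, p)" "\<forall>a\<in>V. fst s' a = m1 a"
    using exec_If.IH[of m] exec_If.prems by (cases "val e m = 0") auto
  show ?case using exec.exec_If[of n' orc' T' \<omega>' e m c1 c2 p t "(m1, p)"] 1 by auto
next
  case (exec_While_done e m0 c p0)
  have [simp]: "val e m0 = val e m" "cost e m0 = cost e m"
    using exec_While_done.prems by (auto intro!: val_cong cost_cong)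
  show ?case
    using exec.exec_While_done[of e m n' orc' T' \<omega>' c p] exec_While_done by auto
next
  case (exec_While_step e m0 c p0 t s' t' s'')
  have [simp]: "val e m0 = val e m" "cost e m0 = cost e m"
    using exec_While_step.prems by (auto intro!: val_cong cost_cong)
  obtain m1 where 1: "exec n' orc' T' \<omega>' c (m, p) t (m1, p)" "\<forall>a\<in>V. fst s' a = m1 a"
    using exec_While_step.IH(1)[of m] exec_While_step.prems by auto
  then obtain m2 where 2: "exec n' orc' T' \<omega>' (While e c) (m1, p) t' (m2, p)" "\<forall>a\<in>V. fst s'' a = m2 a"
    using exec_While_step.IH(2)[of m1] exec_While_step.prems by auto
  show ?case
    using exec.exec_While_step[of e m n' orc' T' \<omega>' c p t "(m1, p)" t' "(m2, p)"] 1 2 exec_While_step.hyps by auto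
qed (auto intro: exec.intros)

lemma det_computes_exec:
  assumes "det_computes A m0 v B" "mentions A \<subseteq> V" "0 \<in> V" "\<And>a. a \<in> V \<Longrightarrow> m a = m0 a"
  shows "\<exists>t m'. exec n orc T \<omega> A (m, p) t (m', p) \<and> real t \<le> B \<and> m' 0 0 = v"
proof -
  obtain t s where *: "deterministic A" "exec 0 (\<lambda>_. 0) 0 (\<lambda>_. False) A (m0, 0) t s" "real t \<le> B" "result s = v"
    using assms(1) by (auto simp: det_computes_def)
  show ?thesis
    using deterministic_transfer[OF *(2,1) assms(2), of m n orc T \<omega> p] assms(3,4) *(3,4)
    by (force simp: result_def)
qed

section \<open>Bit lengths, and the length of what a program can write\<close>

lemma bitlength_pos [simp]: "0 < bitlength k"
  by (simp add: bitlength_def)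

lemma bitlength_mono: "i \<le> j \<Longrightarrow> bitlength i \<le> bitlength j"
  by (simp add: bitlength_def floor_log_le_iff)

lemma less_two_power_bitlength: "k < 2 ^ bitlength k"
  using floor_log_exp2_gt[of k] by (simp add: bitlength_def)

lemma bitlength_le: "k < 2 ^ i \<Longrightarrow> 0 < i \<Longrightarrow> bitlength k \<le> i"
proof (cases "k = 0")
  case False
  assume "k < 2 ^ i"
  then have "2 ^ floor_log k < (2 :: nat) ^ i"
    using floor_log_exp2_le[of k] False by (meson le_less_trans neq0_conv)
  then show ?thesis by (simp add: bitlength_def)
qed (simp add: bitlength_def)

lemma bitlength_power_le: "0 < i \<Longrightarrow> bitlength (k ^ i) \<le> i * bitlength k"
proof (rule bitlength_le)
  assume "0 < i"
  then have "k ^ i < (2 ^ bitlength k) ^ i"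
    by (intro power_strict_mono less_two_power_bitlength) auto
  then show "k ^ i < 2 ^ (i * bitlength k)" by (simp add: power_mult[symmetric] mult.commute)
qed auto

lemma bitlength_mult_le: "bitlength (i * j) \<le> bitlength i + bitlength j"
proof (rule bitlength_le)
  show "i * j < 2 ^ (bitlength i + bitlength j)"
    unfolding power_add by (intro mult_strict_mono' less_two_power_bitlength) auto
qed auto

text \<open>Storing a number costs at least its bit length, so a changed cell holds a number no
  longer than the running time. \<open>Query\<close>, whose price \<open>T\<close> is unrelated to
  the length of the answer, is excluded by determinism.\<close>

lemma exec_bitlength:
  assumes "exec n orc T \<omega> c s t s'" "deterministic c"
  shows "fst s' a i = fst s a i \<or> bitlength (fst s' a i) \<le> t"
  using assms
proof (induction rule: exec.induct)
  case (exec_If e m c1 c2 p t s')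
  then show ?case by (auto split: if_splits)
qed (auto simp: store_def)

lemma exec_time_pos: "exec n orc T \<omega> c s t s' \<Longrightarrow> deterministic c \<Longrightarrow> 0 < t"
  by (induction rule: exec.induct) auto

text \<open>Source of the bound \<open>2 ^ T\<close> on oracle answers: whatever computes an answer
  in time \<open>T\<close> must write it down. An unwritten output is 0, and one bit is covered
  since every run takes positive time.\<close>

lemma det_computes_bitlength:
  assumes "det_computes Q (input [n] x) v (real T)"
  shows "bitlength v \<le> T"
proof -
  obtain t s where *: "deterministic Q" "exec 0 (\<lambda>_. 0) 0 (\<lambda>_. False) Q (input [n] x, 0) t s" "t \<le> T" "result s = v"
    using assms by (auto simp: det_computes_def)
  have "v = 0 \<or> bitlength v \<le> t"
    using exec_bitlength[OF *(2,1), of 0 0] *(4) by (auto simp: result_def input_def)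
  moreover have "bitlength 0 \<le> t" using exec_time_pos[OF *(2,1)] by (simp add: bitlength_def)
  ultimately show ?thesis using *(3) by auto
qed

section \<open>Programs on bounded memory\<close>

text \<open>If all literals and memory cells are at most \<open>X\<close>, the value of an expression is at most
  \<open>X ^ degree_of e\<close>, so that its cost is a constant multiple of \<open>bitlength X\<close>.\<close>

fun degree_of :: "expr \<Rightarrow> nat" where
  "degree_of (Lit c) = 1"
| "degree_of (Cell a e) = 1"
| "degree_of (Op f e1 e2) = degree_of e1 + degree_of e2"

fun weight :: "expr \<Rightarrow> nat" where
  "weight (Lit c) = 1"
| "weight (Cell a e) = weight e + degree_of e + 1"
| "weight (Op f e1 e2) = weight e1 + weight e2 + degree_of e1 + degree_of e2"

fun fits :: "nat set \<Rightarrow> nat \<Rightarrow> expr \<Rightarrow> bool" where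
  "fits Z X (Lit c) \<longleftrightarrow> c \<le> X"
| "fits Z X (Cell a e) \<longleftrightarrow> a \<notin> Z \<and> fits Z X e"
| "fits Z X (Op f e1 e2) \<longleftrightarrow> fits Z X e1 \<and> fits Z X e2"

text \<open>The exceptional arrays \<open>Z\<close> are those that contain oracle answers, whose length is bounded by the
  running time of the oracle only.\<close>

definition bounded_outside :: "nat set \<Rightarrow> nat \<Rightarrow> memory \<Rightarrow> bool" where
  "bounded_outside Z X m \<longleftrightarrow> (\<forall>a i. a \<notin> Z \<longrightarrow> m a i \<le> X)"

lemma bounded_outsideD: "bounded_outside Z X m \<Longrightarrow> a \<notin> Z \<Longrightarrow> m a i \<le> X"
  by (auto simp: bounded_outside_def)

lemma bounded_outside_store:
  "bounded_outside Z X m \<Longrightarrow> a \<in> Z \<or> v \<le> X \<Longrightarrow> bounded_outside Z X (store a i v m)"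
  by (auto simp: bounded_outside_def store_def)

lemma degree_of_pos [simp]: "0 < degree_of e"
  by (induction e) auto

lemma weight_pos [simp]: "0 < weight e"
  by (induction e) auto

lemma val_le:
  assumes "bounded_outside Z X m" "fits Z X e" "2 \<le> X"
  shows "val e m \<le> X ^ degree_of e"
  using assms(2)
proof (induction e)
  case (Cell a e)
  then show ?case using bounded_outsideD[OF assms(1)] by auto
next
  case (Op f e1 e2)
  let ?i = "val e1 m" and ?j = "val e2 m" and ?x = "X ^ degree_of e1" and ?y = "X ^ degree_of e2"
  have IH: "?i \<le> ?x" "?j \<le> ?y" using Op by auto
  \<comment> \<open>For numbers that are at least 2 the sum is at most the product, so addition
    obeys the degree bound of multiplication.\<close>
  have "X ^ 1 \<le> ?x" "X ^ 1 \<le> ?y"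
    using assms(3) degree_of_pos[of e1] degree_of_pos[of e2] by (intro power_increasing; linarith)+
  then have 2: "2 \<le> ?x" "2 \<le> ?y" using assms(3) by auto
  then obtain d d' where "?x = d + 2" "?y = d' + 2" by (metis add.commute le_Suc_ex)
  then have "?x + ?y \<le> ?x * ?y" by (simp add: algebra_simps)
  moreover have "apply_op f ?i ?j \<le> ?i + ?j \<or> apply_op f ?i ?j \<le> ?i * ?j"
    by (cases f) (auto intro: le_trans[OF div_le_dividend] le_trans[OF diff_le_self])
  moreover have "?i * ?j \<le> ?x * ?y" "?i + ?j \<le> ?x + ?y" using IH by (auto intro: mult_le_mono add_mono)
  ultimately have "apply_op f ?i ?j \<le> ?x * ?y" by linarith
  then show ?case by (simp add: power_add)
qed auto

lemma bitlength_val_le: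
  assumes "bounded_outside Z X m" "fits Z X e" "2 \<le> X"
  shows "bitlength (val e m) \<le> degree_of e * bitlength X"
  using bitlength_mono[OF val_le[OF assms]] bitlength_power_le[of "degree_of e" X] by simp

lemma cost_le:
  assumes "bounded_outside Z X m" "fits Z X e" "2 \<le> X"
  shows "cost e m \<le> weight e * bitlength X"
  using assms(2)
proof (induction e)
  case (Lit c)
  then show ?case by (auto intro: bitlength_mono)
next
  case (Cell a e)
  then have "bitlength (m a (val e m)) \<le> bitlength X"
    using bounded_outsideD[OF assms(1)] by (auto intro: bitlength_mono)
  then show ?case using Cell bitlength_val_le[OF assms(1) _ assms(3), of e] by (simp add: algebra_simps)
next
  case (Op f e1 e2)
  then show ?case
    using bitlength_val_le[OF assms(1) _ assms(3), of e1] bitlength_val_le[OF assms(1) _ assms(3), of e2]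
    by (simp add: algebra_simps)
qed

text \<open>Loop-free programs without coins and queries. With \<open>run\<close> and
  \<open>safe\<close> the simplifier evaluates them symbolically and reduces the memory bound to a
  check of each stored value; \<open>com_weight\<close> charges both branches of a test and is thus
  independent of the memory.\<close>

fun simple :: "nat set \<Rightarrow> nat \<Rightarrow> com \<Rightarrow> bool" where
  "simple Z X Skip \<longleftrightarrow> True"
| "simple Z X (Assign a e1 e2) \<longleftrightarrow> fits Z X e1 \<and> fits Z X e2"
| "simple Z X (Seq c1 c2) \<longleftrightarrow> simple Z X c1 \<and> simple Z X c2"
| "simple Z X (If e c1 c2) \<longleftrightarrow> fits Z X e \<and> simple Z X c1 \<and> simple Z X c2"
| "simple Z X _ \<longleftrightarrow> False"

fun run :: "com \<Rightarrow> memory \<Rightarrow> memory" where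
  "run (Assign a e1 e2) m = store a (val e1 m) (val e2 m) m"
| "run (Seq c1 c2) m = run c2 (run c1 m)"
| "run (If e c1 c2) m = (if val e m \<noteq> 0 then run c1 m else run c2 m)"
| "run _ m = m"

fun safe :: "nat set \<Rightarrow> nat \<Rightarrow> com \<Rightarrow> memory \<Rightarrow> bool" where
  "safe Z X (Assign a e1 e2) m \<longleftrightarrow> a \<in> Z \<or> val e2 m \<le> X"
| "safe Z X (Seq c1 c2) m \<longleftrightarrow> safe Z X c1 m \<and> safe Z X c2 (run c1 m)"
| "safe Z X (If e c1 c2) m \<longleftrightarrow> (if val e m \<noteq> 0 then safe Z X c1 m else safe Z X c2 m)"
| "safe Z X _ m \<longleftrightarrow> True"

fun com_weight :: "com \<Rightarrow> nat" where
  "com_weight (Assign a e1 e2) = weight e1 + weight e2 + degree_of e1 + degree_of e2"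
| "com_weight (Seq c1 c2) = com_weight c1 + com_weight c2"
| "com_weight (If e c1 c2) = weight e + degree_of e + com_weight c1 + com_weight c2"
| "com_weight _ = 1"

lemma exec_simple:
  assumes "2 \<le> X" "simple Z X c" "bounded_outside Z X m" "safe Z X c m"
  shows "\<exists>t. exec n orc T \<omega> c (m, p) t (run c m, p) \<and> t \<le> com_weight c * bitlength X \<and>
    bounded_outside Z X (run c m)"
  using assms(2-)
proof (induction c arbitrary: m)
  case Skip
  have "1 \<le> bitlength X" using bitlength_pos[of X] by linarith
  then show ?case using Skip by (auto intro: exec.intros)
next
  case (Assign a e1 e2)
  then show ?case
    using cost_le[of Z X m e1] cost_le[of Z X m e2] bitlength_val_le[of Z X m e1] bitlength_val_le[of Z X m e2] assms(1)
    by (auto intro!: exI exec.intros bounded_outside_store simp: algebra_simps)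
next
  case (Seq c1 c2)
  obtain t1 where 1: "exec n orc T \<omega> c1 (m, p) t1 (run c1 m, p)" "t1 \<le> com_weight c1 * bitlength X"
    "bounded_outside Z X (run c1 m)" using Seq.IH(1)[of m] Seq.prems by auto
  then obtain t2 where 2: "exec n orc T \<omega> c2 (run c1 m, p) t2 (run (Seq c1 c2) m, p)" "t2 \<le> com_weight c2 * bitlength X"
    "bounded_outside Z X (run (Seq c1 c2) m)" using Seq.IH(2)[of "run c1 m"] Seq.prems by auto
  then show ?case using exec.exec_Seq[OF 1(1) 2(1)] 1 2 by (auto simp: algebra_simps intro!: exI[of _ "t1 + t2"])
next
  case (If e c1 c2)
  obtain t where t: "exec n orc T \<omega> (if val e m \<noteq> 0 then c1 else c2) (m, p) t (run (If e c1 c2) m, p)"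
    "t \<le> (com_weight c1 + com_weight c2) * bitlength X" "bounded_outside Z X (run (If e c1 c2) m)"
  proof (cases "val e m \<noteq> 0")
    case True
    then obtain t where "exec n orc T \<omega> c1 (m, p) t (run c1 m, p)" "t \<le> com_weight c1 * bitlength X"
      "bounded_outside Z X (run c1 m)" using If.IH(1)[of m] If.prems by auto
    then show ?thesis using that[of t] True by (simp add: algebra_simps)
  next
    case False
    then obtain t where "exec n orc T \<omega> c2 (m, p) t (run c2 m, p)" "t \<le> com_weight c2 * bitlength X"
      "bounded_outside Z X (run c2 m)" using If.IH(2)[of m] If.prems by auto
    then show ?thesis using that[of t] False by (simp add: algebra_simps)
  qed
  have "cost e m + bitlength (val e m) + t \<le> com_weight (If e c1 c2) * bitlength X"
    using t(2) cost_le[of Z X m e] bitlength_val_le[of Z X m e] assms(1) If.prems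
    by (simp add: algebra_simps)
  then show ?case using exec.exec_If[OF t(1)] t(3) by blast
qed auto

text \<open>The bound \<open>e\<close> is evaluated anew in every round; \<open>runs_For\<close>
  therefore demands that neither the body nor the counter changes an array of
  \<open>e\<close>.\<close>

definition for_loop :: "nat \<Rightarrow> expr \<Rightarrow> com \<Rightarrow> com" where
  "for_loop i e c = Seq (Assign i (Lit 0) (Lit 0))
     (While (Op Sub e (Cell i (Lit 0))) (Seq c (Assign i (Lit 0) (Op Add (Cell i (Lit 0)) (Lit 1)))))"

lemma writes_for_loop [simp]: "writes (for_loop i e c) = insert i (writes c)"
  by (auto simp: for_loop_def)

text \<open>Generous overhead of a round: the test costs at most
  \<open>9 * (weight e + degree_of e)\<close> words and the increment 10.\<close>

definition for_weight :: "expr \<Rightarrow> nat" where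
  "for_weight e = 100 * (weight e + degree_of e)"

section \<open>Hoare-style rules with time bounds\<close>

locale ram =
  fixes n :: nat and orc :: "graph \<Rightarrow> nat" and T :: nat and \<omega> :: "nat \<Rightarrow> bool" and Z :: "nat set" and X :: nat
  assumes X: "2 \<le> X"
begin

abbreviation outcome :: "com \<Rightarrow> memory \<Rightarrow> nat \<Rightarrow> nat \<Rightarrow> (memory \<Rightarrow> nat \<Rightarrow> bool) \<Rightarrow> bool" where
  "outcome c m p B Q \<equiv> \<exists>t m' p'. exec n orc T \<omega> c (m, p) t (m', p') \<and> t \<le> B \<and>
     bounded_outside Z X m' \<and> (\<forall>a. a \<notin> writes c \<longrightarrow> m' a = m a) \<and> Q m' p'"

text \<open>Total correctness from one given memory and coin position, with a time bound. The memory
  bound and the frame condition for unwritten arrays are built in, so that invariants need to speak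
  only of what changes.\<close>

definition runs :: "com \<Rightarrow> memory \<Rightarrow> nat \<Rightarrow> nat \<Rightarrow> (memory \<Rightarrow> nat \<Rightarrow> bool) \<Rightarrow> bool" where
  "runs c m p B Q \<longleftrightarrow> bounded_outside Z X m \<longrightarrow> outcome c m p B Q"

lemma runs_conseq:
  assumes "runs c m p B R" "B \<le> B'"
    and "\<And>m' p'. bounded_outside Z X m' \<Longrightarrow> (\<And>a. a \<notin> writes c \<Longrightarrow> m' a = m a) \<Longrightarrow> R m' p' \<Longrightarrow> Q m' p'"
  shows "runs c m p B' Q"
  unfolding runs_def
proof
  assume "bounded_outside Z X m"
  then obtain t m' p' where "exec n orc T \<omega> c (m, p) t (m', p')" "t \<le> B" "bounded_outside Z X m'"
    "\<forall>a. a \<notin> writes c \<longrightarrow> m' a = m a" "R m' p'" using assms(1) unfolding runs_def by blast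
  then show "outcome c m p B' Q"
    using assms(2,3) by (meson le_trans)
qed

lemma runs_simple:
  assumes "simple Z X c" "bounded_outside Z X m \<Longrightarrow> safe Z X c m"
    "com_weight c * bitlength X \<le> B" "bounded_outside Z X m \<Longrightarrow> Q (run c m) p"
  shows "runs c m p B Q"
  unfolding runs_def
proof
  assume b: "bounded_outside Z X m"
  then obtain t where t: "exec n orc T \<omega> c (m, p) t (run c m, p)" "t \<le> com_weight c * bitlength X"
    "bounded_outside Z X (run c m)"
    using exec_simple[OF X assms(1) _ assms(2)] by blast
  then show "outcome c m p B Q"
    using exec_writes[OF t(1)] assms(3) assms(4)[OF b]
    by (intro exI[of _ t] exI[of _ "run c m"] exI[of _ p]) (auto intro: le_trans)
qed

lemma runs_Seq:
  assumes "runs c1 m p Ba R"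
    and "\<And>m' p'. bounded_outside Z X m' \<Longrightarrow> (\<And>a. a \<notin> writes c1 \<Longrightarrow> m' a = m a) \<Longrightarrow> R m' p' \<Longrightarrow> runs c2 m' p' Bb Q"
    and "Ba + Bb \<le> B"
  shows "runs (Seq c1 c2) m p B Q"
  unfolding runs_def
proof
  assume "bounded_outside Z X m"
  then obtain t1 m1 p1 where 1: "exec n orc T \<omega> c1 (m, p) t1 (m1, p1)" "t1 \<le> Ba" "bounded_outside Z X m1"
    "\<forall>a. a \<notin> writes c1 \<longrightarrow> m1 a = m a" "R m1 p1" using assms(1) unfolding runs_def by blast
  then obtain t2 m2 p2 where 2: "exec n orc T \<omega> c2 (m1, p1) t2 (m2, p2)" "t2 \<le> Bb" "bounded_outside Z X m2"
    "\<forall>a. a \<notin> writes c2 \<longrightarrow> m2 a = m1 a" "Q m2 p2" using assms(2)[of m1 p1] unfolding runs_def by blast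
  then show "outcome (Seq c1 c2) m p B Q"
    using exec.exec_Seq[OF 1(1) 2(1)] 1 assms(3) by (intro exI[of _ "t1 + t2"] exI[of _ m2] exI[of _ p2]) auto
qed

lemma runs_If:
  assumes "fits Z X e"
    and "bounded_outside Z X m \<Longrightarrow> val e m \<noteq> 0 \<Longrightarrow> runs c1 m p B' Q"
    and "bounded_outside Z X m \<Longrightarrow> val e m = 0 \<Longrightarrow> runs c2 m p B' Q"
    and "B' + (weight e + degree_of e) * bitlength X \<le> B"
  shows "runs (If e c1 c2) m p B Q"
  unfolding runs_def
proof
  assume b: "bounded_outside Z X m"
  then have "runs (if val e m \<noteq> 0 then c1 else c2) m p B' Q" using assms(2,3) by auto
  then obtain t m' p' where t: "exec n orc T \<omega> (if val e m \<noteq> 0 then c1 else c2) (m, p) t (m', p')" "t \<le> B'" "bounded_outside Z X m'"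
    "\<forall>a. a \<notin> writes (if val e m \<noteq> 0 then c1 else c2) \<longrightarrow> m' a = m a" "Q m' p'" using b unfolding runs_def by blast
  then show "outcome (If e c1 c2) m p B Q"
    using exec.exec_If[OF t(1)] assms(1,4) cost_le[OF b assms(1) X] bitlength_val_le[OF b assms(1) X]
    by (intro exI[of _ "cost e m + bitlength (val e m) + t"] exI[of _ m'] exI[of _ p'])
       (auto simp: algebra_simps split: if_splits)
qed

lemma runs_Coin:
  assumes "Q (store a 0 (of_bool (\<omega> p)) m) (Suc p)" "0 < B"
  shows "runs (Coin a) m p B Q"
  unfolding runs_def
proof
  assume "bounded_outside Z X m"
  then have "bounded_outside Z X (store a 0 (of_bool (\<omega> p)) m)"
    using X by (intro bounded_outside_store) auto
  then show "outcome (Coin a) m p B Q"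
    using exec.exec_Coin[of n orc T \<omega> a m p] assms
    by (intro exI[of _ 1] exI[of _ "store a 0 (of_bool (\<omega> p)) m"] exI[of _ "Suc p"]) (auto simp: store_def)
qed

lemma runs_Query:
  assumes "Q (store b 0 (orc (graph_of_vector n (m a))) m) p" "T \<le> B" "b \<in> Z"
  shows "runs (Query a b) m p B Q"
  unfolding runs_def
proof
  let ?m = "store b 0 (orc (graph_of_vector n (m a))) m"
  assume "bounded_outside Z X m"
  then have "bounded_outside Z X ?m"
    using assms(3) by (intro bounded_outside_store) auto
  then show "outcome (Query a b) m p B Q"
    using exec.exec_Query[of n orc T \<omega> a b m p] assms
    by (intro exI[of _ T] exI[of _ ?m] exI[of _ p]) (auto simp: store_def)
qed

text \<open>The invariant is indexed by the counter and holds after the increment; hence the body's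
  postcondition speaks of \<open>store i 0 (Suc j) m'\<close>, the memory that the loop makes of
  \<open>m'\<close>. The factor \<open>N + 1\<close> pays for the initial assignment and the final,
  failing test as well.\<close>

lemma runs_For:
  assumes init: "bounded_outside Z X m0 \<Longrightarrow> I 0 (store i 0 0 m0) p0"
    and step: "\<And>j m p. \<lbrakk>j < N; bounded_outside Z X m; \<And>a. a \<noteq> i \<Longrightarrow> a \<notin> writes c \<Longrightarrow> m a = m0 a; m i 0 = j; I j m p\<rbrakk>
      \<Longrightarrow> runs c m p B (\<lambda>m' p'. I (Suc j) (store i 0 (Suc j) m') p')"
    and N: "val e m0 = N" "N \<le> X"
    and static: "fits Z X e" "i \<notin> Z" "i \<notin> writes c" "i \<notin> arrays_of e" "arrays_of e \<inter> writes c = {}"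
    and final: "\<And>m p. bounded_outside Z X m \<Longrightarrow> (\<And>a. a \<noteq> i \<Longrightarrow> a \<notin> writes c \<Longrightarrow> m a = m0 a) \<Longrightarrow> I N m p \<Longrightarrow> Q m p"
    and time: "(N + 1) * (B + for_weight e * bitlength X) \<le> B'"
  shows "runs (for_loop i e c) m0 p0 B' Q"
  unfolding runs_def
proof
  assume b0: "bounded_outside Z X m0"
  define w where "w = bitlength X"
  define W where "W = for_weight e * w"
  define test where "test = Op Sub e (Cell i (Lit 0))"
  define inc where "inc = Assign i (Lit 0) (Op Add (Cell i (Lit 0)) (Lit 1))"
  let ?P = "\<lambda>j m. bounded_outside Z X m \<and> (\<forall>a. a \<noteq> i \<longrightarrow> a \<notin> writes c \<longrightarrow> m a = m0 a) \<and> m i 0 = j"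
  have w: "1 \<le> w" using bitlength_pos[of X] unfolding w_def by linarith
  have dw: "1 \<le> degree_of e" "1 \<le> weight e"
    using degree_of_pos[of e] weight_pos[of e] by linarith+
  have e_eq: "val e m = N" if "?P j m" for j m
  proof -
    have "val e m = val e m0" using that static by (intro val_cong) auto
    then show ?thesis using N by simp
  qed
  have test_val: "val test m = N - j" if "?P j m" for j m
    using e_eq[OF that] that by (simp add: test_def)
  have test_cost: "cost test m + bitlength (val test m) \<le> 9 * (weight e + degree_of e) * w" if "?P j m" for j m
  proof -
    have f: "fits Z X test" using static by (simp add: test_def)
    have "cost test m + bitlength (val test m) \<le> (weight test + degree_of test) * w"
      using cost_le[OF _ f X, of m] bitlength_val_le[OF _ f X, of m] that by (simp add: w_def algebra_simps)
    also have "\<dots> \<le> 9 * (weight e + degree_of e) * w"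
      using dw by (intro mult_right_mono) (auto simp: test_def)
    finally show ?thesis .
  qed
  have loop: "\<exists>t m' p'. exec n orc T \<omega> (While test (Seq c inc)) (m, p) t (m', p') \<and>
      t \<le> (N - j) * (B + W) + 9 * (weight e + degree_of e) * w \<and> ?P N m' \<and> I N m' p'"
    if "?P j m" "I j m p" "j \<le> N" for j m p
    using that
  proof (induction "N - j" arbitrary: j m p)
    case 0
    then have "j = N" by simp
    then have "val test m = 0" using test_val[OF 0(2)] by simp
    then show ?case
      using exec.exec_While_done[of test m n orc T \<omega> "Seq c inc" p] test_cost[OF 0(2)] 0 \<open>j = N\<close> by auto
  next
    case (Suc k)
    then have j: "j < N" by simp
    obtain t m' p' where 1: "exec n orc T \<omega> c (m, p) t (m', p')" "t \<le> B" "bounded_outside Z X m'"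
      "\<forall>a. a \<notin> writes c \<longrightarrow> m' a = m a" "I (Suc j) (store i 0 (Suc j) m') p'"
      using step[OF j, of m p] Suc.prems unfolding runs_def by blast
    have m'i: "m' i 0 = j" using 1(4) static(3) Suc.prems(1) by auto
    have "simple Z X inc" "safe Z X inc m'"
      using static X N(2) j m'i by (auto simp: inc_def)
    then obtain t' where 2: "exec n orc T \<omega> inc (m', p') t' (run inc m', p')" "t' \<le> com_weight inc * w"
      "bounded_outside Z X (run inc m')"
      using exec_simple[OF X, of Z inc m' n orc T \<omega> p'] 1(3) unfolding w_def by blast
    have run: "run inc m' = store i 0 (Suc j) m'" using m'i by (simp add: inc_def)
    have P: "?P (Suc j) (store i 0 (Suc j) m')"
      using 2(3) 1(4) Suc.prems(1) unfolding run by (auto simp: store_def)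
    have k: "k = N - Suc j" using Suc.hyps(2) by simp
    obtain t'' m'' p'' where 3: "exec n orc T \<omega> (While test (Seq c inc)) (store i 0 (Suc j) m', p') t'' (m'', p'')"
      "t'' \<le> (N - Suc j) * (B + W) + 9 * (weight e + degree_of e) * w" "?P N m''" "I N m'' p''"
      using Suc.hyps(1)[OF k P 1(5)] j by auto
    have "val test m = N - j" by (rule test_val[OF Suc.prems(1)])
    then have "val test m \<noteq> 0" using j by simp
    then have "exec n orc T \<omega> (While test (Seq c inc)) (m, p) (cost test m + bitlength (val test m) + (t + t') + t'') (m'', p'')"
      by (rule exec.exec_While_step[OF _ exec.exec_Seq[OF 1(1) 2(1)[unfolded run]] 3(1)])
    moreover have "cost test m + bitlength (val test m) + (t + t') + t'' \<le> (N - j) * (B + W) + 9 * (weight e + degree_of e) * w"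
    proof -
      have "com_weight inc = 10" by (simp add: inc_def)
      moreover have "w \<le> (weight e + degree_of e) * w" using dw by (cases "weight e") auto
      ultimately have "cost test m + bitlength (val test m) + (t + t') \<le> B + W"
        using test_cost[OF Suc.prems(1)] 1(2) 2(2) by (simp add: W_def for_weight_def algebra_simps)
      moreover have "(N - j) * (B + W) = (B + W) + (N - Suc j) * (B + W)"
        using j by (simp add: Suc_diff_Suc flip: mult_Suc)
      ultimately show ?thesis using 3(2) by linarith
    qed
    ultimately show ?case using 3(3,4) by blast
  qed
  let ?m0 = "store i 0 0 m0"
  have "?P 0 ?m0" using b0 by (auto intro: bounded_outside_store) (auto simp: store_def)
  from loop[OF this init[OF b0]] obtain t m' p' where
    t: "exec n orc T \<omega> (While test (Seq c inc)) (?m0, p0) t (m', p')"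
      "t \<le> N * (B + W) + 9 * (weight e + degree_of e) * w" "?P N m'" "I N m' p'" by auto
  have "simple Z X (Assign i (Lit 0) (Lit 0))" "safe Z X (Assign i (Lit 0) (Lit 0)) m0" by auto
  then obtain t0 where t0: "exec n orc T \<omega> (Assign i (Lit 0) (Lit 0)) (m0, p0) t0 (?m0, p0)" "t0 \<le> 4 * w"
    using exec_simple[OF X, of Z "Assign i (Lit 0) (Lit 0)" m0 n orc T \<omega> p0] b0 by (auto simp: w_def)
  have ex: "exec n orc T \<omega> (for_loop i e c) (m0, p0) (t0 + t) (m', p')"
    unfolding for_loop_def using exec.exec_Seq[OF t0(1) t(1)] by (simp add: test_def inc_def)
  have "w \<le> (weight e + degree_of e) * w" using dw by (cases "weight e") auto
  then have "t0 + t \<le> (N + 1) * (B + W)"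
    using t(2) t0(2) by (simp add: W_def for_weight_def algebra_simps)
  then have "t0 + t \<le> B'" using time by (simp add: W_def w_def)
  moreover have "Q m' p'" using final[of m' p'] t by auto
  moreover have "\<forall>a. a \<notin> writes (for_loop i e c) \<longrightarrow> m' a = m0 a" using exec_writes[OF ex] by auto
  ultimately show "outcome (for_loop i e c) m0 p0 B' Q"
    using ex t(3) by blast
qed

end

section \<open>Orbits and cliques\<close>

text \<open>Row-major adjacency matrix, the format of graphs in memory. Each edge occurs in both
  orders, so that relabelling is merely a permutation of indices.\<close>

definition adj :: "nat \<Rightarrow> graph \<Rightarrow> nat \<Rightarrow> nat" where
  "adj n y p = (if {p div n, p mod n} \<in> y then 1 else 0)"

definition orbit :: "nat \<Rightarrow> graph \<Rightarrow> graph set" where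
  "orbit n x = {relabel \<pi> x | \<pi>. \<pi> permutes {..<n}}"

definition swapped :: "nat \<Rightarrow> nat \<Rightarrow> graph \<Rightarrow> graph" where
  "swapped a b = relabel (Transposition.transpose a b)"

definition insert_new :: "'a \<Rightarrow> 'a list \<Rightarrow> 'a list" where
  "insert_new y ys = (if y \<in> set ys then ys else ys @ [y])"

text \<open>A number \<open>g < n * n\<close> codes an ordered pair of vertices, which makes one
  loop sufficient. Equal and reversed pairs yield only graphs that are already in the list.\<close>

definition expand :: "nat \<Rightarrow> nat \<Rightarrow> nat \<Rightarrow> graph list \<Rightarrow> graph list" where
  "expand n i h ys = fold (\<lambda>g zs. insert_new (swapped (g div n) (g mod n) (zs ! i)) zs) [0..<h] ys"

text \<open>Breadth-first search with the list as its own queue: \<open>i\<close> is the head, new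
  graphs go to the end. Rounds are skipped once \<open>N\<close> graphs are known, so the length
  stays below \<open>N + n * n\<close>; after \<open>N\<close> rounds, a list still shorter than
  \<open>N\<close> has been processed completely.\<close>

definition orbit_list :: "nat \<Rightarrow> nat \<Rightarrow> nat \<Rightarrow> graph \<Rightarrow> graph list" where
  "orbit_list n N m x =
     fold (\<lambda>i ys. if i < length ys \<and> length ys < N then expand n i (n * n) ys else ys) [0..<m] [x]"

lemma pair_index_less: "u < n \<Longrightarrow> v < n \<Longrightarrow> u * n + v < n * (n :: nat)"
proof -
  assume "u < n" "v < n"
  then have "u * n + v < Suc u * n" by simp
  also have "\<dots> \<le> n * n" using \<open>u < n\<close> by (intro mult_le_mono1) simp
  finally show ?thesis .
qed

lemma graphs_edge:
  "y \<in> graphs n \<Longrightarrow> e \<in> y \<Longrightarrow> \<exists>u v. u < v \<and> v < n \<and> e = {u, v}"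
proof -
  assume "y \<in> graphs n" "e \<in> y"
  then have "e \<subseteq> {..<n}" "card e = 2" by (auto simp: graphs_def)
  then obtain u v where "e = {u, v}" "u \<noteq> v" by (auto simp: card_2_iff)
  then have "u < v \<or> v < u" "u < n" "v < n" "e = {v, u}" using \<open>e \<subseteq> {..<n}\<close> by auto
  then show ?thesis using \<open>e = {u, v}\<close> by metis
qed

lemma adj_pair: "u < n \<Longrightarrow> v < n \<Longrightarrow> adj n y (u * n + v) = (if {u, v} \<in> y then 1 else 0)"
  by (simp add: adj_def)

lemma graph_eqI:
  assumes "y \<in> graphs n" "z \<in> graphs n" "\<And>p. p < n * n \<Longrightarrow> adj n y p = adj n z p"
  shows "y = z"
proof -
  have *: "{u, v} \<in> y \<longleftrightarrow> {u, v} \<in> z" if "u < v" "v < n" for u v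
    using assms(3)[of "u * n + v"] that pair_index_less[of u n v] by (simp add: adj_pair split: if_splits)
  show ?thesis
  proof (intro equalityI subsetI)
    fix e assume "e \<in> y"
    then show "e \<in> z" using graphs_edge[OF assms(1)] * by metis
  next
    fix e assume "e \<in> z"
    then show "e \<in> y" using graphs_edge[OF assms(2)] * by metis
  qed
qed

lemma graphs_no_loop: "y \<in> graphs n \<Longrightarrow> {u} \<notin> y"
  by (auto simp: graphs_def)

lemma relabel_comp: "relabel (\<pi> \<circ> \<sigma>) y = relabel \<pi> (relabel \<sigma> y)"
  by (simp add: relabel_def image_comp[symmetric] image_image o_def)

lemma relabel_id [simp]: "relabel id y = y"
  by (simp add: relabel_def)

lemma relabel_in_graphs:
  assumes "y \<in> graphs n" "\<pi> permutes {..<n}"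
  shows "relabel \<pi> y \<in> graphs n"
proof -
  have "\<pi> ` e \<subseteq> {..<n} \<and> card (\<pi> ` e) = 2" if "e \<in> y" for e
  proof -
    have "e \<subseteq> {..<n}" "card e = 2" using that assms(1) by (auto simp: graphs_def)
    then show ?thesis
      using permutes_image[OF assms(2)] card_image[of \<pi> e] inj_on_subset[OF permutes_inj[OF assms(2)], of e]
      by auto
  qed
  then show ?thesis by (auto simp: graphs_def relabel_def)
qed

lemma mem_relabel:
  assumes "\<pi> permutes {..<n}"
  shows "\<pi> ` e \<in> relabel \<pi> y \<longleftrightarrow> e \<in> y"
  using inj_image_eq_iff[OF permutes_inj[OF assms]] by (auto simp: relabel_def)

lemma transpose_permutes:
  "a < n \<Longrightarrow> b < n \<Longrightarrow> Transposition.transpose a b permutes {..<n}"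
  by (rule permutes_swap_id) auto

text \<open>A transposition is its own inverse, so the new entry is read at the transposed position
  of the old matrix.\<close>

lemma adj_swapped:
  assumes "a < n" "b < n" "p < n * n"
  shows "adj n (swapped a b y) p =
    adj n y (Transposition.transpose a b (p div n) * n + Transposition.transpose a b (p mod n))"
proof -
  let ?\<tau> = "Transposition.transpose a b"
  have "p div n < n" "p mod n < n" using assms by (auto simp: less_mult_imp_div_less)
  moreover have "?\<tau> u < n" if "u < n" for u using that assms by (auto simp: Transposition.transpose_def)
  moreover have "{u, v} \<in> swapped a b y \<longleftrightarrow> {?\<tau> u, ?\<tau> v} \<in> y" for u v
    using mem_relabel[OF transpose_permutes[OF assms(1,2)], of "{?\<tau> u, ?\<tau> v}" y] by (simp add: swapped_def)
  ultimately show ?thesis by (simp add: adj_pair) (simp add: adj_def)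
qed

lemma orbit_subset_graphs: "x \<in> graphs n \<Longrightarrow> orbit n x \<subseteq> graphs n"
  by (auto simp: orbit_def relabel_in_graphs)

lemma orbit_relabel: "y \<in> orbit n x \<Longrightarrow> \<pi> permutes {..<n} \<Longrightarrow> relabel \<pi> y \<in> orbit n x"
  by (auto simp: orbit_def relabel_comp[symmetric] intro: permutes_compose)

lemma self_in_orbit: "x \<in> orbit n x"
  unfolding orbit_def by (force intro: permutes_id exI[of _ id])

lemma iso_invariant_orbit: "iso_invariant n h \<Longrightarrow> x \<in> graphs n \<Longrightarrow> y \<in> orbit n x \<Longrightarrow> h y = h x"
  by (auto simp: orbit_def iso_invariant_def)

section \<open>Breadth-first enumeration of an orbit\<close>

lemma expand_Suc:
  "expand n i (Suc h) ys = insert_new (swapped (h div n) (h mod n) (expand n i h ys ! i)) (expand n i h ys)"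
  by (simp add: expand_def)

lemma expand_0 [simp]: "expand n i 0 ys = ys"
  by (simp add: expand_def)

lemma orbit_list_Suc:
  "orbit_list n N (Suc m) x = (let ys = orbit_list n N m x in
     if m < length ys \<and> length ys < N then expand n m (n * n) ys else ys)"
  by (simp add: orbit_list_def Let_def)

lemma orbit_list_0 [simp]: "orbit_list n N 0 x = [x]"
  by (simp add: orbit_list_def)

lemma expand_props:
  assumes "distinct ys" "set ys \<subseteq> orbit n x" "i < length ys" "h \<le> n * n"
  shows "distinct (expand n i h ys) \<and> set (expand n i h ys) \<subseteq> orbit n x \<and>
    length (expand n i h ys) \<le> length ys + h \<and> (\<exists>zs. expand n i h ys = ys @ zs) \<and>
    (\<forall>g<h. swapped (g div n) (g mod n) (ys ! i) \<in> set (expand n i h ys))"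
  using assms(4)
proof (induction h)
  case (Suc h)
  let ?E = "expand n i h ys"
  have IH: "distinct ?E" "set ?E \<subseteq> orbit n x" "length ?E \<le> length ys + h" "\<exists>zs. ?E = ys @ zs"
    "\<forall>g<h. swapped (g div n) (g mod n) (ys ! i) \<in> set ?E" using Suc by auto
  have "?E ! i = ys ! i" using IH(4) assms(3) by (auto simp: nth_append)
  moreover have "0 < n" using Suc.prems by (cases n) auto
  then have "h div n < n" "h mod n < n" using Suc.prems by (auto simp: less_mult_imp_div_less)
  then have "swapped (h div n) (h mod n) (ys ! i) \<in> orbit n x"
    unfolding swapped_def using assms(2,3) by (intro orbit_relabel transpose_permutes) (auto dest: nth_mem)
  ultimately show ?case using IH by (auto simp: expand_Suc insert_new_def less_Suc_eq)
qed (use assms in auto)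

text \<open>The last conjunct is the search invariant: entries before the queue head have all their
  images under transpositions in the list. It is claimed only below length \<open>N\<close>, because
  later entries are no longer expanded.\<close>

lemma orbit_list_props:
  assumes "0 < N"
  shows "distinct (orbit_list n N m x) \<and> set (orbit_list n N m x) \<subseteq> orbit n x \<and>
    length (orbit_list n N m x) \<le> N + n * n \<and> (\<exists>zs. orbit_list n N m x = x # zs) \<and>
    (length (orbit_list n N m x) < N \<longrightarrow>
      (\<forall>i < min m (length (orbit_list n N m x)). \<forall>g<n * n.
        swapped (g div n) (g mod n) (orbit_list n N m x ! i) \<in> set (orbit_list n N m x)))"
proof (induction m)
  case 0
  then show ?case using assms by (auto simp: self_in_orbit)
next
  case (Suc m)
  let ?L = "orbit_list n N m x"
  show ?case
  proof (cases "m < length ?L \<and> length ?L < N")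
    case False
    then have "orbit_list n N (Suc m) x = ?L" by (auto simp: orbit_list_Suc Let_def)
    \<comment> \<open>A round skipped while the list is short means that the queue is exhausted, so
      there is no new entry to be closed under transpositions.\<close>
    moreover have "min (Suc m) (length ?L) = min m (length ?L)" if "length ?L < N"
      using that False by auto
    ultimately show ?thesis using Suc by auto
  next
    case True
    let ?E = "expand n m (n * n) ?L"
    have E: "distinct ?E" "set ?E \<subseteq> orbit n x" "length ?E \<le> length ?L + n * n" "\<exists>zs. ?E = ?L @ zs"
      "\<forall>g<n * n. swapped (g div n) (g mod n) (?L ! m) \<in> set ?E"
      using expand_props[of ?L n x m "n * n"] Suc True by auto
    then obtain zs where zs: "?E = ?L @ zs" by auto
    have "swapped (g div n) (g mod n) (?E ! i) \<in> set ?E" if "i < Suc m" "g < n * n" for i g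
    proof (cases "i = m")
      case True
      then show ?thesis using E(5) that zs \<open>m < length ?L \<and> length ?L < N\<close> by (simp add: nth_append)
    next
      case False
      then have "i < m" using that by simp
      then show ?thesis using Suc True that zs by (auto simp: nth_append)
    qed
    moreover have "orbit_list n N (Suc m) x = ?E" using True by (simp add: orbit_list_Suc Let_def)
    moreover have "\<exists>zs. ?E = x # zs" using Suc zs by auto
    ultimately show ?thesis using E True by auto
  qed
qed

text \<open>The list contains \<open>x\<close> and is closed under transpositions, which generate
  the symmetric group.\<close>

lemma orbit_list_complete:
  assumes "0 < N" "length (orbit_list n N N x) < N"
  shows "set (orbit_list n N N x) = orbit n x"
proof -
  let ?L = "orbit_list n N N x"
  have closed: "swapped a b y \<in> set ?L" if "a < n" "b < n" and y: "y \<in> set ?L" for a b y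
  proof -
    obtain i where "i < length ?L" "y = ?L ! i" using y by (metis in_set_conv_nth)
    moreover have "\<forall>i < min N (length ?L). \<forall>g<n * n. swapped (g div n) (g mod n) (?L ! i) \<in> set ?L"
      using orbit_list_props[OF assms(1), of n N x] assms(2) by blast
    moreover have "i < min N (length ?L)" using \<open>i < length ?L\<close> assms(2) by simp
    ultimately have "swapped ((a * n + b) div n) ((a * n + b) mod n) y \<in> set ?L"
      using pair_index_less[OF that(1,2)] by blast
    then show ?thesis using that(1,2) by simp
  qed
  have x: "x \<in> set ?L" using orbit_list_props[OF assms(1), of n N x] by auto
  have "relabel \<pi> x \<in> set ?L" if "\<pi> permutes {..<n}" for \<pi>
    using that finite_lessThan
  proof (induction rule: permutes_induct)
    case (swap a b p)
    then show ?case using closed[of a b "relabel p x"] unfolding swapped_def relabel_comp by auto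
  qed (simp only: relabel_id x)
  then show ?thesis using orbit_list_props[OF assms(1), of n N x] by (auto simp: orbit_def)
qed

section \<open>Double counting of cliques in an orbit\<close>

definition is_clique :: "graph \<Rightarrow> nat set \<Rightarrow> bool" where
  "is_clique x K \<longleftrightarrow> (\<forall>u\<in>K. \<forall>v\<in>K. u \<noteq> v \<longrightarrow> {u, v} \<in> x)"

lemma is_clique_relabel:
  assumes "\<pi> permutes {..<n}"
  shows "is_clique (relabel \<pi> x) (\<pi> ` K) \<longleftrightarrow> is_clique x K"
  using mem_relabel[OF assms, of "{_, _}" x] inj_eq[OF permutes_inj[OF assms]] by (auto simp: is_clique_def)

lemma card_cliques_relabel:
  assumes "\<pi> permutes {..<n}"
  shows "card (cliques n k (relabel \<pi> x)) = card (cliques n k x)"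
proof (rule bij_betw_same_card[symmetric], rule bij_betw_imageI)
  let ?f = "\<lambda>K. \<pi> ` K"
  show "inj_on ?f (cliques n k x)"
    by (auto intro: inj_onI simp: inj_image_eq_iff[OF permutes_inj[OF assms]])
  have cl: "cliques n j y = {K. K \<subseteq> {..<n} \<and> card K = j \<and> is_clique y K}" for y j
    by (auto simp: cliques_def is_clique_def)
  have card: "card (\<pi> ` K) = card K" for K
    by (meson assms card_image inj_on_subset permutes_inj subset_UNIV)
  show "?f ` cliques n k x = cliques n k (relabel \<pi> x)"
  proof (intro equalityI subsetI)
    fix K assume "K \<in> ?f ` cliques n k x"
    then obtain K' where K': "K = \<pi> ` K'" "K' \<subseteq> {..<n}" "card K' = k" "is_clique x K'" by (auto simp: cl)
    moreover have "\<pi> ` K' \<subseteq> {..<n}" using K'(2) permutes_image[OF assms] by blast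
    ultimately show "K \<in> cliques n k (relabel \<pi> x)" by (auto simp: cl card is_clique_relabel[OF assms])
  next
    fix K assume K: "K \<in> cliques n k (relabel \<pi> x)"
    have "\<pi> ` (inv \<pi> ` K) = K" by (simp add: image_comp permutes_inv_o[OF assms])
    moreover have "inv \<pi> ` K \<subseteq> {..<n}" using K permutes_image[OF permutes_inv[OF assms]] by (auto simp: cl)
    ultimately show "K \<in> ?f ` cliques n k x"
      using K card[of "inv \<pi> ` K"] is_clique_relabel[OF assms, of x "inv \<pi> ` K"]
      by (intro image_eqI[of _ _ "inv \<pi> ` K"]) (auto simp: cl)
  qed
qed

text \<open>A bijection between two \<open>k\<close>-sets extends to a permutation by matching their
  complements. Thus \<open>{..<k}\<close> can represent all \<open>k\<close>-sets in the double
  counting.\<close>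

lemma permutation_onto_initial:
  assumes "K \<subseteq> {..<n}" "card K = k"
  shows "\<exists>\<pi>. \<pi> permutes {..<n} \<and> \<pi> ` {..<k} = K"
proof -
  have fin: "finite K" using assms(1) finite_subset by blast
  have "k \<le> n" using card_mono[OF _ assms(1)] assms(2) by simp
  obtain f where f: "bij_betw f {..<k} K" using finite_same_card_bij[of "{..<k}" K] fin assms(2) by auto
  obtain g where g: "bij_betw g ({..<n} - {..<k}) ({..<n} - K)"
    using finite_same_card_bij[of "{..<n} - {..<k}" "{..<n} - K"] assms \<open>k \<le> n\<close> fin
    by (auto simp: card_Diff_subset)
  define \<pi> where "\<pi> i = (if i < k then f i else if i < n then g i else i)" for i
  have "bij_betw \<pi> {..<k} K" using f by (rule bij_betw_cong[THEN iffD1, rotated]) (simp add: \<pi>_def)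
  moreover have "bij_betw \<pi> ({..<n} - {..<k}) ({..<n} - K)"
    using g by (rule bij_betw_cong[THEN iffD1, rotated]) (simp add: \<pi>_def)
  ultimately have "bij_betw \<pi> ({..<k} \<union> ({..<n} - {..<k})) (K \<union> ({..<n} - K))"
    by (rule bij_betw_combine) auto
  moreover have "{..<k} \<union> ({..<n} - {..<k}) = {..<n}" "K \<union> ({..<n} - K) = {..<n}"
    using assms(1) \<open>k \<le> n\<close> by auto
  ultimately have "bij_betw \<pi> {..<n} {..<n}" by simp
  then have "\<pi> permutes {..<n}" by (rule bij_imp_permutes) (use \<open>k \<le> n\<close> in \<open>simp add: \<pi>_def\<close>)
  then show ?thesis using \<open>bij_betw \<pi> {..<k} K\<close> by (auto simp: bij_betw_def)
qed

text \<open>Double counting of the pairs of a graph in the orbit and a \<open>k\<close>-clique in it: every graph in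
  the orbit has equally many \<open>k\<close>-cliques, and every \<open>k\<close>-set is a clique of equally many graphs in
  the orbit.\<close>

lemma card_cliques_orbit:
  assumes "x \<in> graphs n"
  shows "card (cliques n k x) * card (orbit n x) =
    (n choose k) * card {y \<in> orbit n x. is_clique y {..<k}}"
proof -
  let ?O = "orbit n x" and ?K = "{K. K \<subseteq> {..<n} \<and> card K = k}"
  have finO: "finite ?O" using orbit_subset_graphs[OF assms] by (rule finite_subset) (simp add: graphs_def)
  have finK: "finite ?K" by simp
  have cl: "cliques n k y = {K \<in> ?K. is_clique y K}" for y
    by (auto simp: cliques_def is_clique_def)
  have "card (cliques n k x) * card ?O = (\<Sum>y\<in>?O. card (cliques n k y))"
    by (subst sum.cong[OF refl, of _ _ "\<lambda>_. card (cliques n k x)"]) (auto simp: orbit_def card_cliques_relabel)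
  also have "\<dots> = (\<Sum>y\<in>?O. \<Sum>K\<in>?K. if is_clique y K then 1 else 0)"
    using finK by (intro sum.cong) (auto simp: cl sum.If_cases Int_def)
  also have "\<dots> = (\<Sum>K\<in>?K. \<Sum>y\<in>?O. if is_clique y K then 1 else 0)"
    by (rule sum.swap)
  also have "\<dots> = (\<Sum>K\<in>?K. card {y \<in> ?O. is_clique y K})"
    using finO by (intro sum.cong) (auto simp: sum.If_cases Int_def)
  also have "\<dots> = (\<Sum>K\<in>?K. card {y \<in> ?O. is_clique y {..<k}})"
  proof (intro sum.cong refl)
    fix K assume "K \<in> ?K"
    then obtain \<pi> where \<pi>: "\<pi> permutes {..<n}" "\<pi> ` {..<k} = K" using permutation_onto_initial by blast
    have inv: "relabel (inv \<pi>) (relabel \<pi> y) = y" "relabel \<pi> (relabel (inv \<pi>) y) = y" for y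
      using permutes_inv_o[OF \<pi>(1)] by (simp_all flip: relabel_comp)
    \<comment> \<open>Relabelling with \<pi> permutes the orbit and moves a clique on
      \<open>{..<k}\<close> to a clique on \<open>K\<close>.\<close>
    have "bij_betw (relabel \<pi>) {y \<in> ?O. is_clique y {..<k}} {y \<in> ?O. is_clique y K}"
    proof (rule bij_betw_byWitness[where f' = "relabel (inv \<pi>)"])
      show "relabel \<pi> ` {y \<in> ?O. is_clique y {..<k}} \<subseteq> {y \<in> ?O. is_clique y K}"
        using is_clique_relabel[OF \<pi>(1), of _ "{..<k}"] \<pi>(2) orbit_relabel[OF _ \<pi>(1)] by auto
      show "relabel (inv \<pi>) ` {y \<in> ?O. is_clique y K} \<subseteq> {y \<in> ?O. is_clique y {..<k}}"
        using is_clique_relabel[OF \<pi>(1), of "relabel (inv \<pi>) _" "{..<k}"] \<pi>(2)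
          orbit_relabel[OF _ permutes_inv[OF \<pi>(1)]] by (auto simp: inv)
    qed (simp_all add: inv)
    then show "card {y \<in> ?O. is_clique y K} = card {y \<in> ?O. is_clique y {..<k}}"
      by (simp add: bij_betw_same_card)
  qed
  also have "\<dots> = (n choose k) * card {y \<in> ?O. is_clique y {..<k}}"
    using n_subsets[of "{..<n}" k] by simp
  finally show ?thesis .
qed

section \<open>Edge indicator vectors\<close>

lemma graph_of_vector_eq:
  assumes "y \<in> graphs n" "\<And>u v. u < v \<Longrightarrow> v < n \<Longrightarrow> f (edge_pos u v) = (if {u, v} \<in> y then 1 else 0)"
  shows "graph_of_vector n f = y"
proof -
  have "e \<in> y" if "u < v" "v < n" "f (edge_pos u v) \<noteq> 0" "e = {u, v}" for u v e
    using assms(2)[OF that(1,2)] that by (simp split: if_splits)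
  moreover have "\<exists>u v. e = {u, v} \<and> u < v \<and> v < n \<and> f (edge_pos u v) \<noteq> 0" if "e \<in> y" for e
    using graphs_edge[OF assms(1) that] assms(2) that by fastforce
  ultimately show ?thesis unfolding graph_of_vector_def by blast
qed

text \<open>The pairs with larger vertex \<open>v\<close> fill a block of \<open>v\<close> positions
  from \<open>v choose 2\<close> on; it ends where the next block begins, as
  \<open>(v choose 2) + v = Suc v choose 2\<close>.\<close>

lemma edge_pos_mono: "u < v \<Longrightarrow> v < v' \<Longrightarrow> edge_pos u v < edge_pos u' v'"
proof -
  assume "u < v" "v < v'"
  have "Suc v choose 2 \<le> v' choose 2" using \<open>v < v'\<close>
    unfolding choose_two by (intro div_le_mono mult_le_mono) auto
  moreover have "Suc v choose 2 = (v choose 2) + v" by (simp add: numeral_2_eq_2)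
  ultimately show ?thesis using \<open>u < v\<close> by (simp add: edge_pos_def)
qed

lemma edge_pos_inj:
  assumes "u < v" "u' < v'" "edge_pos u v = edge_pos u' v'"
  shows "u = u' \<and> v = v'"
proof -
  have "v = v'" using edge_pos_mono[of u v v' u'] edge_pos_mono[of u' v' v u] assms
    by (metis less_irrefl linorder_cases)
  then show ?thesis using assms(3) by (simp add: edge_pos_def)
qed

lemma indicator_vector_edge_pos:
  "u < v \<Longrightarrow> indicator_vector x (edge_pos u v) = (if {u, v} \<in> x then 1 else 0)"
  unfolding indicator_vector_def using edge_pos_inj by fastforce

lemma indicator_vector_le_1: "indicator_vector x i \<le> 1"
  by (simp add: indicator_vector_def)

lemma finite_graphs [simp]: "finite (graphs n)"
  by (simp add: graphs_def)

lemma card_graphs: "card (graphs n) = 2 ^ (n choose 2)"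
  using n_subsets[of "{..<n}" 2] by (simp add: graphs_def card_Pow)

section \<open>Chernoff bounds by counting\<close>

text \<open>With \<open>z = exp l\<close> for \<open>l = \<tau> - q\<close>, the moment generating function of a sum of \<open>N\<close> Bernoulli
  variables of mean \<open>q\<close> is small compared to \<open>z powr (\<tau> N)\<close>.\<close>

lemma chernoff_estimate:
  fixes q \<tau> :: real
  assumes "0 \<le> q" "q \<le> \<tau>" "\<tau> \<le> 1/2"
  shows "(1 + q * (exp (\<tau> - q) - 1)) ^ N \<le> exp (\<tau> - q) powr (\<tau> * N) * exp (- (\<tau> - q)\<^sup>2 * N / 2)"
proof -
  let ?l = "\<tau> - q"
  have "1 + q * (exp ?l - 1) \<le> exp (q * (exp ?l - 1))" by (rule exp_ge_add_one_self)
  \<comment> \<open>On [0, 1], exp l \<le> 1 + l + l^2. The bound q \<le> 1/2 then halves the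
    quadratic term, and q l = \<tau> l - l^2 leaves a net gain of l^2 / 2.\<close>
  also have "q * (exp ?l - 1) \<le> q * (?l + ?l\<^sup>2)"
    using exp_bound[of ?l] assms by (intro mult_left_mono) auto
  also have "\<dots> \<le> q * ?l + ?l\<^sup>2 / 2"
    using mult_right_mono[of q "1/2" "?l\<^sup>2"] assms by (simp add: algebra_simps)
  also have "\<dots> = ?l * \<tau> - ?l\<^sup>2 / 2" by (simp add: power2_eq_square algebra_simps)
  finally have "(1 + q * (exp ?l - 1)) ^ N \<le> exp (?l * \<tau> - ?l\<^sup>2 / 2) ^ N"
    using assms by (intro power_mono) (auto intro!: add_nonneg_nonneg mult_nonneg_nonneg)
  also have "\<dots> = exp (?l * (\<tau> * N)) * exp (- ?l\<^sup>2 * N / 2)"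
    by (simp add: exp_of_nat_mult[symmetric] exp_add[symmetric] algebra_simps)
  also have "exp (?l * (\<tau> * N)) = exp ?l powr (\<tau> * N)" by (simp add: powr_def mult.commute)
  finally show ?thesis .
qed

text \<open>The binomial theorem, expanded over subsets instead of sizes: with
  \<open>c = z - 1\<close> it writes a power of \<open>z\<close> as a sum over sets
  \<open>J\<close>, which can be averaged one by one.\<close>

lemma sum_Pow_power_card:
  fixes c :: real
  assumes "finite W"
  shows "(\<Sum>J\<in>Pow W. c ^ card J) = (1 + c) ^ card W"
  using assms
proof (induction W rule: finite_induct)
  case (insert a W)
  have "(\<Sum>J\<in>Pow (insert a W). c ^ card J) = (\<Sum>J\<in>Pow W. c ^ card J) + (\<Sum>J\<in>insert a ` Pow W. c ^ card J)"
    using insert by (subst Pow_insert, subst sum.union_disjoint) auto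
  also have "(\<Sum>J\<in>insert a ` Pow W. c ^ card J) = (\<Sum>J\<in>Pow W. c ^ card (insert a J))"
    using insert by (subst sum.reindex) (auto simp: inj_on_def o_def)
  also have "\<dots> = (\<Sum>J\<in>Pow W. c * c ^ card J)"
    using insert by (intro sum.cong refl) (auto simp: card_insert_if finite_subset)
  finally show ?case using insert by (simp add: sum_distrib_left[symmetric] algebra_simps)
qed simp

text \<open>Passing from \<open>j\<close> to \<open>j + 1\<close> multiplies the left side by 1 - s
  / (u - j) \<le> 1 - s / u: in a random set without replacement, missing some elements makes
  missing the next one less likely.\<close>

lemma binomial_avoid_le:
  assumes "s \<le> u" "0 < u"
  shows "real ((u - j) choose s) \<le> real (u choose s) * ((real u - real s) / real u) ^ j"
proof (induction j)
  case (Suc j)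
  let ?q = "(real u - real s) / real u"
  have q: "0 \<le> ?q" using assms by simp
  have "real ((u - Suc j) choose s) \<le> real ((u - j) choose s) * ?q"
  proof (cases "s < u - j")
    case True
    define a where "a = u - Suc j"
    have a: "u - j = Suc a" "s \<le> a" using True by (auto simp: a_def)
    have "(Suc a - s) * (Suc a choose s) = Suc a * (a choose s)"
      using binomial_absorb_comp[of "Suc a" s] by simp
    then have "real (Suc a - s) * real (Suc a choose s) = real (Suc a) * real (a choose s)"
      by (simp only: flip: of_nat_mult)
    then have "real (a choose s) = real (Suc a choose s) * ((real (Suc a) - real s) / real (Suc a))"
      using a by (simp add: of_nat_diff field_simps)
    also have "(real (Suc a) - real s) / real (Suc a) \<le> ?q"
    proof -
      have "real s / real u \<le> real s / real (Suc a)"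
        using a assms by (intro divide_left_mono) (auto simp: a_def)
      then show ?thesis using assms by (simp add: diff_divide_distrib)
    qed
    finally show ?thesis using a by (simp add: a_def mult_left_mono)
  next
    \<comment> \<open>No \<open>s\<close>-subset survives a further removal, unless
      \<open>s = 0\<close>; the empty set always survives, and then the factor is 1.\<close>
    case False
    show ?thesis
    proof (cases "s = 0")
      case True
      then show ?thesis using assms by simp
    next
      case s: False
      then have "real ((u - Suc j) choose s) = 0" using False by (simp add: binomial_eq_0)
      then show ?thesis using q by (metis mult_nonneg_nonneg of_nat_0_le_iff)
    qed
  qed
  also have "\<dots> \<le> (real (u choose s) * ?q ^ j) * ?q" using Suc q by (intro mult_right_mono) auto
  finally show ?case by (simp add: algebra_simps)
qed simp

text \<open>The probability that a fixed \<open>j\<close>-set avoids a random \<open>s\<close>-subset is at most what it would be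
  for independent draws; expanding \<open>z ^ X = \<Sum> (z - 1) ^ card J\<close> over the subsets \<open>J\<close> of
  \<open>W - S\<close> thus compares the moment generating functions.\<close>

lemma hypergeometric_mgf:
  fixes z :: real
  assumes "finite U" "card U = u" "0 < u" "s \<le> u" "W \<subseteq> U" "1 \<le> z"
  shows "(\<Sum>S | S \<subseteq> U \<and> card S = s. z ^ card (W - S))
    \<le> real (u choose s) * (1 + (real u - real s) / real u * (z - 1)) ^ card W"
proof -
  let ?A = "{S. S \<subseteq> U \<and> card S = s}" and ?q = "(real u - real s) / real u"
  have finW: "finite W" using assms finite_subset by blast
  have finA: "finite ?A" using assms by simp
  have "(\<Sum>S\<in>?A. z ^ card (W - S)) = (\<Sum>S\<in>?A. \<Sum>J\<in>Pow W. if J \<inter> S = {} then (z - 1) ^ card J else 0)"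
  proof (intro sum.cong refl)
    fix S
    have "z ^ card (W - S) = (\<Sum>J\<in>Pow (W - S). (z - 1) ^ card J)"
      using sum_Pow_power_card[of "W - S" "z - 1"] finW by simp
    also have "\<dots> = (\<Sum>J\<in>Pow W. if J \<inter> S = {} then (z - 1) ^ card J else 0)"
      using finW by (intro sum.mono_neutral_cong_left) auto
    finally show "z ^ card (W - S) = (\<Sum>J\<in>Pow W. if J \<inter> S = {} then (z - 1) ^ card J else 0)" .
  qed
  also have "\<dots> = (\<Sum>J\<in>Pow W. \<Sum>S\<in>?A. if J \<inter> S = {} then (z - 1) ^ card J else 0)"
    by (rule sum.swap)
  also have "\<dots> \<le> (\<Sum>J\<in>Pow W. real (u choose s) * (?q * (z - 1)) ^ card J)"
  proof (intro sum_mono)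
    fix J assume J: "J \<in> Pow W"
    then have finJ: "finite J" using finW finite_subset by blast
    have "(\<Sum>S\<in>?A. if J \<inter> S = {} then (z - 1) ^ card J else 0) = real (card {S \<in> ?A. J \<inter> S = {}}) * (z - 1) ^ card J"
      using finA by (simp add: sum.If_cases Int_def)
    also have "{S \<in> ?A. J \<inter> S = {}} = {S. S \<subseteq> U - J \<and> card S = s}" by blast
    also have "card \<dots> = ((u - card J) choose s)"
      using n_subsets[of "U - J" s] assms J finJ by (simp add: card_Diff_subset)
    also have "real \<dots> * (z - 1) ^ card J \<le> (real (u choose s) * ?q ^ card J) * (z - 1) ^ card J"
      using binomial_avoid_le[OF assms(4,3)] assms(6) by (intro mult_right_mono) auto
    finally show "(\<Sum>S\<in>?A. if J \<inter> S = {} then (z - 1) ^ card J else 0) \<le> real (u choose s) * (?q * (z - 1)) ^ card J"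
      by (simp only: power_mult_distrib mult.assoc)
  qed
  also have "\<dots> = real (u choose s) * (1 + ?q * (z - 1)) ^ card W"
    using sum_Pow_power_card[OF finW] by (simp add: sum_distrib_left[symmetric])
  finally show ?thesis .
qed

text \<open>Markov's inequality for \<open>z ^ card (W - S)\<close> under a uniform
  \<open>S\<close>, multiplied by the number of sets to stay with counting. The quotient
  \<open>(u - s) / u\<close> is the probability that \<open>S\<close> misses a fixed
  element.\<close>

lemma hypergeometric_tail:
  assumes "finite U" "card U = u" "0 < u" "s \<le> u" "W \<subseteq> U"
    and "(real u - real s) / real u \<le> \<tau>" "\<tau> \<le> 1/2"
  shows "real (card {S. S \<subseteq> U \<and> card S = s \<and> \<tau> * card W < card (W - S)})
    \<le> real (u choose s) * exp (- (\<tau> - (real u - real s) / real u)\<^sup>2 * card W / 2)"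
proof -
  let ?q = "(real u - real s) / real u"
  let ?A = "{S. S \<subseteq> U \<and> card S = s}" and ?z = "exp (\<tau> - ?q)"
  let ?B = "{S. S \<subseteq> U \<and> card S = s \<and> \<tau> * card W < card (W - S)}"
  have finA: "finite ?A" using assms by simp
  have z: "1 \<le> ?z" using assms(6) by simp
  have "real (card ?B) * ?z powr (\<tau> * card W) = (\<Sum>S\<in>?B. ?z powr (\<tau> * card W))" by simp
  also have "\<dots> \<le> (\<Sum>S\<in>?B. ?z ^ card (W - S))"
    using z by (intro sum_mono) (auto simp: powr_realpow[symmetric] intro!: powr_mono)
  also have "\<dots> \<le> (\<Sum>S\<in>?A. ?z ^ card (W - S))"
    using finA by (intro sum_mono2) auto
  also have "\<dots> \<le> real (u choose s) * (1 + ?q * (?z - 1)) ^ card W"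
    by (rule hypergeometric_mgf[OF assms(1-5) z])
  also have "\<dots> \<le> real (u choose s) * (?z powr (\<tau> * card W) * exp (- (\<tau> - ?q)\<^sup>2 * card W / 2))"
    using assms by (intro mult_left_mono chernoff_estimate) auto
  finally have "real (card ?B) * ?z powr (\<tau> * card W) \<le>
    (real (u choose s) * exp (- (\<tau> - ?q)\<^sup>2 * card W / 2)) * ?z powr (\<tau> * card W)"
    by (simp add: mult_ac)
  then show ?thesis by (rule mult_right_le_imp_le) simp
qed

section \<open>Majority of random samples\<close>

lemma prob_space_coins: "prob_space coins"
  unfolding coins_def by (intro prob_space_PiM measure_pmf.prob_space_axioms)

text \<open>The event is a cylinder of the product measure. Measurability is included because finite
  unions of these events are formed next.\<close>

lemma measure_coins_prefix_eq:
  "{\<omega>. map \<omega> [0..<length bs] = bs} \<in> sets coins \<and>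
   measure coins {\<omega>. map \<omega> [0..<length bs] = bs} = 1 / 2 ^ length bs"
proof -
  let ?M = "\<lambda>_ :: nat. measure_pmf (bernoulli_pmf (1/2))"
  interpret product_prob_space ?M UNIV
    by (intro product_prob_spaceI measure_pmf.prob_space_axioms)
  let ?X = "\<lambda>i. {bs ! i}"
  have eq: "{\<omega>. map \<omega> [0..<length bs] = bs} = prod_emb UNIV ?M {..<length bs} (Pi\<^sub>E {..<length bs} ?X)"
  proof (intro set_eqI)
    fix \<omega>
    have "map \<omega> [0..<length bs] = bs \<longleftrightarrow> (\<forall>i<length bs. \<omega> i = bs ! i)"
      by (subst list_eq_iff_nth_eq) (simp only: length_map length_upt diff_zero simp_thms nth_map_upt add_0 cong: conj_cong imp_cong)
    also have "\<dots> \<longleftrightarrow> \<omega> \<in> prod_emb UNIV ?M {..<length bs} (Pi\<^sub>E {..<length bs} ?X)"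
      by (simp add: prod_emb_def restrict_PiE_iff Pi_iff Ball_def)
    finally show "\<omega> \<in> {\<omega>. map \<omega> [0..<length bs] = bs} \<longleftrightarrow>
      \<omega> \<in> prod_emb UNIV ?M {..<length bs} (Pi\<^sub>E {..<length bs} ?X)" by simp
  qed
  have "emeasure coins {\<omega>. map \<omega> [0..<length bs] = bs} = (\<Prod>i<length bs. emeasure (?M i) (?X i))"
    using emeasure_PiM_emb[of "{..<length bs}" ?X] by (simp only: eq coins_def sets_measure_pmf UNIV_I subset_UNIV finite_lessThan)
  also have "\<dots> = (\<Prod>i<length bs. ennreal (1/2))"
    by (intro prod.cong refl) (simp add: emeasure_pmf_single)
  also have "\<dots> = ennreal ((1/2) ^ length bs)"
    by (subst prod_constant, subst ennreal_power) simp_all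
  finally have "measure coins {\<omega>. map \<omega> [0..<length bs] = bs} = (1/2) ^ length bs"
    by (simp add: measure_def)
  moreover have "{\<omega>. map \<omega> [0..<length bs] = bs} \<in> sets coins"
    unfolding eq coins_def by (rule sets_PiM_I) auto
  ultimately show ?thesis by (simp add: power_divide)
qed

lemma finite_bits: "finite {bs :: bool list. length bs = m \<and> P bs}"
  by (rule finite_subset[OF _ finite_lists_length_eq[of UNIV m]]) auto

text \<open>An event about the first \<open>m\<close> coins is a finite disjoint union of cylinders,
  which reduces its probability to counting bit lists.\<close>

lemma measure_coins_prefix:
  "{\<omega>. P (map \<omega> [0..<m])} \<in> sets coins \<and>
   measure coins {\<omega>. P (map \<omega> [0..<m])} = real (card {bs. length bs = m \<and> P bs}) / 2 ^ m"
proof -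
  interpret prob_space coins by (rule prob_space_coins)
  let ?A = "{bs. length bs = m \<and> P bs}"
  define E where "E bs = {\<omega>. map \<omega> [0..<length bs] = (bs :: bool list)}" for bs
  have E: "E bs \<in> sets coins" "measure coins (E bs) = 1 / 2 ^ length bs" for bs
    using measure_coins_prefix_eq[of bs] by (simp_all add: E_def)
  have eq: "{\<omega>. P (map \<omega> [0..<m])} = (\<Union>bs\<in>?A. E bs)" by (auto simp: E_def)
  have "measure coins (\<Union>bs\<in>?A. E bs) = (\<Sum>bs\<in>?A. measure coins (E bs))"
    by (intro finite_measure_finite_Union finite_bits) (auto simp: E disjoint_family_on_def, auto simp: E_def)
  also have "\<dots> = (\<Sum>bs\<in>?A. 1 / 2 ^ m)" by (intro sum.cong) (auto simp: E)
  finally have "measure coins {\<omega>. P (map \<omega> [0..<m])} = real (card ?A) / 2 ^ m" unfolding eq by simp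
  moreover have "{\<omega>. P (map \<omega> [0..<m])} \<in> sets coins"
    unfolding eq by (intro sets.finite_UN finite_bits) (simp add: E)
  ultimately show ?thesis by simp
qed

text \<open>Most significant bit first, the order in which \<open>sample_prog\<close> builds an
  index by doubling and adding the next coin.\<close>

definition bits_value :: "bool list \<Rightarrow> nat" where
  "bits_value bs = foldl (\<lambda>r b. 2 * r + of_bool b) 0 bs"

lemma bits_value_snoc [simp]: "bits_value (bs @ [b]) = 2 * bits_value bs + of_bool b"
  by (simp add: bits_value_def)

lemma bits_value_Nil [simp]: "bits_value [] = 0"
  by (simp add: bits_value_def)

lemma bits_value_less: "bits_value bs < 2 ^ length bs"
  by (induction bs rule: rev_induct) (auto split: bool.splits simp: of_bool_def)

lemma bits_value_inj: "length bs = length cs \<Longrightarrow> bits_value bs = bits_value cs \<Longrightarrow> bs = cs"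
proof (induction bs arbitrary: cs rule: rev_induct)
  case (snoc b bs)
  obtain c cs' where cs: "cs = cs' @ [c]" using snoc.prems(1) by (cases cs rule: rev_cases) auto
  have "2 * bits_value bs + of_bool b = 2 * bits_value cs' + of_bool c" using snoc.prems(2) cs by simp
  then have "bits_value bs = bits_value cs' \<and> b = c" by (cases b; cases c; simp; presburger)
  then show ?case using snoc cs by simp
qed simp

lemma sum_bits_value:
  fixes f :: "nat \<Rightarrow> real"
  shows "(\<Sum>bs | length bs = L. f (bits_value bs)) = (\<Sum>r<2 ^ L. f r)"
proof -
  let ?A = "{bs :: bool list. length bs = L}"
  have inj: "inj_on bits_value ?A" by (auto intro!: inj_onI bits_value_inj)
  have "card (bits_value ` ?A) = 2 ^ L"
    using card_image[OF inj] card_lists_length_eq[of "UNIV :: bool set" L] by simp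
  moreover have "bits_value ` ?A \<subseteq> {..<2 ^ L}" using bits_value_less by auto
  ultimately have "bits_value ` ?A = {..<2 ^ L}" by (intro card_subset_eq) auto
  then show ?thesis using sum.reindex[OF inj, of f] by simp
qed

text \<open>Disjoint blocks of \<open>L\<close> coins give independent indices. The recursion splits
  off the last block, as the sampling loop extends its history at the end.\<close>

fun samples :: "nat \<Rightarrow> nat \<Rightarrow> bool list \<Rightarrow> nat list" where
  "samples L 0 bs = []"
| "samples L (Suc t) bs = samples L t bs @ [bits_value (take L (drop (t * L) bs))]"

lemma length_samples [simp]: "length (samples L t bs) = t"
  by (induction t) auto

lemma samples_append: "length bs \<ge> t * L \<Longrightarrow> samples L t (bs @ cs) = samples L t bs"
  by (induction t) auto

text \<open>Independence of the blocks as a product formula: the generating function of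
  \<open>t\<close> samples is the \<open>t\<close>-th power of that of one.\<close>

lemma sum_samples:
  fixes f :: "nat \<Rightarrow> real"
  shows "(\<Sum>bs | length bs = t * L. prod_list (map f (samples L t bs))) = (\<Sum>r<2 ^ L. f r) ^ t"
proof (induction t)
  case (Suc t)
  let ?A = "\<lambda>m. {bs :: bool list. length bs = m}"
  let ?app = "\<lambda>(bs, cs). bs @ cs"
  have inj: "inj_on ?app (?A (t * L) \<times> ?A L)" by (auto simp: inj_on_def)
  have img: "?app ` (?A (t * L) \<times> ?A L) = ?A (Suc t * L)"
  proof (intro equalityI subsetI)
    fix bs assume "bs \<in> ?A (Suc t * L)"
    then show "bs \<in> ?app ` (?A (t * L) \<times> ?A L)"
      by (intro image_eqI[of _ _ "(take (t * L) bs, drop (t * L) bs)"]) auto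
  qed auto
  have "(\<Sum>bs\<in>?A (Suc t * L). prod_list (map f (samples L (Suc t) bs))) =
    (\<Sum>(bs, cs)\<in>?A (t * L) \<times> ?A L. prod_list (map f (samples L (Suc t) (bs @ cs))))"
    using sum.reindex[OF inj, of "\<lambda>bs. prod_list (map f (samples L (Suc t) bs))"]
    unfolding img by (simp only: o_def split_def)
  also have "\<dots> = (\<Sum>(bs, cs)\<in>?A (t * L) \<times> ?A L. prod_list (map f (samples L t bs)) * f (bits_value cs))"
    by (intro sum.cong refl) (auto simp: samples_append)
  also have "\<dots> = (\<Sum>bs\<in>?A (t * L). prod_list (map f (samples L t bs))) * (\<Sum>cs\<in>?A L. f (bits_value cs))"
    by (subst sum.cartesian_product[symmetric]) (simp add: sum_product)
  finally show ?case using Suc by (simp add: sum_bits_value)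
qed simp

text \<open>Chernoff's bound with threshold 1/2, where \<open>W\<close> is the set of indices with
  wrong answers; a tie already counts as failure.\<close>

lemma samples_majority:
  fixes W :: "nat set"
  assumes q: "real (card {r. r < 2 ^ L \<and> r \<in> W}) \<le> q * 2 ^ L" "0 \<le> q" "q \<le> 1/2"
  shows "real (card {bs. length bs = t * L \<and> real t \<le> 2 * real (length (filter (\<lambda>r. r \<in> W) (samples L t bs)))})
    \<le> 2 ^ (t * L) * exp (- (1/2 - q)\<^sup>2 * t / 2)"
proof -
  let ?A = "{bs :: bool list. length bs = t * L}"
  let ?x = "\<lambda>bs. length (filter (\<lambda>r. r \<in> W) (samples L t bs))"
  let ?B = "{bs. length bs = t * L \<and> real t \<le> 2 * real (?x bs)}"
  let ?z = "exp (1/2 - q)" and ?f = "\<lambda>r. if r \<in> W then exp (1/2 - q) else 1"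
  have z: "1 \<le> ?z" using q by simp
  have prod: "prod_list (map ?f rs) = ?z ^ length (filter (\<lambda>r. r \<in> W) rs)" for rs
    by (induction rs) auto
  have fin: "finite ?A" using finite_bits[of "t * L" "\<lambda>_. True"] by simp
  have "real (card ?B) * ?z powr (1/2 * t) = (\<Sum>bs\<in>?B. ?z powr (1/2 * t))" by simp
  also have "\<dots> \<le> (\<Sum>bs\<in>?B. ?z ^ ?x bs)"
    using z by (intro sum_mono) (auto simp: powr_realpow[symmetric] intro!: powr_mono)
  also have "\<dots> \<le> (\<Sum>bs\<in>?A. ?z ^ ?x bs)"
    using fin by (intro sum_mono2) auto
  also have "\<dots> = (\<Sum>r<2 ^ L. ?f r) ^ t"
    unfolding sum_samples[symmetric] by (simp add: prod)
  finally have 1: "real (card ?B) * ?z powr (1/2 * t) \<le> (\<Sum>r<2 ^ L. ?f r) ^ t" .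
  have "(\<Sum>r<2 ^ L. ?f r) = 2 ^ L + real (card {r. r < 2 ^ L \<and> r \<in> W}) * (?z - 1)"
  proof -
    have "(\<Sum>r<2 ^ L. ?f r) = (\<Sum>r<(2 :: nat) ^ L. 1 + (if r \<in> W then ?z - 1 else 0))"
      by (intro sum.cong) auto
    also have "\<dots> = 2 ^ L + (\<Sum>r<(2 :: nat) ^ L. if r \<in> W then ?z - 1 else 0)"
      by (simp add: sum.distrib)
    also have "(\<Sum>r<(2 :: nat) ^ L. if r \<in> W then ?z - 1 else 0) = real (card ({..<2 ^ L} \<inter> W)) * (?z - 1)"
      by (simp add: sum.If_cases)
    also have "{..<2 ^ L} \<inter> W = {r. r < 2 ^ L \<and> r \<in> W}" by auto
    finally show ?thesis .
  qed
  also have "\<dots> \<le> 2 ^ L + (q * 2 ^ L) * (?z - 1)"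
    using q z by (intro add_left_mono mult_right_mono) auto
  also have "\<dots> = 2 ^ L * (1 + q * (?z - 1))" by (simp add: algebra_simps)
  finally have "(\<Sum>r<2 ^ L. ?f r) ^ t \<le> (2 ^ L * (1 + q * (?z - 1))) ^ t"
    using z by (intro power_mono sum_nonneg) auto
  with 1 have "real (card ?B) * ?z powr (1/2 * t) \<le> (2 ^ L * (1 + q * (?z - 1))) ^ t"
    by (rule order_trans)
  also have "\<dots> = 2 ^ (t * L) * (1 + q * (?z - 1)) ^ t"
    by (simp add: power_mult_distrib power_mult[symmetric] mult.commute)
  also have "\<dots> \<le> 2 ^ (t * L) * (?z powr (1/2 * t) * exp (- (1/2 - q)\<^sup>2 * t / 2))"
    using q by (intro mult_left_mono chernoff_estimate) auto
  finally have "real (card ?B) * ?z powr (1/2 * t) \<le> (2 ^ (t * L) * exp (- (1/2 - q)\<^sup>2 * t / 2)) * ?z powr (1/2 * t)"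
    by (simp add: mult_ac)
  then show ?thesis by (rule mult_right_le_imp_le) simp
qed

section \<open>The Boyer-Moore majority vote\<close>

text \<open>With one candidate and one counter, a query needs a constant number of operations on
  \<open>T\<close>-bit answers. Comparing all answers pairwise would multiply the term
  \<open>T\<close> by a further factor 1/\<epsilon>^2.\<close>

definition vote_step :: "'a \<Rightarrow> 'a \<times> nat \<Rightarrow> 'a \<times> nat" where
  "vote_step a = (\<lambda>(c, v). if v = 0 then (a, 1) else if c = a then (c, v + 1) else (c, v - 1))"

lemma vote_step_Pair:
  "vote_step a (c, v) = (if v = 0 then (a, 1) else if c = a then (c, v + 1) else (c, v - 1))"
  by (simp add: vote_step_def)

text \<open>Apart from the \<open>v\<close> surplus votes for the candidate, the answers read so far
  pair off into unequal ones, and such a pair contains \<open>a\<close> at most once.\<close>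

lemma vote_bound:
  assumes "fold vote_step xs (c0, 0) = (c, v)"
  shows "v \<le> length xs \<and> (c = a \<longrightarrow> 2 * count_list xs a \<le> length xs + v) \<and>
    (c \<noteq> a \<longrightarrow> 2 * count_list xs a + v \<le> length xs)"
  using assms
proof (induction xs arbitrary: c v rule: rev_induct)
  case (snoc x xs)
  obtain c' v' where *: "fold vote_step xs (c0, 0) = (c', v')" by fastforce
  then show ?case using snoc.IH[OF *] snoc.prems
    by (auto simp: vote_step_Pair split: if_splits)
qed auto

lemma vote_majority:
  assumes "length xs < 2 * count_list xs a"
  shows "fst (fold vote_step xs (c0, 0)) = a"
proof -
  obtain c v where *: "fold vote_step xs (c0, 0) = (c, v)" by fastforce
  then show ?thesis using vote_bound[OF *, of a] assms by auto
qed

section \<open>Enumerating the orbit of the input\<close>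

text \<open>Scalars are cells 0 of arrays numbered from an offset \<open>M\<close>, which is later
  chosen above all arrays of the given algorithm so that the two cannot collide.\<close>

abbreviation "reg M a \<equiv> Cell (M + a) (Lit 0)"
abbreviation "set_reg M a e \<equiv> Assign (M + a) (Lit 0) e"
abbreviation (input) "r_nn \<equiv> 28 :: nat"
abbreviation (input) "r_target \<equiv> 3 :: nat"
abbreviation (input) "r_N \<equiv> 4 :: nat"
abbreviation (input) "r_L \<equiv> 5 :: nat"
abbreviation (input) "r_count \<equiv> 6 :: nat"
abbreviation (input) "r_i \<equiv> 7 :: nat"
abbreviation (input) "r_g \<equiv> 8 :: nat"
abbreviation (input) "r_p \<equiv> 9 :: nat"
abbreviation (input) "r_j \<equiv> 10 :: nat"
abbreviation (input) "r_equal \<equiv> 11 :: nat"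
abbreviation (input) "r_found \<equiv> 12 :: nat"
abbreviation (input) "r_list \<equiv> 13 :: nat"
abbreviation (input) "r_cliques \<equiv> 14 :: nat"
abbreviation (input) "r_binom \<equiv> 15 :: nat"
abbreviation (input) "r_s \<equiv> 16 :: nat"
abbreviation (input) "r_r \<equiv> 17 :: nat"
abbreviation (input) "r_query \<equiv> 18 :: nat"
abbreviation (input) "r_answer \<equiv> 19 :: nat"
abbreviation (input) "r_cand \<equiv> 20 :: nat"
abbreviation (input) "r_votes \<equiv> 21 :: nat"
abbreviation (input) "r_t \<equiv> 22 :: nat"
abbreviation (input) "r_coin \<equiv> 23 :: nat"
abbreviation (input) "r_u \<equiv> 24 :: nat"
abbreviation (input) "r_v \<equiv> 25 :: nat"
abbreviation (input) "r_a \<equiv> 26 :: nat"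
abbreviation (input) "r_b \<equiv> 27 :: nat"

text \<open>The absolute difference: under truncated subtraction one of the two summands is
  zero.\<close>

definition neq_exp :: "expr \<Rightarrow> expr \<Rightarrow> expr" where
  "neq_exp e f = Op Add (Op Sub e f) (Op Sub f e)"

lemma val_neq_exp: "val (neq_exp e f) m \<noteq> 0 \<longleftrightarrow> val e m \<noteq> val f m"
  by (auto simp: neq_exp_def)

lemma val_neq_exp' [simp]: "0 < val (neq_exp e f) m \<longleftrightarrow> val e m \<noteq> val f m"
  "val (neq_exp e f) m = 0 \<longleftrightarrow> val e m = val f m"
  by (auto simp: neq_exp_def)

lemma neq_exp_static [simp]:
  "arrays_of (neq_exp e f) = arrays_of e \<union> arrays_of f"
  "fits Z X (neq_exp e f) \<longleftrightarrow> fits Z X e \<and> fits Z X f"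
  "degree_of (neq_exp e f) = 2 * (degree_of e + degree_of f)"
  "weight (neq_exp e f) = 2 * (weight e + weight f) + 4 * (degree_of e + degree_of f)"
  by (auto simp: neq_exp_def)

lemma store_apply [simp]: "store a i v m b = (if b = a then (m a)(i := v) else m b)"
  by (simp add: store_def)

text \<open>The machine has no remainder, hence \<open>v\<close> is computed as
  \<open>p - (p div n) * n\<close>; cell 0 of array 1 holds \<open>n\<close>.\<close>

definition unpair :: "nat \<Rightarrow> nat \<Rightarrow> nat \<Rightarrow> nat \<Rightarrow> com" where
  "unpair M p u v = Seq (set_reg M u (Op Div (reg M p) (Cell 1 (Lit 0))))
     (set_reg M v (Op Sub (reg M p) (Op Mul (reg M u) (Cell 1 (Lit 0)))))"

text \<open>A list of graphs is stored as consecutive flattened adjacency matrices.\<close>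

definition holds :: "nat \<Rightarrow> (nat \<Rightarrow> nat) \<Rightarrow> graph list \<Rightarrow> bool" where
  "holds n l ys \<longleftrightarrow> (\<forall>j<length ys. \<forall>p<n * n. l (j * (n * n) + p) = adj n (ys ! j) p)"

lemma slot_index_less: "j < c \<Longrightarrow> p < q \<Longrightarrow> j * q + p < c * (q :: nat)"
proof -
  assume "j < c" "p < q"
  then have "j * q + p < Suc j * q" by simp
  also have "\<dots> \<le> c * q" using \<open>j < c\<close> by (intro mult_le_mono1) simp
  finally show ?thesis .
qed

lemma holds_cong:
  "holds n l ys \<Longrightarrow> (\<And>q. q < length ys * (n * n) \<Longrightarrow> l' q = l q) \<Longrightarrow> holds n l' ys"
  by (auto simp: holds_def slot_index_less)

lemma holds_snoc:
  "holds n l ys \<Longrightarrow> (\<And>p. p < n * n \<Longrightarrow> l (length ys * (n * n) + p) = adj n y p) \<Longrightarrow> holds n l (ys @ [y])"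
  by (auto simp: holds_def nth_append less_Suc_eq)

definition swap_reg :: "nat \<Rightarrow> nat \<Rightarrow> com" where
  "swap_reg M r = If (neq_exp (reg M r) (reg M r_a)) (If (neq_exp (reg M r) (reg M r_b)) Skip (set_reg M r (reg M r_a)))
     (set_reg M r (reg M r_b))"

lemma run_swap_reg [simp]:
  "run (swap_reg M r) m = store (M + r) 0 (Transposition.transpose (m (M + r_a) 0) (m (M + r_b) 0) (m (M + r) 0)) m"
  by (auto simp: swap_reg_def store_def Transposition.transpose_def val_neq_exp)

lemma swap_reg_static [simp]:
  "writes (swap_reg M r) = {M + r}"
  "com_weight (swap_reg M r) = com_weight (swap_reg 0 0)"
  "simple {} X (swap_reg M r)"
  "m (M + r_a) 0 \<le> X \<Longrightarrow> m (M + r_b) 0 \<le> X \<Longrightarrow> safe {} X (swap_reg M r) m"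
  by (auto simp: swap_reg_def val_neq_exp)

text \<open>The new graph is written into the free slot behind the list. There it can be compared
  with all entries, and it becomes an entry by a mere increment of the count.\<close>

definition write_swapped :: "nat \<Rightarrow> com" where
  "write_swapped M = for_loop (M + r_p) (reg M r_nn) (Seq (unpair M r_p r_u r_v) (Seq (swap_reg M r_u) (Seq (swap_reg M r_v)
     (Assign (M + r_list) (Op Add (Op Mul (reg M r_count) (reg M r_nn)) (reg M r_p))
       (Cell (M + r_list) (Op Add (Op Mul (reg M r_i) (reg M r_nn)) (Op Add (Op Mul (reg M r_u) (Cell 1 (Lit 0))) (reg M r_v))))))))"

definition search_list :: "nat \<Rightarrow> com" where
  "search_list M = Seq (set_reg M r_found (Lit 0)) (for_loop (M + r_j) (reg M r_count)
     (Seq (set_reg M r_equal (Lit 1))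
     (Seq (for_loop (M + r_p) (reg M r_nn)
        (If (neq_exp (Cell (M + r_list) (Op Add (Op Mul (reg M r_j) (reg M r_nn)) (reg M r_p)))
             (Cell (M + r_list) (Op Add (Op Mul (reg M r_count) (reg M r_nn)) (reg M r_p))))
          (set_reg M r_equal (Lit 0)) Skip))
     (If (reg M r_equal) (set_reg M r_found (Lit 1)) Skip))))"

definition expand_prog :: "nat \<Rightarrow> com" where
  "expand_prog M = for_loop (M + r_g) (reg M r_nn)
     (Seq (unpair M r_g r_a r_b) (Seq (write_swapped M) (Seq (search_list M)
       (If (reg M r_found) Skip (set_reg M r_count (Op Add (reg M r_count) (Lit 1)))))))"

text \<open>A product of truncated differences serves as a conjunction: it is nonzero iff
  \<open>i < count\<close> and \<open>count < N\<close>.\<close>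

definition orbit_prog :: "nat \<Rightarrow> com" where
  "orbit_prog M = for_loop (M + r_i) (reg M r_N)
     (If (Op Mul (Op Sub (reg M r_count) (reg M r_i)) (Op Sub (reg M r_N) (reg M r_count))) (expand_prog M) Skip)"

lemma mod_eq_minus_div: "p - p div n * n = p mod (n :: nat)"
  by (simp add: minus_div_mult_eq_mod)

section \<open>Correctness and cost of the enumeration\<close>

context ram
begin

abbreviation w where "w \<equiv> bitlength X"

lemma w_pos: "1 \<le> w"
  using bitlength_pos[of X] by linarith

lemma runs_write_swapped:
  assumes Z: "Z = {}" and M: "3 \<le> M" and "n * n \<le> X"
    and m: "m 1 0 = n" "m (M + r_nn) 0 = n * n" "m (M + r_a) 0 = a" "m (M + r_b) 0 = b" "m (M + r_i) 0 = i"
      "m (M + r_count) 0 = length ys"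
    and "a < n" "b < n" and i: "i < length ys" and ys: "holds n (m (M + r_list)) ys"
  shows "runs (write_swapped M) m p (2000 * (n * n + 1) * w) (\<lambda>m' p'. p' = p \<and> holds n (m' (M + r_list)) ys \<and>
    (\<forall>q<n * n. m' (M + r_list) (length ys * (n * n) + q) = adj n (swapped a b (ys ! i)) q))"
  unfolding write_swapped_def
proof (rule runs_For[where N = "n * n" and B = "1000 * w" and I = "\<lambda>j m' p'. p' = p \<and>
    (\<forall>q<length ys * (n * n). m' (M + r_list) q = m (M + r_list) q) \<and>
    (\<forall>q<j. m' (M + r_list) (length ys * (n * n) + q) = adj n (swapped a b (ys ! i)) q)"], goal_cases)
  case (2 j m' p')
  have fr: "m' 1 = m 1" "m' (M + r_nn) = m (M + r_nn)" "m' (M + r_a) = m (M + r_a)" "m' (M + r_b) = m (M + r_b)"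
    "m' (M + r_i) = m (M + r_i)" "m' (M + r_count) = m (M + r_count)"
    using 2(3) M by (auto simp: unpair_def)
  let ?u = "Transposition.transpose a b (j div n)" and ?v = "Transposition.transpose a b (j mod n)"
  have "j div n < n" "j mod n < n" using \<open>a < n\<close> 2(1) by (auto simp: less_mult_imp_div_less)
  then have "?u < n" "?v < n" using \<open>a < n\<close> \<open>b < n\<close> by (auto simp: Transposition.transpose_def)
  then have uv: "?u * n + ?v < n * n" by (rule pair_index_less)
  \<comment> \<open>The slot that is read lies before the slot that is written, so earlier rounds of
    this loop have not changed it.\<close>
  then have "i * (n * n) + (?u * n + ?v) < length ys * (n * n)"
    using \<open>i < length ys\<close> by (rule slot_index_less[rotated])
  then have "m' (M + r_list) (i * (n * n) + (?u * n + ?v)) = adj n (ys ! i) (?u * n + ?v)"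
    using 2(5) i ys uv by (simp add: holds_def)
  then have read: "m' (M + r_list) (i * (n * n) + (?u * n + ?v)) = adj n (swapped a b (ys ! i)) j"
    using 2(1) \<open>a < n\<close> \<open>b < n\<close> by (simp add: adj_swapped)
  have le: "m' c d \<le> X" for c d using 2(2) Z by (simp add: bounded_outsideD)
  have nX: "n \<le> X" using \<open>n * n \<le> X\<close> le_square[of n] by linarith
  have uvX: "j mod n \<le> X" "a \<le> X" "b \<le> X" using nX \<open>j mod n < n\<close> \<open>a < n\<close> \<open>b < n\<close> by linarith+
  show ?case
    apply (rule runs_simple)
    subgoal using X by (simp add: unpair_def Z)
    subgoal unfolding Z using M le uvX fr m 2(4) \<open>j div n < n\<close> \<open>j mod n < n\<close> \<open>?u < n\<close> \<open>?v < n\<close> nX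
      by (simp add: unpair_def mod_eq_minus_div) (rule uvX(1))
    subgoal by (simp add: unpair_def swap_reg_def)
    subgoal using 2 fr m M read by (auto simp: unpair_def mod_eq_minus_div less_Suc_eq)
    done
qed (use assms in \<open>auto simp: unpair_def intro: holds_cong simp: for_weight_def algebra_simps\<close>)

lemma runs_search_list:
  assumes Z: "Z = {}" and M: "3 \<le> M" and nX: "n * n \<le> X"
    and m: "m (M + r_nn) 0 = n * n" "m (M + r_count) 0 = length ys"
    and ys: "holds n (m (M + r_list)) ys" "set ys \<subseteq> graphs n" and z: "z \<in> graphs n"
    and slot: "\<And>q. q < n * n \<Longrightarrow> m (M + r_list) (length ys * (n * n) + q) = adj n z q"
  shows "runs (search_list M) m p (5000 * (length ys + 1) * (n * n + 1) * w)
    (\<lambda>m' p'. p' = p \<and> m' (M + r_found) 0 = (if z \<in> set ys then 1 else 0))"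
  unfolding search_list_def
proof (rule runs_Seq[where Ba = "100 * w" and Bb = "(length ys + 1) * (4000 * (n * n + 1) * w)" and
    R = "\<lambda>m' p'. p' = p \<and> m' (M + r_found) 0 = 0"], goal_cases)
  case (2 m1 p1)
  then have [simp]: "p1 = p" by simp
  have lenX: "length ys \<le> X" using m(2) 2(2)[of "M + r_count"] Z bounded_outsideD[OF 2(1), of "M + r_count" 0] by simp
  show ?case
  proof (rule runs_For[where N = "length ys" and B = "3000 * (n * n + 1) * w" and I = "\<lambda>j m' p'. p' = p \<and>
      m' (M + r_found) 0 = (if z \<in> set (take j ys) then 1 else 0)"], goal_cases)
    case (2 j m2 p2)
    then have [simp]: "p2 = p" by simp
    have fr: "m2 (M + r_nn) = m (M + r_nn)" "m2 (M + r_count) = m (M + r_count)" "m2 (M + r_list) = m (M + r_list)"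
      using 2(3) \<open>\<And>a. a \<notin> writes _ \<Longrightarrow> m1 a = m a\<close> by auto
    have yj: "ys ! j \<in> graphs n" "ys ! j \<in> set ys" using 2(1) ys(2) by auto
    show ?case
    proof (rule runs_Seq[where Ba = "100 * w" and Bb = "2500 * (n * n + 1) * w" and
        R = "\<lambda>m' p'. p' = p \<and> m' (M + r_equal) 0 = 1"], goal_cases)
      case (2 m3 p3)
      then have [simp]: "p3 = p" by simp
      have fr3: "m3 a = m2 a" if "a \<noteq> M + r_equal" for a using 2(2) that by simp
      have eq3: "m3 (M + r_equal) 0 = 1" using 2(3) by simp
      show ?case
      proof (rule runs_Seq[where Ba = "(n * n + 1) * (1500 * w)" and Bb = "1000 * w" and
          R = "\<lambda>m' p'. p' = p \<and> m' (M + r_equal) 0 = (if ys ! j = z then 1 else 0)"], goal_cases)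
        case 1
        show ?case
        proof (rule runs_For[where N = "n * n" and B = "1000 * w" and I = "\<lambda>q m' p'. p' = p \<and>
            m' (M + r_equal) 0 = (if \<forall>r<q. adj n (ys ! j) r = adj n z r then 1 else 0)"], goal_cases)
          case (2 q m4 p4)
          have fr4: "m4 a = m2 a" if "a \<noteq> M + r_equal" "a \<noteq> M + r_p" for a using 2(3) fr3 that by simp
          have "m4 (M + r_list) (j * (n * n) + q) = adj n (ys ! j) q"
            "m4 (M + r_list) (length ys * (n * n) + q) = adj n z q"
            using 2(1) \<open>j < length ys\<close> ys(1) slot by (simp_all add: fr4 fr holds_def)
          moreover have "m4 (M + r_j) 0 = j" "m4 (M + r_nn) 0 = n * n" "m4 (M + r_count) 0 = length ys"
            using \<open>m2 (M + r_j) 0 = j\<close> by (simp_all add: fr4 fr m)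
          ultimately show ?case
            apply (intro runs_simple)
            subgoal using X Z by simp
            subgoal by simp
            subgoal by simp
            subgoal using 2 by (auto simp: val_neq_exp less_Suc_eq)
            done
        next
          case (10 m5 p5)
          then show ?case using graph_eqI[OF yj(1) z] by auto
        qed (use nX m Z eq3 in \<open>auto simp: fr3 fr for_weight_def algebra_simps\<close>)
      next
        case (2 m4 p4)
        have "m4 (M + r_found) 0 = (if z \<in> set (take j ys) then 1 else 0)"
          using 2(2)[of "M + r_found"] fr3 \<open>p2 = p \<and> _\<close> by simp
        then show ?case
          apply (intro runs_simple)
          subgoal using X Z by simp
          subgoal using X by simp
          subgoal by simp
          subgoal using 2 \<open>j < length ys\<close> by (auto simp: take_Suc_conv_app_nth)
          done
      qed (simp add: algebra_simps)
    next
      case 1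
      then show ?case by (rule runs_simple) (use X Z in auto)
    qed (simp add: algebra_simps)
  qed (use 2 lenX m Z w_pos in \<open>auto simp: for_weight_def algebra_simps\<close>)
next
  case 1
  then show ?case by (rule runs_simple) (use X Z in auto)
qed (simp add: algebra_simps)

lemma runs_expand_prog:
  assumes Z: "Z = {}" and M: "3 \<le> M" and nX: "n * n \<le> X" and N: "N + n * n < X" "length ys < N"
    and m: "m 1 0 = n" "m (M + r_nn) 0 = n * n" "m (M + r_count) 0 = length ys" "m (M + r_i) 0 = i"
    and x: "x \<in> graphs n" and ys: "holds n (m (M + r_list)) ys" "set ys \<subseteq> orbit n x" "distinct ys" and i: "i < length ys"
  shows "runs (expand_prog M) m p (10000 * (N + n * n + 1) * (n * n + 1) * (n * n + 1) * w)
    (\<lambda>m' p'. p' = p \<and> holds n (m' (M + r_list)) (expand n i (n * n) ys) \<and>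
      m' (M + r_count) 0 = length (expand n i (n * n) ys))"
  unfolding expand_prog_def
proof (rule runs_For[where N = "n * n" and B = "9500 * (N + n * n + 1) * (n * n + 1) * w" and I = "\<lambda>h m' p'. p' = p \<and>
    holds n (m' (M + r_list)) (expand n i h ys) \<and> m' (M + r_count) 0 = length (expand n i h ys)"], goal_cases)
  case (2 h m1 p1)
  then have [simp]: "p1 = p" by simp
  let ?E = "expand n i h ys"
  have E: "set ?E \<subseteq> orbit n x" "length ?E \<le> length ys + h" "\<exists>zs. ?E = ys @ zs"
    using expand_props[OF ys(3,2) i, of h] 2(1) by auto
  have iE: "i < length ?E" using E(3) i by auto
  have E': "set ?E \<subseteq> graphs n" using E(1) orbit_subset_graphs[OF x] by blast
  have n0: "0 < n" using 2(1) by (cases n) auto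
  have hn: "h div n < n" "h mod n < n" using 2(1) n0 by (auto simp: less_mult_imp_div_less)
  let ?z = "swapped (h div n) (h mod n) (?E ! i)"
  have z: "?z \<in> graphs n"
    unfolding swapped_def using E' iE by (intro relabel_in_graphs transpose_permutes hn) auto
  \<comment> \<open>The length is compared with \<open>N\<close> only between expansions, and one
    expansion adds up to \<open>n * n\<close> graphs.\<close>
  have lenE: "length ?E \<le> N + n * n" using E(2) N 2(1) by linarith
  have fr1: "m1 1 = m 1" "m1 (M + r_nn) = m (M + r_nn)" "m1 (M + r_i) = m (M + r_i)"
    using 2(3) M by (auto simp: unpair_def write_swapped_def search_list_def)
  show ?case
  proof (rule runs_Seq[where Ba = "100 * w" and Bb = "9000 * (N + n * n + 1) * (n * n + 1) * w" and
      R = "\<lambda>m' p'. p' = p \<and> m' (M + r_a) 0 = h div n \<and> m' (M + r_b) 0 = h mod n"], goal_cases)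
    case 1
    have "\<And>c d. m1 c d \<le> X" using 2(2) Z by (simp add: bounded_outsideD)
    then show ?case
      apply (intro runs_simple)
      subgoal using X Z by (simp add: unpair_def)
      subgoal using le_trans[OF div_le_dividend] by (auto simp: unpair_def intro: le_trans[OF diff_le_self])
      subgoal by (simp add: unpair_def)
      subgoal using 2 M m fr1 by (auto simp: unpair_def mod_eq_minus_div)
      done
  next
    case (2 m2 p2)
    then have [simp]: "p2 = p" by simp
    have fr2: "m2 1 = m 1" "m2 (M + r_nn) = m (M + r_nn)" "m2 (M + r_i) = m (M + r_i)"
      "m2 (M + r_count) = m1 (M + r_count)" "m2 (M + r_list) = m1 (M + r_list)"
      using 2(2) M fr1 by (auto simp: unpair_def)
    have cnt2: "m2 (M + r_count) 0 = length ?E" "holds n (m2 (M + r_list)) ?E"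
      using \<open>p1 = p \<and> _\<close> by (simp_all add: fr2)
    show ?case
    proof (rule runs_Seq[OF runs_write_swapped[where a = "h div n" and b = "h mod n" and i = i and ys = ?E],
        where Bb = "7000 * (N + n * n + 1) * (n * n + 1) * w"], goal_cases)
      case (14 m3 p3)
      then have [simp]: "p3 = p" by simp
      have fr3: "m3 1 = m 1" "m3 (M + r_nn) = m (M + r_nn)" "m3 (M + r_i) = m (M + r_i)"
        "m3 (M + r_count) = m1 (M + r_count)"
        using 14(2) M fr2 by (auto simp: unpair_def write_swapped_def)
      have c3: "m3 (M + r_count) 0 = length ?E" using cnt2 fr2 fr3 by simp
      show ?case
      proof (rule runs_Seq[OF runs_search_list[where ys = ?E and z = ?z], where Bb = "1000 * w"], goal_cases)
        case (10 m4 p4)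
        have fr4: "m4 (M + r_list) = m3 (M + r_list)" "m4 (M + r_count) = m3 (M + r_count)"
          using 10(2) by (auto simp: search_list_def)
        have snoc: "holds n (m4 (M + r_list)) (?E @ [?z])"
          using 14(3) by (intro holds_snoc) (auto simp: fr4)
        moreover have "holds n (m4 (M + r_list)) ?E" using 14(3) by (simp add: fr4)
        moreover have "Suc (length ?E) \<le> X" using lenE N by simp
        ultimately show ?case
          apply (intro runs_simple[where B = "1000 * w"])
          subgoal using X Z by simp
          subgoal using c3 fr4 by simp
          subgoal by simp
          subgoal using 10(3) c3 fr4 by (auto simp: expand_Suc insert_new_def)
          done
      next
        case 11
        have "5000 * (length ?E + 1) * (n * n + 1) * w \<le> 5000 * (N + n * n + 1) * (n * n + 1) * w"
          using lenE by (intro mult_le_mono) auto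
        moreover have "1000 * w \<le> 2000 * (N + n * n + 1) * (n * n + 1) * w"
          by (intro mult_right_mono) auto
        ultimately have "5000 * (length ?E + 1) * (n * n + 1) * w + 1000 * w \<le>
            5000 * (N + n * n + 1) * (n * n + 1) * w + 2000 * (N + n * n + 1) * (n * n + 1) * w"
          by (rule add_mono)
        then show ?case by (simp add: algebra_simps)
      qed (use 14 assms fr3 c3 E' z in auto)
    next
      case 15
      show ?case by (simp add: algebra_simps)
    qed (use 2 assms fr2 cnt2 hn iE in auto)
  qed (simp add: algebra_simps)
qed (use assms w_pos in \<open>auto simp: for_weight_def algebra_simps write_swapped_def search_list_def unpair_def\<close>)

lemma runs_orbit_prog:
  assumes Z: "Z = {}" and M: "3 \<le> M" and nX: "n * n \<le> X" and N: "N + n * n < X" "0 < N"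
    and m: "m 1 0 = n" "m (M + r_nn) 0 = n * n" "m (M + r_N) 0 = N" "m (M + r_count) 0 = 1"
    and x: "x \<in> graphs n" and hx: "holds n (m (M + r_list)) [x]"
  shows "runs (orbit_prog M) m p (20000 * (N + 1) * (N + n * n + 1) * (n * n + 1) * (n * n + 1) * w)
    (\<lambda>m' p'. p' = p \<and> holds n (m' (M + r_list)) (orbit_list n N N x) \<and>
      m' (M + r_count) 0 = length (orbit_list n N N x))"
  unfolding orbit_prog_def
proof (rule runs_For[where N = N and B = "11000 * (N + n * n + 1) * (n * n + 1) * (n * n + 1) * w" and I = "\<lambda>h m' p'. p' = p \<and>
    holds n (m' (M + r_list)) (orbit_list n N h x) \<and> m' (M + r_count) 0 = length (orbit_list n N h x)"], goal_cases)
  case (2 h m1 p1)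
  then have [simp]: "p1 = p" by simp
  let ?L = "orbit_list n N h x"
  have fr: "m1 1 = m 1" "m1 (M + r_nn) = m (M + r_nn)" "m1 (M + r_N) = m (M + r_N)"
    using 2(3) M by (auto simp: expand_prog_def unpair_def write_swapped_def search_list_def)
  have props: "distinct ?L" "set ?L \<subseteq> orbit n x" using orbit_list_props[OF N(2)] by auto
  show ?case
  proof (rule runs_If[where B' = "10000 * (N + n * n + 1) * (n * n + 1) * (n * n + 1) * w"], goal_cases)
    case 2
    then have "h < length ?L \<and> length ?L < N" using \<open>p1 = p \<and> _\<close> \<open>m1 (M + r_i) 0 = h\<close> by (simp add: fr m)
    then show ?case using 2 \<open>p1 = p \<and> _\<close> \<open>m1 (M + r_i) 0 = h\<close> props fr m
      by (intro runs_conseq[OF runs_expand_prog[OF Z M nX N(1), of ?L m1 h x p1]])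
         (auto simp: x orbit_list_Suc Let_def)
  next
    case 3
    then have "\<not> (h < length ?L \<and> length ?L < N)" using \<open>p1 = p \<and> _\<close> \<open>m1 (M + r_i) 0 = h\<close> by (auto simp: fr m)
    then have "orbit_list n N (Suc h) x = ?L" by (auto simp: orbit_list_Suc Let_def)
    then show ?case using \<open>p1 = p \<and> _\<close> by (intro runs_simple) auto
  qed (use Z in \<open>simp_all add: algebra_simps\<close>)
qed (use assms w_pos in \<open>auto simp: for_weight_def algebra_simps expand_prog_def write_swapped_def search_list_def unpair_def\<close>)

end

text \<open>Under truncated subtraction, \<open>u + (v - u)\<close> and \<open>u - (u - v)\<close>
  are the maximum and the minimum of \<open>u\<close> and \<open>v\<close>, which gives the position
  of the edge for either order. The diagonal is skipped and keeps its initial zeros.\<close>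

definition load_prog :: "nat \<Rightarrow> com" where
  "load_prog M = for_loop (M + r_p) (reg M r_nn) (Seq (unpair M r_p r_u r_v)
     (If (neq_exp (reg M r_u) (reg M r_v))
       (Seq (set_reg M r_a (Op Add (reg M r_u) (Op Sub (reg M r_v) (reg M r_u))))
         (Assign (M + r_list) (reg M r_p)
           (Cell 2 (Op Add (Op Div (Op Mul (reg M r_a) (Op Sub (reg M r_a) (Lit 1))) (Lit 2))
             (Op Sub (reg M r_u) (Op Sub (reg M r_u) (reg M r_v)))))))
       Skip))"

text \<open>Only logarithmically many of the \<open>target\<close> rounds double \<open>N\<close>;
  the idle ones spare the computation of a logarithm and cost far less than the enumeration.\<close>

definition level_prog :: "nat \<Rightarrow> com" where
  "level_prog M = for_loop (M + r_i) (reg M r_target) (If (Op Sub (reg M r_target) (reg M r_N))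
     (Seq (set_reg M r_N (Op Mul (reg M r_N) (Lit 2))) (set_reg M r_L (Op Add (reg M r_L) (Lit 1)))) Skip)"

definition init_prog :: "nat \<Rightarrow> com" where
  "init_prog M = Seq (Seq (set_reg M r_nn (Op Mul (Cell 1 (Lit 0)) (Cell 1 (Lit 0))))
     (Seq (set_reg M r_target (Op Mul (Lit 64) (Op Mul (reg M r_nn) (Op Mul (Cell 1 (Lit 2)) (Cell 1 (Lit 2))))))
     (Seq (set_reg M r_count (Lit 1)) (Seq (set_reg M r_N (Lit 1)) (set_reg M r_L (Lit 0))))))
     (Seq (level_prog M) (load_prog M))"

text \<open>\<open>E\<close> is 1/\<epsilon> rounded up. The 64 comes from the deviation bound: a
  gap of \<epsilon>/4 between threshold and mean gives the exponent (\<epsilon>/4)^2 * (64 n^2 /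
  \<epsilon>^2) / 2 = 2 n^2.\<close>

definition target :: "nat \<Rightarrow> nat \<Rightarrow> nat" where
  "target n E = 64 * (n * n * (E * E))"

definition level :: "nat \<Rightarrow> nat \<Rightarrow> nat" where
  "level n E = (LEAST l. target n E \<le> 2 ^ l)"

lemma target_le_level: "target n E \<le> 2 ^ level n E"
  unfolding level_def by (rule LeastI[of _ "target n E"]) (rule less_imp_le[OF less_exp])

lemma level_le_target: "0 < target n E \<Longrightarrow> 2 ^ level n E \<le> 2 * target n E"
proof (cases "level n E")
  case (Suc l)
  then have "\<not> target n E \<le> 2 ^ l" unfolding level_def by (intro not_less_Least) simp
  then show ?thesis using Suc by simp
qed simp

lemma indicator_vector_adj:
  assumes "u \<noteq> v" "u < n" "v < n"
  shows "indicator_vector x ((u + (v - u)) * (u + (v - u) - Suc 0) div 2 + (u - (u - v))) = adj n x (u * n + v)"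
proof (cases "u < v")
  case True
  then have "(u + (v - u)) * (u + (v - u) - Suc 0) div 2 + (u - (u - v)) = edge_pos u v"
    by (simp add: edge_pos_def choose_two)
  then show ?thesis using indicator_vector_edge_pos[OF True, of x] assms by (simp add: adj_pair)
next
  case False
  then have "(u + (v - u)) * (u + (v - u) - Suc 0) div 2 + (u - (u - v)) = edge_pos v u"
    by (simp add: edge_pos_def choose_two)
  then show ?thesis using indicator_vector_edge_pos[of v u x] False assms by (simp add: adj_pair insert_commute)
qed

context ram
begin

lemma runs_load_prog:
  assumes Z: "Z = {}" and M: "3 \<le> M" and nX: "n * n \<le> X"
    and m: "m 1 0 = n" "m (M + r_nn) 0 = n * n" "m 2 = indicator_vector x" "m (M + r_list) = (\<lambda>_. 0)"
    and x: "x \<in> graphs n"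
  shows "runs (load_prog M) m p (2000 * (n * n + 1) * w) (\<lambda>m' p'. p' = p \<and> holds n (m' (M + r_list)) [x])"
  unfolding load_prog_def
proof (rule runs_For[where N = "n * n" and B = "1000 * w" and I = "\<lambda>j m' p'. p' = p \<and>
    (\<forall>q<j. m' (M + r_list) q = adj n x q) \<and> (\<forall>q\<ge>j. m' (M + r_list) q = 0)"], goal_cases)
  case (2 j m' p')
  have fr: "m' 1 = m 1" "m' 2 = m 2" "m' (M + r_nn) = m (M + r_nn)"
    using 2(3) M by (auto simp: unpair_def)
  have n0: "0 < n" using 2(1) by (cases n) auto
  then have lt: "j div n < n" "j mod n < n" using 2(1) by (auto simp: less_mult_imp_div_less)
  have nX': "n \<le> X" using nX le_square[of n] by linarith
  have modX: "j mod n \<le> X" "j div n \<le> X" using nX' lt by linarith+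
  have maxX: "j div n + (j mod n - j div n) \<le> X" using modX by simp
  have ind: "m' 2 q \<le> X" for q using X indicator_vector_le_1[of x q] m fr by simp
  show ?case
  proof (rule runs_simple, goal_cases)
    case 1
    then show ?case using X by (simp add: unpair_def Z)
  next
    case 2
    then show ?case unfolding Z using M fr m \<open>m' (M + r_p) 0 = j\<close> modX maxX ind
      by (simp add: unpair_def mod_eq_minus_div del: mod_less_divisor)
  next
    case 3
    then show ?case by (simp add: unpair_def)
  next
    case 4
    show ?case
    proof (cases "j div n = j mod n")
      case True
      have "adj n x j = 0" using graphs_no_loop[OF x] True by (simp add: adj_def)
      moreover have "j - j mod n * n = j mod n" using mod_eq_minus_div[of j n] True by simp
      ultimately show ?thesis using 2 fr m M True by (auto simp: unpair_def mod_eq_minus_div less_Suc_eq)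
    next
      case False
      then show ?thesis using 2 fr m M indicator_vector_adj[OF False lt, of x]
        by (auto simp: unpair_def mod_eq_minus_div less_Suc_eq)
    qed
  qed
qed (use assms in \<open>auto simp: unpair_def holds_def for_weight_def algebra_simps\<close>)

lemma runs_level_prog:
  assumes Z: "Z = {}" and X': "2 * target n E \<le> X" and t0: "0 < target n E"
    and m: "m (M + r_target) 0 = target n E" "m (M + r_N) 0 = 1" "m (M + r_L) 0 = 0"
  shows "runs (level_prog M) m p (2000 * (target n E + 1) * w)
    (\<lambda>m' p'. p' = p \<and> m' (M + r_L) 0 = level n E \<and> m' (M + r_N) 0 = 2 ^ level n E)"
  unfolding level_prog_def
proof (rule runs_For[where N = "target n E" and B = "1000 * w" and I = "\<lambda>j m' p'. p' = p \<and>
    m' (M + r_L) 0 \<le> j \<and> m' (M + r_N) 0 = 2 ^ m' (M + r_L) 0 \<and> (\<forall>l<m' (M + r_L) 0. 2 ^ l < target n E) \<and>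
    (target n E \<le> 2 ^ m' (M + r_L) 0 \<or> m' (M + r_L) 0 = j)"], goal_cases)
  case (2 j m' p')
  have fr: "m' (M + r_target) 0 = target n E" using 2(3)[of "M + r_target"] m by simp
  have "m' (M + r_L) 0 < target n E" using 2(1,5) by auto
  then have "Suc (m' (M + r_L) 0) \<le> X" using X' by simp
  then show ?case using 2 fr X' Z X
    by (intro runs_simple) (auto simp: less_Suc_eq)
next
  case (10 m' p')
  let ?l = "m' (M + r_L) 0"
  \<comment> \<open>After the last round, either doubling has stopped at a sufficient power or the
    exponent is the target itself, which is large enough.\<close>
  have "target n E < 2 ^ target n E" by (rule less_exp)
  then have "target n E \<le> 2 ^ ?l" using 10(3) by auto
  then have "level n E = ?l"
    unfolding level_def using 10(3) by (intro Least_equality) (auto simp: not_less[symmetric])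
  then show ?case using 10(3) by simp
qed (use assms in \<open>auto simp: for_weight_def algebra_simps\<close>)

lemma runs_init_prog:
  assumes Z: "Z = {}" and M: "3 \<le> M" and nX: "n * n \<le> X" and X': "2 * target n E \<le> X" "64 \<le> X" and t0: "0 < target n E"
    and m: "m 1 0 = n" "m 1 2 = E" "m 2 = indicator_vector x" "m (M + r_list) = (\<lambda>_. 0)"
    and x: "x \<in> graphs n"
  shows "runs (init_prog M) m p (10000 * (target n E + n * n + 1) * w) (\<lambda>m' p'. p' = p \<and>
    m' (M + r_nn) 0 = n * n \<and> m' (M + r_L) 0 = level n E \<and> m' (M + r_N) 0 = 2 ^ level n E \<and>
    m' (M + r_count) 0 = 1 \<and> holds n (m' (M + r_list)) [x])"
  unfolding init_prog_def
proof (rule runs_Seq[where Ba = "1000 * w" and Bb = "5000 * (target n E + n * n + 1) * w" and R = "\<lambda>m' p'. p' = p \<and>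
    m' (M + r_nn) 0 = n * n \<and> m' (M + r_target) 0 = target n E \<and> m' (M + r_count) 0 = 1 \<and> m' (M + r_N) 0 = 1 \<and> m' (M + r_L) 0 = 0"], goal_cases)
  case 1
  show ?case
    using X X' M m nX by (intro runs_simple) (simp_all add: Z target_def mult.assoc)
next
  case (2 m1 p1)
  have fr1: "m1 1 = m 1" "m1 2 = m 2" "m1 (M + r_list) = m (M + r_list)" using 2(2) M by auto
  show ?case
  proof (rule runs_Seq[OF runs_level_prog[OF Z X'(1) t0], where Bb = "2000 * (n * n + 1) * w"], goal_cases)
    case (4 m2 p2)
    have fr2: "m2 1 = m 1" "m2 2 = m 2" "m2 (M + r_list) = m (M + r_list)" "m2 (M + r_nn) = m1 (M + r_nn)" "m2 (M + r_count) = m1 (M + r_count)"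
      using 4(2) M fr1 by (auto simp: level_prog_def)
    show ?case
    proof (rule runs_conseq[OF runs_load_prog[OF Z M nX, where x = x]], goal_cases)
      case (7 m3 p3)
      have "m3 (M + r_nn) = m2 (M + r_nn)" "m3 (M + r_count) = m2 (M + r_count)" "m3 (M + r_L) = m2 (M + r_L)" "m3 (M + r_N) = m2 (M + r_N)"
        using 7(2) by (auto simp: load_prog_def unpair_def)
      then show ?case using 7 4 2 fr2 by simp
    qed (use m 2(3) x fr2 in auto)
  qed (use 2 in \<open>auto simp: algebra_simps\<close>)
qed (simp add: algebra_simps)

end

section \<open>Counting cliques in a small orbit\<close>

text \<open>The clique condition as the program tests it, over matrix positions. For
  \<open>k > n\<close>, where positions of the clique would be missing, the resulting count is
  multiplied by \<open>n choose k = 0\<close>.\<close>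

definition initial_clique :: "nat \<Rightarrow> nat \<Rightarrow> graph \<Rightarrow> bool" where
  "initial_clique n k y \<longleftrightarrow> (\<forall>p<n * n. p div n < k \<and> p mod n < k \<and> p div n \<noteq> p mod n \<longrightarrow> adj n y p \<noteq> 0)"

text \<open>The product is nonzero iff \<open>u < k\<close>, \<open>v < k\<close>,
  \<open>u \<noteq> v\<close> and the matrix entry is 0, that is, iff the pair violates the clique
  condition.\<close>

definition clique_test :: "nat \<Rightarrow> com" where
  "clique_test M = for_loop (M + r_p) (reg M r_nn)
        (Seq (unpair M r_p r_u r_v)
          (If (Op Mul (Op Mul (Op Sub (Cell 1 (Lit 1)) (reg M r_u)) (Op Sub (Cell 1 (Lit 1)) (reg M r_v)))
                (Op Mul (neq_exp (reg M r_u) (reg M r_v))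
                  (Op Sub (Lit 1) (Cell (M + r_list) (Op Add (Op Mul (reg M r_j) (reg M r_nn)) (reg M r_p))))))
            (set_reg M r_equal (Lit 0)) Skip))"

text \<open>The result goes to index 3 of array 1, where the given algorithm expects the clique
  count behind the three parameters. The binomial coefficient is built from
  \<open>n choose 0\<close> upwards, each division being exact.\<close>

definition count_prog :: "nat \<Rightarrow> com" where
  "count_prog M = Seq (set_reg M r_cliques (Lit 0)) (Seq (for_loop (M + r_j) (reg M r_count)
     (Seq (set_reg M r_equal (Lit 1)) (Seq (clique_test M)
        (set_reg M r_cliques (Op Add (reg M r_cliques) (reg M r_equal))))))
     (Seq (set_reg M r_binom (Lit 1)) (Seq (for_loop (M + r_i) (Cell 1 (Lit 1))
       (set_reg M r_binom (Op Div (Op Mul (reg M r_binom) (Op Sub (Cell 1 (Lit 0)) (reg M r_i))) (Op Add (reg M r_i) (Lit 1)))))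
     (Assign 1 (Lit 3) (Op Div (Op Mul (reg M r_binom) (reg M r_cliques)) (reg M r_count))))))"

lemma binomial_step: "(n choose i) * (n - i) div Suc i = (n choose Suc i)"
proof -
  have "Suc i * (n choose Suc i) = (n choose i) * (n - i)"
    using binomial_absorption[of i n] binomial_absorb_comp[of n i] by (simp add: mult.commute)
  then show ?thesis by (metis nonzero_mult_div_cancel_left nat.distinct(1))
qed

lemma initial_clique_iff:
  assumes "y \<in> graphs n" "k \<le> n"
  shows "initial_clique n k y \<longleftrightarrow> is_clique y {..<k}"
proof
  assume *: "initial_clique n k y"
  show "is_clique y {..<k}"
    unfolding is_clique_def
  proof (intro ballI impI)
    fix u v assume uv: "u \<in> {..<k}" "v \<in> {..<k}" "u \<noteq> v"
    then have "u < n" "v < n" using assms(2) by auto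
    then have "(u * n + v) div n = u" "(u * n + v) mod n = v" "u * n + v < n * n"
      by (simp_all add: pair_index_less)
    then have "adj n y (u * n + v) \<noteq> 0"
      using *[unfolded initial_clique_def, rule_format, of "u * n + v"] uv by simp
    then show "{u, v} \<in> y" using \<open>u < n\<close> \<open>v < n\<close> by (simp add: adj_pair split: if_splits)
  qed
next
  assume "is_clique y {..<k}"
  then show "initial_clique n k y" by (auto simp: initial_clique_def is_clique_def adj_def)
qed

context ram
begin

lemma runs_initial_clique:
  assumes Z: "Z = {}" and M: "3 \<le> M" and nX: "n * n \<le> X"
    and m: "m 1 0 = n" "m 1 1 = k" "m (M + r_nn) 0 = n * n" "m (M + r_j) 0 = j" "m (M + r_equal) 0 = 1"
    and y: "\<And>p. p < n * n \<Longrightarrow> m (M + r_list) (j * (n * n) + p) = adj n y p"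
  shows "runs (clique_test M) m p (2000 * (n * n + 1) * w)
    (\<lambda>m' p'. p' = p \<and> m' (M + r_equal) 0 = (if initial_clique n k y then 1 else 0))"
  unfolding clique_test_def
proof (rule runs_For[where N = "n * n" and B = "1000 * w" and I = "\<lambda>q m' p'. p' = p \<and>
    m' (M + r_equal) 0 = (if \<forall>r<q. r div n < k \<and> r mod n < k \<and> r div n \<noteq> r mod n \<longrightarrow> adj n y r \<noteq> 0 then 1 else 0)"], goal_cases)
  case (2 q m' p')
  have fr: "m' 1 0 = n" "m' 1 1 = k" "m' (M + r_nn) 0 = n * n" "m' (M + r_j) 0 = j" "m' (M + r_list) = m (M + r_list)"
    using 2(3) M m by (auto simp: unpair_def)
  then have fr': "m' (Suc 0) 0 = n" "m' (Suc 0) (Suc 0) = k" by simp_all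
  have n0: "0 < n" using 2(1) by (cases n) auto
  then have lt: "q div n < n" "q mod n < n" using 2(1) by (auto simp: less_mult_imp_div_less)
  have "n \<le> X" using nX le_square[of n] by linarith
  then have modX: "q mod n \<le> X" "q div n \<le> X" using lt by linarith+
  have rd: "m' (M + r_list) (j * (n * n) + q) = adj n y q" using y[OF 2(1)] fr by simp
  show ?case
  proof (rule runs_simple, goal_cases)
    case 1
    then show ?case using X by (simp add: unpair_def Z)
  next
    case 2
    then show ?case unfolding Z using M fr fr' \<open>m' (M + r_p) 0 = q\<close> modX
      by (simp add: unpair_def mod_eq_minus_div del: mod_less_divisor)
  next
    case 3
    then show ?case by (simp add: unpair_def)
  next
    case 4
    show ?case
      using 2(4,5) fr fr' M rd
      by (auto simp: unpair_def mod_eq_minus_div less_Suc_eq adj_def)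
  qed
qed (use assms in \<open>auto simp: unpair_def initial_clique_def for_weight_def algebra_simps\<close>)

lemma runs_count_prog:
  assumes Z: "Z = {}" and M: "3 \<le> M" and nX: "n * n \<le> X" "2 ^ n \<le> X" "3 \<le> X" and k: "k \<le> X"
    and m: "m 1 0 = n" "m 1 1 = k" "m (M + r_nn) 0 = n * n" "m (M + r_count) 0 = c" "c = length ys"
    and ys: "holds n (m (M + r_list)) ys" and res: "(n choose k) * length (filter (initial_clique n k) ys) div c \<le> X"
  shows "runs (count_prog M) m p (20000 * (c + k + 1) * (n * n + 1) * w)
    (\<lambda>m' p'. p' = p \<and> m' 1 = (m 1)(3 := (n choose k) * length (filter (initial_clique n k) ys) div c))"
  unfolding count_prog_def
proof (rule runs_Seq[where Ba = "100 * w" and Bb = "18000 * (c + k + 1) * (n * n + 1) * w" and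
    R = "\<lambda>m' p'. p' = p \<and> m' (M + r_cliques) 0 = 0"], goal_cases)
  case 1
  then show ?case by (intro runs_simple) (use X Z in auto)
next
  case (2 m1 p1)
  then have [simp]: "p1 = p" by simp
  let ?F = "\<lambda>j. length (filter (initial_clique n k) (take j ys))"
  have fr1: "m1 a = m a" if "a \<noteq> M + r_cliques" for a using 2(2) that by simp
  have cX: "c \<le> X" using m(4) fr1[of "M + r_count"] Z bounded_outsideD[OF 2(1), of "M + r_count" 0] by simp
  show ?case
  proof (rule runs_Seq[where Ba = "(c + 1) * (5000 * (n * n + 1) * w)" and Bb = "10000 * (c + k + 1) * w" and
      R = "\<lambda>m' p'. p' = p \<and> m' (M + r_cliques) 0 = ?F c"], goal_cases)
    case 1
    show ?case
    proof (rule runs_For[where N = c and B = "4000 * (n * n + 1) * w" and I = "\<lambda>j m' p'. p' = p \<and> m' (M + r_cliques) 0 = ?F j"], goal_cases)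
      case (2 j m2 p2)
      then have [simp]: "p2 = p" by simp
      have fr2: "m2 1 = m 1" "m2 (M + r_nn) = m (M + r_nn)" "m2 (M + r_list) = m (M + r_list)"
        using 2(3) fr1 M by (auto simp: clique_test_def unpair_def)
      show ?case
      proof (rule runs_Seq[where Ba = "100 * w" and Bb = "3000 * (n * n + 1) * w" and R = "\<lambda>m' p'. p' = p \<and> m' (M + r_equal) 0 = 1"], goal_cases)
        case 1
        then show ?case by (intro runs_simple) (use X Z in auto)
      next
        case (2 m3 p3)
        then have [simp]: "p3 = p" by simp
        have fr3: "m3 a = m2 a" if "a \<noteq> M + r_equal" for a using 2(2) that by simp
        have fr3': "m3 1 0 = n" "m3 1 1 = k" "m3 (M + r_nn) 0 = n * n" "m3 (M + r_list) = m (M + r_list)" "m3 (M + r_j) 0 = j"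
          using fr3[of 1] fr3[of "M + r_nn"] fr3[of "M + r_list"] fr3[of "M + r_j"] fr2 m M \<open>m2 (M + r_j) 0 = j\<close> by auto
        show ?case
        proof (rule runs_Seq[OF runs_initial_clique[OF Z M nX(1), where y = "ys ! j" and j = j and k = k], where Bb = "100 * w"], goal_cases)
          case (7 m4 p4)
          have "m4 (M + r_cliques) = m3 (M + r_cliques)" using 7(2) by (simp add: clique_test_def unpair_def)
          then have F: "m4 (M + r_cliques) 0 = ?F j" using \<open>p2 = p \<and> _\<close> fr3[of "M + r_cliques"] by simp
          have "?F (Suc j) = ?F j + (if initial_clique n k (ys ! j) then 1 else 0)"
            using \<open>j < c\<close> m(5) by (simp add: take_Suc_conv_app_nth)
          moreover have "?F (Suc j) \<le> Suc j" by (rule order_trans[OF length_filter_le]) simp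
          then have "?F (Suc j) \<le> X" using \<open>j < c\<close> cX by linarith
          ultimately show ?case
            using 7(3) F by (intro runs_simple) (simp_all add: Z)
        qed (use fr3' 2(3) ys \<open>j < c\<close> m(5) in \<open>auto simp: holds_def algebra_simps\<close>)
      qed (simp add: algebra_simps)
    qed (use 2(3) fr1[of "M + r_count"] m(4) cX Z in \<open>auto simp: for_weight_def algebra_simps clique_test_def unpair_def\<close>)
  next
    case (2 m2 p2)
    then have [simp]: "p2 = p" by simp
    have fr2: "m2 1 = m 1" "m2 (M + r_count) = m (M + r_count)"
      using 2(2) fr1 M by (auto simp: clique_test_def unpair_def)
    show ?case
    proof (rule runs_Seq[where Ba = "100 * w" and Bb = "9000 * (c + k + 1) * w" and R = "\<lambda>m' p'. p' = p \<and> m' (M + r_binom) 0 = 1"], goal_cases)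
      case 1
      then show ?case by (intro runs_simple) (use X Z in auto)
    next
      case (2 m3 p3)
      then have [simp]: "p3 = p" by simp
      have fr3: "m3 1 = m 1" "m3 (M + r_count) = m (M + r_count)" "m3 (M + r_cliques) 0 = ?F c"
        using 2(2)[of 1] 2(2)[of "M + r_count"] 2(2)[of "M + r_cliques"] fr2 \<open>p2 = p \<and> _\<close> M by auto
      show ?case
      proof (rule runs_Seq[where Ba = "(k + 1) * (3000 * w)" and Bb = "100 * w" and R = "\<lambda>m' p'. p' = p \<and> m' (M + r_binom) 0 = (n choose k)"], goal_cases)
        case 1
        show ?case
        proof (rule runs_For[where N = k and B = "1000 * w" and I = "\<lambda>i m' p'. p' = p \<and> m' (M + r_binom) 0 = (n choose i)"], goal_cases)
          case (2 i m4 p4)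
          have "m4 1 0 = n" using 2(3)[of 1] fr3 m M by simp
          moreover have "(n choose Suc i) \<le> X" using binomial_le_pow2[of n "Suc i"] nX by linarith
          ultimately show ?case
            using 2(4,5) X M by (intro runs_simple) (simp_all add: Z binomial_step)
        qed (use 2(3) fr3 m M Z X k cX in \<open>auto simp: for_weight_def algebra_simps\<close>)
      next
        case (2 m4 p4)
        have "m4 1 = m 1" "m4 (M + r_count) 0 = c" "m4 (M + r_cliques) 0 = ?F c"
          using 2(2) fr3 m M by auto
        then show ?case
          using 2(3) nX res m(5) by (intro runs_simple) (simp_all add: Z)
      next
        case 3
        show ?case by (simp add: algebra_simps)
      qed
    qed (simp add: algebra_simps)
  qed (simp add: algebra_simps)
qed (simp add: algebra_simps)

end

section \<open>The majority vote over random queries\<close>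

definition sample_prog :: "nat \<Rightarrow> com" where
  "sample_prog M = Seq (set_reg M r_r (Lit 0)) (for_loop (M + r_j) (reg M r_L)
     (Seq (Coin (M + r_coin)) (set_reg M r_r (Op Add (Op Mul (Lit 2) (reg M r_r)) (reg M r_coin)))))"

text \<open>Exactly the positions of pairs \<open>u < v < n\<close> are written, which are those
  that a query reads; remains of earlier queries are thus overwritten.\<close>

definition write_query :: "nat \<Rightarrow> com" where
  "write_query M = for_loop (M + r_p) (reg M r_nn) (Seq (unpair M r_p r_u r_v)
     (If (Op Sub (reg M r_v) (reg M r_u))
       (Assign (M + r_query) (Op Add (Op Div (Op Mul (reg M r_v) (Op Sub (reg M r_v) (Lit 1))) (Lit 2)) (reg M r_u))
         (Cell (M + r_list) (Op Add (Op Mul (reg M r_r) (reg M r_nn)) (reg M r_p)))) Skip))"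

definition vote_prog :: "nat \<Rightarrow> com" where
  "vote_prog M = If (reg M r_votes) (If (neq_exp (reg M r_cand) (reg M r_answer))
     (set_reg M r_votes (Op Sub (reg M r_votes) (Lit 1))) (set_reg M r_votes (Op Add (reg M r_votes) (Lit 1))))
     (Seq (set_reg M r_cand (reg M r_answer)) (set_reg M r_votes (Lit 1)))"

definition sampling_prog :: "nat \<Rightarrow> nat \<Rightarrow> com" where
  "sampling_prog M K = Seq (Seq (set_reg M r_t (Op Mul (Lit K) (Op Mul (Cell 1 (Lit 2)) (Cell 1 (Lit 2))))) (set_reg M r_votes (Lit 0)))
     (Seq (for_loop (M + r_s) (reg M r_t) (Seq (sample_prog M) (Seq (write_query M)
       (Seq (Query (M + r_query) (M + r_answer)) (vote_prog M)))))
     (Assign 0 (Lit 0) (reg M r_cand)))"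

context ram
begin

text \<open>\<open>fits Z\<close> forbids reading the answer arrays, whose contents may exceed
  \<open>X\<close>. A program that reads them is costed with a bound \<open>Y\<close> on all of
  memory, while its outcome still respects \<open>X\<close> outside \<open>Z\<close>.\<close>

lemma runs_simple_wide:
  assumes "2 \<le> Y" "simple {} Y c" "bounded_outside Z X m \<Longrightarrow> bounded_outside {} Y m \<and> safe {} Y c m \<and> bounded_outside Z X (run c m)"
    "com_weight c * bitlength Y \<le> B" "Q (run c m) p"
  shows "runs c m p B Q"
  unfolding runs_def
proof
  assume "bounded_outside Z X m"
  note b = assms(3)[OF this]
  then obtain t where t: "exec n orc T \<omega> c (m, p) t (run c m, p)" "t \<le> com_weight c * bitlength Y"
    using exec_simple[OF assms(1,2)] by blast
  then show "outcome c m p B Q"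
    using exec_writes[OF t(1)] assms(4,5) b
    by (intro exI[of _ t] exI[of _ "run c m"] exI[of _ p]) (auto intro: le_trans)
qed

lemma runs_sample_prog:
  assumes Z: "Z = {0, M + r_answer, M + r_cand}" and M: "3 \<le> M" and L: "m (M + r_L) 0 = L" "2 ^ L \<le> X"
  shows "runs (sample_prog M) m p (5000 * w * w)
    (\<lambda>m' p'. p' = p + L \<and> m' (M + r_r) 0 = bits_value (map \<omega> [p..<p + L]))"
  unfolding sample_prog_def
proof (rule runs_Seq[where Ba = "100 * w" and Bb = "4000 * w * w" and R = "\<lambda>m' p'. p' = p \<and> m' (M + r_r) 0 = 0"], goal_cases)
  case 1
  then show ?case by (intro runs_simple) (use X Z M in auto)
next
  case (2 m1 p1)
  have "L < 2 ^ L" by (rule less_exp)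
  then have LX: "L \<le> X" using L(2) by linarith
  \<comment> \<open>An index below \<open>X\<close> needs fewer coins than \<open>X\<close> has
    bits, so drawing it costs only a second factor \<open>w\<close>.\<close>
  have Lw: "L + 1 \<le> w" using bitlength_mono[OF L(2)] by (simp add: bitlength_def)
  have L1: "m1 (M + r_L) 0 = L" using 2(2)[of "M + r_L"] L by simp
  show ?case
  proof (rule runs_For[where N = L and B = "1000 * w" and I = "\<lambda>h m' p'. p' = p + h \<and> m' (M + r_r) 0 = bits_value (map \<omega> [p..<p + h])"], goal_cases)
    case (2 h m2 p2)
    have snoc: "bits_value (map \<omega> [p..<p + Suc h]) = 2 * bits_value (map \<omega> [p..<p + h]) + of_bool (\<omega> (p + h))"
      by simp
    have "bits_value (map \<omega> [p..<p + Suc h]) < 2 ^ Suc h" using bits_value_less[of "map \<omega> [p..<p + Suc h]"] by simp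
    also have "\<dots> \<le> 2 ^ L" using 2(1) by (intro power_increasing) auto
    finally have le: "2 * bits_value (map \<omega> [p..<p + h]) + of_bool (\<omega> (p + h)) \<le> X" using L(2) snoc by linarith
    show ?case
    proof (rule runs_Seq[where Ba = w and Bb = "500 * w" and R = "\<lambda>m' p'. p' = p + Suc h \<and> m' = store (M + r_coin) 0 (of_bool (\<omega> (p + h))) m2"], goal_cases)
      case 1
      then show ?case using 2(5) w_pos by (intro runs_Coin) auto
    next
      case (2 m3 p3)
      then show ?case
        using le snoc \<open>p2 = p + h \<and> _\<close> by (intro runs_simple) (use X Z M in auto)
    qed simp
  next
    case 11
    have "(L + 1) * (1000 * w + for_weight (reg M r_L) * w) \<le> w * (1000 * w + for_weight (reg M r_L) * w)"
      using Lw by (intro mult_right_mono) auto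
    then show ?case by (simp add: for_weight_def algebra_simps)
  qed (use 2 L1 LX Z M in auto)
next
  case 3
  show ?case using w_pos by simp
qed

lemma runs_write_query:
  assumes Z: "Z = {0, M + r_answer, M + r_cand}" and M: "3 \<le> M" and nX: "n * n \<le> X"
    and m: "m 1 0 = n" "m (M + r_nn) 0 = n * n" "m (M + r_r) 0 = r" and r: "r < length ys"
    and ys: "holds n (m (M + r_list)) ys" "set ys \<subseteq> graphs n"
  shows "runs (write_query M) m p (2000 * (n * n + 1) * w) (\<lambda>m' p'. p' = p \<and> graph_of_vector n (m' (M + r_query)) = ys ! r)"
  unfolding write_query_def
proof (rule runs_For[where N = "n * n" and B = "1000 * w" and I = "\<lambda>j m' p'. p' = p \<and>
    (\<forall>q<j. q div n < q mod n \<longrightarrow> m' (M + r_query) (edge_pos (q div n) (q mod n)) = adj n (ys ! r) q)"], goal_cases)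
  case (2 j m' p')
  have fr: "m' 1 0 = n" "m' (M + r_nn) 0 = n * n" "m' (M + r_r) 0 = r" "m' (M + r_list) = m (M + r_list)"
    using 2(3) M m by (auto simp: unpair_def)
  then have fr': "m' (Suc 0) 0 = n" by simp
  have n0: "0 < n" using 2(1) by (cases n) auto
  then have lt: "j div n < n" "j mod n < n" using 2(1) by (auto simp: less_mult_imp_div_less)
  have "n \<le> X" using nX le_square[of n] by linarith
  then have modX: "j mod n \<le> X" "j div n \<le> X" using lt by linarith+
  have rd: "m' (M + r_list) (r * (n * n) + j) = adj n (ys ! r) j" using ys(1) r 2(1) by (simp add: fr holds_def)
  have adjX: "adj n (ys ! r) j \<le> X" using X by (simp add: adj_def)
  \<comment> \<open>Injectivity of positions protects what earlier rounds have written.\<close>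
  have ne: "edge_pos (q div n) (q mod n) \<noteq> edge_pos (j div n) (j mod n)"
    if "q < j" "q div n < q mod n" "j div n < j mod n" for q
    using edge_pos_inj[OF that(2,3)] that(1) by (metis div_mult_mod_eq less_irrefl)
  have ep: "j mod n * (j mod n - Suc 0) div 2 + j div n = edge_pos (j div n) (j mod n)"
    by (simp add: edge_pos_def choose_two)
  show ?case
  proof (rule runs_simple, goal_cases)
    case 1
    then show ?case using X M by (simp add: unpair_def Z)
  next
    case 2
    then show ?case unfolding Z using M fr fr' \<open>m' (M + r_p) 0 = j\<close> modX rd adjX
      by (simp add: unpair_def mod_eq_minus_div del: mod_less_divisor)
  next
    case 3
    then show ?case by (simp add: unpair_def)
  next
    case 4
    show ?case
      using 2(4,5) fr fr' M rd ep ne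
      by (auto simp: unpair_def mod_eq_minus_div less_Suc_eq)
  qed
next
  case (10 m' p')
  have "graph_of_vector n (m' (M + r_query)) = ys ! r"
  proof (rule graph_of_vector_eq)
    show "ys ! r \<in> graphs n" using ys(2) r by auto
    fix u v assume uv: "u < v" "v < n"
    then have "u * n + v < n * n" by (intro pair_index_less) auto
    moreover have "(u * n + v) div n = u" "(u * n + v) mod n = v" using uv by auto
    ultimately have "m' (M + r_query) (edge_pos u v) = adj n (ys ! r) (u * n + v)" using 10(3) uv by metis
    then show "m' (M + r_query) (edge_pos u v) = (if {u, v} \<in> ys ! r then 1 else 0)"
      using uv by (simp add: adj_pair)
  qed
  then show ?case using 10 by simp
qed (use assms in \<open>auto simp: unpair_def for_weight_def algebra_simps\<close>)

lemma runs_vote_prog: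
  assumes Z: "Z = {0, M + r_answer, M + r_cand}" and M: "3 \<le> M" and v: "m (M + r_votes) 0 < X"
    and T: "\<And>i. m 0 i < 2 ^ T" "\<And>i. m (M + r_answer) i < 2 ^ T" "\<And>i. m (M + r_cand) i < 2 ^ T"
  shows "runs (vote_prog M) m p (1000 * (w + T)) (\<lambda>m' p'. p' = p \<and>
    (m' (M + r_cand) 0, m' (M + r_votes) 0) = vote_step (m (M + r_answer) 0) (m (M + r_cand) 0, m (M + r_votes) 0) \<and>
    (\<forall>i. m' (M + r_cand) i < 2 ^ T))"
proof (rule runs_simple_wide[where Y = "max X (2 ^ T)"], goal_cases)
  case 1
  then show ?case using X by simp
next
  case 2
  then show ?case using X by (simp add: vote_prog_def le_max_iff_disj)
next
  case 3
  have "m a i \<le> max X (2 ^ T)" for a i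
    using 3 T[of i] unfolding bounded_outside_def Z
    by (cases "a = 0 \<or> a = M + r_answer \<or> a = M + r_cand") (auto simp: le_max_iff_disj intro: less_imp_le)
  moreover have "Suc (m (M + r_votes) 0) \<le> X" "Suc 0 \<le> X" using v X by simp_all
  moreover have "m (M + r_votes) 0 - Suc 0 \<le> X" using v by simp
  ultimately show ?case using 3 M
    by (auto simp: vote_prog_def val_neq_exp bounded_outside_def Z le_max_iff_disj)
next
  case 4
  have "bitlength (2 ^ T) = T + 1" by (simp add: bitlength_def)
  then have "bitlength (max X (2 ^ T)) \<le> w + T" using w_pos by (simp add: max_def)
  then have "com_weight (vote_prog M) * bitlength (max X (2 ^ T)) \<le> com_weight (vote_prog M) * (w + T)" by simp
  also have "\<dots> \<le> 1000 * (w + T)" by (intro mult_right_mono) (simp_all add: vote_prog_def)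
  finally show ?case .
next
  case 5
  show ?case using T by (auto simp: vote_prog_def val_neq_exp vote_step_def)
qed

lemma runs_sampling_prog:
  assumes Z: "Z = {0, M + r_answer, M + r_cand}" and M: "3 \<le> M" and nX: "n * n \<le> X" and tX: "K * (E * E) < X" "K \<le> X"
    and m: "m 1 0 = n" "m 1 2 = E" "m (M + r_nn) 0 = n * n" "m (M + r_L) 0 = L"
    and zero: "m 0 = (\<lambda>_. 0)" "m (M + r_answer) = (\<lambda>_. 0)" "m (M + r_cand) = (\<lambda>_. 0)"
    and ys: "holds n (m (M + r_list)) ys" "set ys \<subseteq> graphs n" and L: "2 ^ L \<le> length ys" "2 ^ L \<le> X"
    and T: "\<And>y. y \<in> graphs n \<Longrightarrow> orc y < 2 ^ T" and t: "t = K * (E * E)"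
  shows "runs (sampling_prog M K) m 0 (20000 * (t + 1) * ((n * n + 1) * w * w + T))
    (\<lambda>m' p'. m' 0 0 = fst (fold vote_step (map (\<lambda>r. orc (ys ! r)) (samples L t (map \<omega> [0..<t * L]))) (0, 0)))"
  unfolding sampling_prog_def
proof (rule runs_Seq[where Ba = "100 * w" and Bb = "15000 * (t + 1) * ((n * n + 1) * w * w + T)" and
    R = "\<lambda>m' p'. p' = 0 \<and> m' (M + r_t) 0 = t \<and> m' (M + r_votes) 0 = 0"], goal_cases)
  case 1
  then show ?case using X M tX m t by (intro runs_simple) (simp_all add: Z)
next
  case (2 m1 p1)
  let ?vote = "\<lambda>s. fold vote_step (map (\<lambda>r. orc (ys ! r)) (samples L s (map \<omega> [0..<s * L]))) (0, 0)"
  have fr1: "m1 a = m a" if "a \<noteq> M + r_t" "a \<noteq> M + r_votes" for a using 2(2) that by simp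
  have w1: "w \<le> (n * n + 1) * w * w" "w * w \<le> (n * n + 1) * w * w" "(n * n + 1) * w \<le> (n * n + 1) * w * w"
    using w_pos by simp_all
  have fr1': "m1 1 0 = n" "m1 (M + r_nn) 0 = n * n" "m1 (M + r_L) 0 = L" "holds n (m1 (M + r_list)) ys"
    using fr1[of 1] fr1[of "M + r_nn"] fr1[of "M + r_L"] fr1[of "M + r_list"] m M ys by auto
  show ?case
  proof (rule runs_Seq[where Ba = "(t + 1) * (12000 * ((n * n + 1) * w * w + T))" and Bb = "100 * (w + T)" and
      R = "\<lambda>m' p'. m' (M + r_cand) 0 = fst (?vote t) \<and> (\<forall>i. m' 0 i = 0) \<and> (\<forall>i. m' (M + r_cand) i < 2 ^ T) \<and> (\<forall>i. m' (M + r_answer) i < 2 ^ T)"], goal_cases)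
    case 1
    show ?case
    proof (rule runs_For[where N = t and B = "11000 * ((n * n + 1) * w * w + T)" and I = "\<lambda>s m' p'. p' = s * L \<and>
        (m' (M + r_cand) 0, m' (M + r_votes) 0) = ?vote s \<and> (\<forall>i. m' (M + r_cand) i < 2 ^ T) \<and> (\<forall>i. m' (M + r_answer) i < 2 ^ T)"], goal_cases)
      case (2 s m2 p2)
      have wr: "writes (Seq (sample_prog M) (Seq (write_query M) (Seq (Query (M + r_query) (M + r_answer)) (vote_prog M)))) =
        {M + r_r, M + r_j, M + r_coin, M + r_p, M + r_u, M + r_v, M + r_query, M + r_answer, M + r_votes, M + r_cand}"
        by (auto simp: sample_prog_def write_query_def vote_prog_def unpair_def)
      have fr2: "m2 a = m1 a" if "a \<noteq> M + r_s" "a \<notin> {M + r_r, M + r_j, M + r_coin, M + r_p, M + r_u, M + r_v, M + r_query, M + r_answer, M + r_votes, M + r_cand}" for a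
        using 2(3) that unfolding wr by blast
      have fr2': "m2 1 0 = n" "m2 (M + r_nn) 0 = n * n" "m2 (M + r_L) 0 = L" "holds n (m2 (M + r_list)) ys" "m2 0 = (\<lambda>_. 0)"
        using fr2[of 1] fr2[of "M + r_nn"] fr2[of "M + r_L"] fr2[of "M + r_list"] fr2[of 0] fr1[of 0] fr1' M zero by auto
      show ?case
      proof (rule runs_Seq[OF runs_sample_prog[OF Z M, where L = L], where Bb = "5000 * ((n * n + 1) * w * w + T)"], goal_cases)
        case (3 m3 p3)
        let ?r = "bits_value (map \<omega> [p2..<p2 + L])"
        have fr3: "m3 a = m2 a" if "a \<notin> {M + r_r, M + r_j, M + r_coin}" for a
          using 3(2) that by (simp add: sample_prog_def)
        have r: "m3 (M + r_r) 0 = ?r" "?r < length ys" "p3 = p2 + L"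
          using 3(3) bits_value_less[of "map \<omega> [p2..<p2 + L]"] L(1) by simp_all
        have fr3': "m3 1 0 = n" "m3 (M + r_nn) 0 = n * n" "holds n (m3 (M + r_list)) ys" "m3 0 = (\<lambda>_. 0)"
          "m3 (M + r_cand) = m2 (M + r_cand)" "m3 (M + r_answer) = m2 (M + r_answer)" "m3 (M + r_votes) = m2 (M + r_votes)"
          using fr3[of 1] fr3[of "M + r_nn"] fr3[of "M + r_list"] fr3[of 0] fr3[of "M + r_cand"] fr3[of "M + r_answer"] fr3[of "M + r_votes"] fr2' M by auto
        have ry: "ys ! ?r \<in> graphs n" using r(2) ys(2) by auto
        have samp: "samples L (Suc s) (map \<omega> [0..<Suc s * L]) = samples L s (map \<omega> [0..<s * L]) @ [?r]"
        proof -
          \<comment> \<open>Round \<open>s\<close> consumes just the block of coins that the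
            recursion of \<open>samples\<close> splits off.\<close>
          have split: "[0..<Suc s * L] = [0..<s * L] @ [s * L..<s * L + L]"
            using upt_add_eq_append[of 0 "s * L" L] by (simp add: add.commute)
          have "samples L s (map \<omega> [0..<Suc s * L]) = samples L s (map \<omega> [0..<s * L])"
            unfolding split map_append by (rule samples_append) simp
          moreover have "take L (drop (s * L) (map \<omega> [0..<Suc s * L])) = map \<omega> [s * L..<s * L + L]"
            unfolding split map_append by simp
          ultimately show ?thesis using \<open>p2 = s * L \<and> _\<close> by simp
        qed
        show ?case
        proof (rule runs_Seq[OF runs_write_query[OF Z M nX, where r = ?r and ys = ys], where Bb = "3000 * (w + T)"], goal_cases)
          case (7 m4 p4)
          have fr4: "m4 a = m3 a" if "a \<notin> {M + r_p, M + r_u, M + r_v, M + r_query}" for a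
            using 7(2) that by (simp add: write_query_def unpair_def)
          have fr4': "m4 0 = (\<lambda>_. 0)"
            "m4 (M + r_cand) = m2 (M + r_cand)" "m4 (M + r_answer) = m2 (M + r_answer)" "m4 (M + r_votes) = m2 (M + r_votes)"
            using fr4[of 0] fr4[of "M + r_cand"] fr4[of "M + r_answer"] fr4[of "M + r_votes"] fr3' M by auto
          show ?case
          proof (rule runs_Seq[where Ba = T and Bb = "2000 * (w + T)" and R = "\<lambda>m' p'. p' = p4 \<and> m' = store (M + r_answer) 0 (orc (ys ! ?r)) m4"], goal_cases)
            case 1
            show ?case using 7(3) by (intro runs_Query) (simp_all add: Z)
          next
            case (2 m5 p5)
            have vs: "(m2 (M + r_cand) 0, m2 (M + r_votes) 0) = ?vote s" using \<open>p2 = s * L \<and> _\<close> by simp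
            \<comment> \<open>The counter never exceeds the number of answers read; it may therefore
              live in an array bounded by \<open>X\<close>, unlike the candidate.\<close>
            have "m2 (M + r_votes) 0 \<le> s"
              using vote_bound[OF vs[symmetric]] by simp
            then have vX: "m2 (M + r_votes) 0 < X" using \<open>s < t\<close> tX t by simp
            show ?case
            proof (rule runs_conseq[OF runs_vote_prog[OF Z M]], goal_cases)
              case (6 m6 p6)
              have "m6 (M + r_answer) = m5 (M + r_answer)" using 6(2) by (simp add: vote_prog_def)
              moreover have "?vote (Suc s) = vote_step (orc (ys ! ?r)) (?vote s)" unfolding samp by simp
              ultimately show ?case
                using 6(3) 2(3) 7(3) r(3) fr4' vs \<open>p2 = s * L \<and> _\<close> T[OF ry] by auto
            qed (use 2(3) fr4' vX \<open>p2 = s * L \<and> _\<close> T[OF ry] in auto)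
          qed simp
        next
          case 8
          show ?case using w1 by (simp add: algebra_simps)
        qed (use fr3' r ys in auto)
      next
        case 4
        show ?case using w1 by (simp add: algebra_simps)
      qed (use fr2' L in auto)
    next
      case (10 m' p')
      have "m' 0 = m1 0" using 10(2)[of 0] M by (simp add: sample_prog_def write_query_def vote_prog_def unpair_def)
      then have "m' 0 = (\<lambda>_. 0)" using fr1[of 0] M zero by simp
      then show ?case using 10(3) by (metis fst_conv)
    next
      case 11
      have "11000 * ((n * n + 1) * w * w + T) + for_weight (reg M r_t) * w \<le> 12000 * ((n * n + 1) * w * w + T)"
      proof -
        obtain q where q: "(n * n + 1) * w * w = q" by blast
        have "for_weight (reg M r_t) * w = 400 * w" by (simp add: for_weight_def)
        then show ?thesis using w1(1) unfolding q distrib_left by linarith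
      qed
      then show ?case by (intro mult_left_mono) auto
    qed (use 2(3) fr1 zero t tX Z M in \<open>auto simp: sample_prog_def write_query_def vote_prog_def unpair_def\<close>)
  next
    case (2 m2 p2)
    show ?case
    proof (rule runs_simple_wide[where Y = "max X (2 ^ T)"], goal_cases)
      case 1
      then show ?case using X by simp
    next
      case 2
      then show ?case by simp
    next
      case 3
      have "m2 a i \<le> max X (2 ^ T)" for a i
        using 3 2(3) unfolding bounded_outside_def Z
        by (cases "a = 0 \<or> a = M + r_answer \<or> a = M + r_cand") (auto simp: le_max_iff_disj intro: less_imp_le)
      then show ?case using 3 by (auto simp: bounded_outside_def Z)
    next
      case 4
      have "bitlength (2 ^ T) = T + 1" by (simp add: bitlength_def)
      then have "bitlength (max X (2 ^ T)) \<le> w + T" using w_pos by (simp add: max_def)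
      then show ?case by simp
    next
      case 5
      then show ?case using 2(3) by simp
    qed
  next
    case 3
    obtain q where q: "(n * n + 1) * w * w = q" by blast
    have "100 * (w + T) \<le> (t + 1) * (100 * ((n * n + 1) * w * w + T))"
      using w1(1) unfolding q by (simp add: algebra_simps)
    then have "(t + 1) * (12000 * ((n * n + 1) * w * w + T)) + 100 * (w + T) \<le>
        (t + 1) * (12000 * ((n * n + 1) * w * w + T)) + (t + 1) * (100 * ((n * n + 1) * w * w + T))" by (rule add_left_mono)
    also have "\<dots> \<le> 15000 * (t + 1) * ((n * n + 1) * w * w + T)"
      unfolding q by (simp add: algebra_simps)
    finally show ?case .
  qed
next
  case 3
  have "w \<le> (n * n + 1) * w * w" using w_pos by simp
  then have "w \<le> (n * n + 1) * w * w + T" by (rule trans_le_add1)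
  moreover obtain q where q: "(n * n + 1) * w * w + T = q" by blast
  ultimately show ?case unfolding q by (simp add: algebra_simps)
qed

end

section \<open>The algorithm\<close>

definition sampled_orbit :: "nat \<Rightarrow> nat \<Rightarrow> graph \<Rightarrow> graph list" where
  "sampled_orbit n E x = orbit_list n (2 ^ level n E) (2 ^ level n E) x"

text \<open>Bounds the numbers in memory, except for oracle answers and for binomial coefficients.\<close>

definition word_bound :: "nat \<Rightarrow> nat \<Rightarrow> nat \<Rightarrow> nat" where
  "word_bound K n E = (200 + K) * (n * n * (E * E))"

text \<open>\<open>M\<close> exceeds all arrays mentioned in \<open>A\<close>, hence \<open>A\<close> finds its memory untouched apart from the
  clique count appended to its numerical inputs.\<close>

definition main_prog :: "nat \<Rightarrow> com \<Rightarrow> nat \<Rightarrow> com" where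
  "main_prog M A K = Seq (Seq (init_prog M) (orbit_prog M))
     (If (Op Sub (reg M r_N) (reg M r_count)) (Seq (count_prog M) A) (sampling_prog M K))"

lemma writes_orbit_phase:
  "writes (Seq (init_prog M) (orbit_prog M)) \<subseteq> (\<lambda>a. M + a) ` ({3..13} \<union> {24..28})"
  by (auto simp: init_prog_def level_prog_def load_prog_def orbit_prog_def expand_prog_def write_swapped_def
      search_list_def unpair_def image_iff)

lemma writes_count_prog: "writes (count_prog M) \<subseteq> insert 1 (range (\<lambda>a. M + a))"
  by (auto simp: count_prog_def clique_test_def unpair_def)

lemma sampled_orbit_props:
  assumes "x \<in> graphs n"
  shows "distinct (sampled_orbit n E x)" "set (sampled_orbit n E x) \<subseteq> orbit n x" "set (sampled_orbit n E x) \<subseteq> graphs n"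
  using orbit_list_props[of "2 ^ level n E" n "2 ^ level n E" x] orbit_subset_graphs[OF assms]
  unfolding sampled_orbit_def by auto

text \<open>A list shorter than \<open>N\<close> is the whole orbit without repetition, so the
  double counting can be solved for the clique count by exact division. For \<open>k > n\<close> the
  parameter is \<open>n + 1\<close> and both sides vanish.\<close>

lemma clique_count_formula:
  fixes n E k :: nat
  assumes x: "x \<in> graphs n" and len: "length (sampled_orbit n E x) < 2 ^ level n E"
  defines "k' \<equiv> min k (n + 1)" and "ys \<equiv> sampled_orbit n E x"
  shows "(n choose k') * length (filter (initial_clique n k') ys) div length ys = card (cliques n k x)"
proof (cases "k \<le> n")
  case True
  have ys: "distinct ys" "set ys = orbit n x"
    using sampled_orbit_props[OF x] orbit_list_complete[of "2 ^ level n E" n x] len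
    by (auto simp: ys_def sampled_orbit_def)
  have "orbit n x \<subseteq> graphs n" by (rule orbit_subset_graphs[OF x])
  then have "set (filter (initial_clique n k') ys) = {y \<in> orbit n x. is_clique y {..<k}}"
    using True initial_clique_iff[of _ n k] ys(2) by (auto simp: k'_def)
  then have "length (filter (initial_clique n k') ys) = card {y \<in> orbit n x. is_clique y {..<k}}"
    using ys(1) distinct_card[of "filter (initial_clique n k') ys"] by simp
  moreover have "length ys = card (orbit n x)" using ys distinct_card by metis
  ultimately have "(n choose k') * length (filter (initial_clique n k') ys) = card (cliques n k x) * length ys"
    using card_cliques_orbit[OF x, of k] True by (simp add: k'_def)
  moreover have "0 < length ys" using ys(2) self_in_orbit[of x n] by (cases ys) auto
  ultimately show ?thesis by simp
next
  case False
  have "cliques n k x = {}"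
  proof -
    have "card K \<le> n" if "K \<subseteq> {..<n}" for K using card_mono[OF _ that] by simp
    then show ?thesis using False by (force simp: cliques_def)
  qed
  then show ?thesis using False by (simp add: k'_def binomial_eq_0)
qed

lemma (in ram) runs_orbit_phase:
  assumes Z: "Z = {}" and M: "3 \<le> M" and XK: "X = word_bound K n E" and n: "1 \<le> n" "1 \<le> E"
    and m: "m 1 0 = n" "m 1 2 = E" "m 2 = indicator_vector x" "m (M + r_list) = (\<lambda>_. 0)"
    and x: "x \<in> graphs n"
  shows "runs (Seq (init_prog M) (orbit_prog M)) m p
    (2000000000 * (n * n * (E * E)) * (n * n * (E * E)) * (n * n) * (n * n) * w) (\<lambda>m' p'. p' = p \<and>
    m' (M + r_nn) 0 = n * n \<and> m' (M + r_L) 0 = level n E \<and> m' (M + r_N) 0 = 2 ^ level n E \<and>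
    m' (M + r_count) 0 = length (sampled_orbit n E x) \<and> holds n (m' (M + r_list)) (sampled_orbit n E x))"
proof -
  define S where "S = n * n * (E * E)"
  define q where "q = n * n"
  have q1: "1 \<le> q" using n by (simp add: q_def)
  have S1: "q \<le> S" using n by (simp add: S_def q_def)
  have tS: "target n E = 64 * S" by (simp add: target_def S_def)
  have XS: "X = (200 + K) * S" by (simp add: XK word_bound_def S_def)
  have X200: "200 * S \<le> X" by (simp add: XS)
  have N: "2 ^ level n E \<le> 128 * S" using level_le_target[of n E] tS q1 S1 by simp
  have "1 \<le> S" using S1 q1 by linarith
  have "2 ^ level n E + n * n < X" using N X200 S1 q1 unfolding q_def[symmetric] by linarith
  note bounds = this
  show ?thesis
  proof (rule runs_Seq[OF runs_init_prog[OF Z M, where E = E and x = x],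
      where Bb = "20000 * (2 ^ level n E + 1) * (2 ^ level n E + n * n + 1) * (n * n + 1) * (n * n + 1) * w"], goal_cases)
    case (10 m1 p1)
    have fr: "m1 1 = m 1"
      using 10(2)[of 1] M by (auto simp: init_prog_def level_prog_def load_prog_def unpair_def)
    show ?case
    proof (rule runs_conseq[OF runs_orbit_prog[OF Z M, where N = "2 ^ level n E" and x = x]], goal_cases)
      case (11 m2 p2)
      have "m2 (M + r_nn) = m1 (M + r_nn)" "m2 (M + r_L) = m1 (M + r_L)" "m2 (M + r_N) = m1 (M + r_N)"
        using 11(2) by (auto simp: orbit_prog_def expand_prog_def write_swapped_def search_list_def unpair_def)
      then show ?case using 11(3) \<open>p1 = p \<and> _\<close> by (simp add: sampled_orbit_def)
    next
      case 10
      show ?case by (rule order_refl)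
    qed (use 10 fr m x bounds in auto)
  next
    case 11
    have "10000 * (target n E + n * n + 1) * w \<le> 660000 * S * w"
      using S1 q1 by (intro mult_right_mono) (simp_all add: tS q_def[symmetric])
    also have "\<dots> \<le> 660000 * S * w * (S * (q * q))"
      using \<open>1 \<le> S\<close> q1 by simp
    finally have 1: "10000 * (target n E + n * n + 1) * w \<le> 660000 * S * S * q * q * w" by (simp add: mult_ac)
    \<comment> \<open>With \<open>N \<le> 128 * S\<close> and \<open>1 \<le> q \<le> S\<close>, the
      factors \<open>N + 1\<close>, \<open>N + n * n + 1\<close> and \<open>n * n + 1\<close> are at
      most \<open>129 * S\<close>, \<open>130 * S\<close> and \<open>2 * q\<close>.\<close>
    have "20000 * (2 ^ level n E + 1) * (2 ^ level n E + n * n + 1) * (n * n + 1) * (n * n + 1) * w \<le>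
      20000 * (129 * S) * (130 * S) * (2 * q) * (2 * q) * w"
      using N S1 q1 \<open>1 \<le> S\<close> unfolding q_def[symmetric] by (intro mult_mono) auto
    also have "\<dots> = 1341600000 * S * S * q * q * w" by simp
    finally have 2: "20000 * (2 ^ level n E + 1) * (2 ^ level n E + n * n + 1) * (n * n + 1) * (n * n + 1) * w \<le>
      1341600000 * S * S * q * q * w" .
    have "660000 * S * S * q * q * w + 1341600000 * S * S * q * q * w \<le> 2000000000 * S * S * q * q * w" by simp
    then show ?case using add_mono[OF 1 2] unfolding S_def q_def by (rule order_trans[rotated])
  qed (use m x bounds N X200 S1 q1 \<open>1 \<le> S\<close> tS in \<open>auto simp: q_def\<close>)
qed

lemma input_bounded:
  assumes n: "1 \<le> n" "1 \<le> E"
  shows "bounded_outside {} (word_bound K n E) (input [n, min k (n + 1), E] x)"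
proof -
  have "n * 1 * (1 * 1) \<le> n * n * (E * E)" using n by (intro mult_le_mono) auto
  moreover have "1 * 1 * (E * 1) \<le> n * n * (E * E)" using n by (intro mult_le_mono) auto
  moreover have "200 * (n * n * (E * E)) \<le> word_bound K n E" by (simp add: word_bound_def)
  ultimately have X: "n + 1 \<le> word_bound K n E" "E \<le> word_bound K n E" "1 \<le> word_bound K n E" using n by linarith+
  have "[n, min k (n + 1), E] ! i \<le> word_bound K n E" if "i < 3" for i
    using that X by (auto simp: less_Suc_eq numeral_3_eq_3 min_def)
  then show ?thesis
    using X indicator_vector_le_1[of x] le_trans[OF indicator_vector_le_1] by (auto simp: bounded_outside_def input_def)
qed

lemma word_bound_ge2: "1 \<le> n \<Longrightarrow> 1 \<le> E \<Longrightarrow> 2 \<le> word_bound K n E"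
proof -
  assume "1 \<le> n" "1 \<le> E"
  then have "1 * 1 * (1 * 1) \<le> n * n * (E * E)" by (intro mult_le_mono) auto
  then have "200 * 1 \<le> word_bound K n E" unfolding word_bound_def by (intro mult_le_mono) auto
  then show ?thesis by simp
qed

text \<open>The explicit index ranges record that registers 14 to 23 are untouched: the answer and
  candidate arrays are still zero when the vote begins.\<close>

lemma exec_orbit_phase:
  fixes M n E k K :: nat
  assumes M: "3 \<le> M" and n: "1 \<le> n" "1 \<le> E" and x: "x \<in> graphs n"
  defines "m0 \<equiv> input [n, min k (n + 1), E] x" and "W \<equiv> bitlength (word_bound K n E)"
  shows "\<exists>t m'. exec n orc T \<omega> (Seq (init_prog M) (orbit_prog M)) (m0, 0) t (m', 0) \<and>
    t \<le> 2000000000 * (n * n * (E * E)) * (n * n * (E * E)) * (n * n) * (n * n) * W \<and>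
    bounded_outside {} (word_bound K n E) m' \<and> (\<forall>a. a \<notin> (\<lambda>a. M + a) ` ({3..13} \<union> {24..28}) \<longrightarrow> m' a = m0 a) \<and>
    m' (M + r_nn) 0 = n * n \<and> m' (M + r_L) 0 = level n E \<and> m' (M + r_N) 0 = 2 ^ level n E \<and>
    m' (M + r_count) 0 = length (sampled_orbit n E x) \<and> holds n (m' (M + r_list)) (sampled_orbit n E x)"
proof -
  interpret ram n orc T \<omega> "{}" "word_bound K n E"
    using word_bound_ge2[OF n] by unfold_locales
  have m: "m0 1 0 = n" "m0 1 2 = E" "m0 2 = indicator_vector x" "m0 (M + r_list) = (\<lambda>_. 0)"
    using M by (auto simp: m0_def input_def fun_eq_iff)
  note r = runs_orbit_phase[OF refl M refl n m x, of 0, unfolded runs_def]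
  have "bounded_outside {} (word_bound K n E) m0" unfolding m0_def by (rule input_bounded[OF n])
  from r[THEN mp, OF this] show ?thesis
    using writes_orbit_phase[of M] unfolding W_def by blast
qed

abbreviation (input) orbit_cost :: "nat \<Rightarrow> nat \<Rightarrow> nat \<Rightarrow> nat" where
  "orbit_cost n E W \<equiv> (n * n * (E * E)) * (n * n * (E * E)) * (n * n) * (n * n) * W"

lemma exec_main_small:
  fixes M n E k K :: nat
  assumes M: "3 \<le> M" "mentions A \<subseteq> {..<M}" and n: "1 \<le> n" "1 \<le> E" and x: "x \<in> graphs n"
    and small: "length (sampled_orbit n E x) < 2 ^ level n E"
    and A: "det_computes A (input ([n, min k (n + 1), E] @ [card (cliques n k x)]) x) v B"
  defines "m0 \<equiv> input [n, min k (n + 1), E] x" and "W \<equiv> bitlength (word_bound K n E)"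
  shows "\<exists>t s. exec n orc T \<omega> (main_prog M A K) (m0, 0) t s \<and>
    real t \<le> 2100000000 * real (orbit_cost n E W) + B \<and> result s = v"
proof -
  let ?X = "word_bound K n E"
  let ?k = "min k (n + 1)"
  define ys where "ys = sampled_orbit n E x"
  \<comment> \<open>Binomial coefficients can reach \<open>2 ^ n\<close>, so counting is costed with
    a wider bound of at most \<open>n + 1 + W\<close> bits. There is room for this, because counting
    is linear in the length of the list and the enumeration quadratic.\<close>
  define Y where "Y = 2 ^ n * ?X"
  have X2: "2 \<le> ?X" by (rule word_bound_ge2[OF n])
  have XY: "?X \<le> Y" by (simp add: Y_def)
  interpret Y: ram n orc T \<omega> "{}" Y using X2 XY by unfold_locales simp
  obtain t1 m1 where 1: "exec n orc T \<omega> (Seq (init_prog M) (orbit_prog M)) (m0, 0) t1 (m1, 0)"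
    "t1 \<le> 2000000000 * (n * n * (E * E)) * (n * n * (E * E)) * (n * n) * (n * n) * W"
    "bounded_outside {} ?X m1" "\<forall>a. a \<notin> (\<lambda>a. M + a) ` ({3..13} \<union> {24..28}) \<longrightarrow> m1 a = m0 a"
    "m1 (M + r_nn) 0 = n * n" "m1 (M + r_N) 0 = 2 ^ level n E"
    "m1 (M + r_count) 0 = length ys" "holds n (m1 (M + r_list)) ys"
    using exec_orbit_phase[OF M(1) n x, of orc T \<omega> k K] unfolding m0_def W_def ys_def by blast
  have m1: "m1 a = m0 a" if "a < M" for a
  proof -
    have "a \<notin> (\<lambda>a. M + a) ` ({3..13} \<union> {24..28})" using that by auto
    then show ?thesis using 1(4) by blast
  qed
  define c where "c = card (cliques n k x)"
  have c: "(n choose ?k) * length (filter (initial_clique n ?k) ys) div length ys = c"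
    using clique_count_formula[OF x small, of k] by (simp add: ys_def c_def)
  have cY: "c \<le> Y"
  proof -
    have "length (filter (initial_clique n ?k) ys) \<le> length ys" by simp
    then have "(n choose ?k) * length (filter (initial_clique n ?k) ys) div length ys \<le> (n choose ?k) * length ys div length ys"
      by (intro div_le_mono mult_le_mono2)
    also have "\<dots> \<le> (n choose ?k)" by (cases "length ys = 0") auto
    also have "\<dots> \<le> 2 ^ n" by (rule binomial_le_pow2)
    also have "\<dots> \<le> Y" using X2 by (simp add: Y_def)
    finally show ?thesis using c by simp
  qed
  define S where "S = n * n * (E * E)"
  have "n * n \<le> S" "1 \<le> n * n" using n by (simp_all add: S_def)
  have "n \<le> n * n" by simp
  have XS: "200 * S \<le> ?X" by (simp add: word_bound_def S_def)
  have "2 ^ n \<le> Y" using X2 by (simp add: Y_def)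
  have "3 \<le> Y" using XS XY \<open>n * n \<le> S\<close> \<open>1 \<le> n * n\<close> by linarith
  have bY: "bounded_outside {} Y m1" using 1(3) XY by (auto simp: bounded_outside_def intro: le_trans)
  have "Y.runs (count_prog M) m1 0 (20000 * (length ys + ?k + 1) * (n * n + 1) * bitlength Y)
    (\<lambda>m' p'. p' = 0 \<and> m' 1 = (m1 1)(3 := (n choose ?k) * length (filter (initial_clique n ?k) ys) div length ys))"
  proof (rule Y.runs_count_prog, goal_cases)
    case 1
    then show ?case by (rule refl)
  next
    case 5
    show ?case by (rule \<open>3 \<le> Y\<close>)
  next
    case 13
    then show ?case using cY c by simp
  next
    case 6
    have "?k \<le> 2 * S" using \<open>n * n \<le> S\<close> \<open>1 \<le> n * n\<close> \<open>n \<le> n * n\<close> by linarith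
    then show ?case using XS XY by linarith
  qed (use M 1 m1 \<open>2 ^ n \<le> Y\<close> XY XS \<open>n * n \<le> S\<close> \<open>1 \<le> n * n\<close> in \<open>auto simp: m0_def input_def\<close>)
  then obtain t2 m2 where 2: "exec n orc T \<omega> (count_prog M) (m1, 0) t2 (m2, 0)"
    "t2 \<le> 20000 * (length ys + ?k + 1) * (n * n + 1) * bitlength Y"
    "\<forall>a. a \<notin> writes (count_prog M) \<longrightarrow> m2 a = m1 a" "m2 1 = (m1 1)(3 := c)"
    using bY unfolding Y.runs_def c by blast
  \<comment> \<open>Below \<open>M\<close> the memory is now indistinguishable from a fresh input of
    the given algorithm.\<close>
  have m2: "m2 a = input ([n, ?k, E] @ [c]) x a" if "a \<in> {..<M}" for a
  proof (cases "a = 1")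
    case True
    have "m1 1 = m0 1" using m1[of 1] M by simp
    then show ?thesis using True 2(4)
      by (auto simp: m0_def input_def fun_eq_iff nth_append less_Suc_eq numeral_3_eq_3)
  next
    case False
    then have "a \<notin> writes (count_prog M)" using that writes_count_prog[of M] by auto
    then show ?thesis using 2(3) m1[of a] False that by (auto simp: m0_def input_def fun_eq_iff)
  qed
  obtain t3 m3 where 3: "exec n orc T \<omega> A (m2, 0) t3 (m3, 0)" "real t3 \<le> B" "m3 0 0 = v"
    using det_computes_exec[OF A M(2), of m2 n orc T \<omega> 0] m2 M unfolding c_def by auto
  let ?e = "Op Sub (reg M r_N) (reg M r_count)"
  have test: "val ?e m1 \<noteq> 0" using 1(6,7) small by (simp add: ys_def)
  have f: "fits {} ?X ?e" by simp
  have ct: "cost ?e m1 + bitlength (val ?e m1) \<le> 20 * W"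
    using cost_le[OF 1(3) f X2] bitlength_val_le[OF 1(3) f X2] by (simp add: W_def)
  have ex: "exec n orc T \<omega> (main_prog M A K) (m0, 0) (t1 + (cost ?e m1 + bitlength (val ?e m1) + (t2 + t3))) (m3, 0)"
    unfolding main_prog_def
    by (rule exec.exec_Seq[OF 1(1)], rule exec.exec_If) (use test exec.exec_Seq[OF 2(1) 3(1)] in simp)
  have W1: "1 \<le> W" using bitlength_pos[of ?X] unfolding W_def by linarith
  define R where "R = S * S * (n * n) * (n * n) * W"
  have len: "length ys \<le> 128 * S"
    using small level_le_target[of n E] n by (simp add: ys_def target_def S_def)
  have bl: "bitlength Y \<le> 3 * (n * n) * W"
  proof -
    have "bitlength Y \<le> bitlength (2 ^ n) + W" unfolding Y_def W_def by (rule bitlength_mult_le)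
    also have "\<dots> = n + 1 + W" by (simp add: bitlength_def)
    also have "n + 1 + W \<le> n * n * W + n * n * W + n * n * W"
    proof -
      have "n * 1 \<le> n * n * W" "1 * 1 \<le> n * n * W" "1 * W \<le> n * n * W"
        using \<open>n \<le> n * n\<close> \<open>1 \<le> n * n\<close> W1 by (intro mult_le_mono; simp)+
      then show ?thesis by linarith
    qed
    finally show ?thesis by (simp add: algebra_simps)
  qed
  have "t2 \<le> 20000 * (131 * S) * (2 * (n * n)) * (3 * (n * n) * W)"
  proof -
    have "length ys + ?k + 1 \<le> 131 * S"
      using len \<open>n * n \<le> S\<close> \<open>1 \<le> n * n\<close> \<open>n \<le> n * n\<close> by linarith
    moreover have "n * n + 1 \<le> 2 * (n * n)" using \<open>1 \<le> n * n\<close> by linarith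
    ultimately show ?thesis using 2(2) bl by (elim order_trans) (intro mult_le_mono order_refl)
  qed
  also have "\<dots> = 15720000 * (S * (n * n) * (n * n) * W)" by simp
  also have "S * (n * n) * (n * n) * W \<le> R"
  proof -
    have "1 * (S * (n * n) * (n * n) * W) \<le> S * (S * (n * n) * (n * n) * W)"
      using \<open>n * n \<le> S\<close> \<open>1 \<le> n * n\<close> by (intro mult_le_mono order_refl) linarith
    then show ?thesis by (simp add: R_def mult_ac)
  qed
  finally have t2: "t2 \<le> 15720000 * R" by simp
  have "1 * 1 * 1 * 1 * W \<le> R" unfolding R_def
    using \<open>n * n \<le> S\<close> \<open>1 \<le> n * n\<close> by (intro mult_le_mono order_refl) linarith+
  then have "cost ?e m1 + bitlength (val ?e m1) \<le> 20 * R" using ct by linarith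
  moreover have "t1 \<le> 2000000000 * R" using 1(2) by (simp add: R_def S_def mult_ac)
  ultimately have "t1 + (cost ?e m1 + bitlength (val ?e m1) + t2) \<le> 2100000000 * R" using t2 by linarith
  then have "real (t1 + (cost ?e m1 + bitlength (val ?e m1) + t2)) \<le> 2100000000 * real R"
    by (metis of_nat_le_iff of_nat_mult of_nat_numeral)
  then have "real (t1 + (cost ?e m1 + bitlength (val ?e m1) + (t2 + t3))) \<le> 2100000000 * real R + B"
    using 3(2) by simp
  note time = this[unfolded R_def S_def]
  show ?thesis by (intro exI conjI, rule ex, rule time) (simp add: result_def 3(3))
qed

text \<open>The output is expressed as an explicit function of a finite prefix of the coins, so that
  its distribution can be computed by counting.\<close>

lemma exec_main_large:
  fixes M n E k K :: nat
  assumes M: "3 \<le> M" and n: "1 \<le> n" "1 \<le> E" and x: "x \<in> graphs n"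
    and large: "2 ^ level n E \<le> length (sampled_orbit n E x)"
    and T: "\<And>y. y \<in> graphs n \<Longrightarrow> orc y < 2 ^ T"
  defines "m0 \<equiv> input [n, min k (n + 1), E] x" and "W \<equiv> bitlength (word_bound K n E)"
    and "t0 \<equiv> K * (E * E)" and "L \<equiv> level n E"
  shows "\<exists>t s. exec n orc T \<omega> (main_prog M A K) (m0, 0) t s \<and>
    t \<le> 2000000020 * (orbit_cost n E W) +
      40000 * (t0 + 1) * (n * n * W * W + T) \<and>
    result s = fst (fold vote_step (map (\<lambda>r. orc (sampled_orbit n E x ! r)) (samples L t0 (map \<omega> [0..<t0 * L]))) (0, 0))"
proof -
  let ?X = "word_bound K n E"
  define ys where "ys = sampled_orbit n E x"
  \<comment> \<open>The arrays that oracle answers can reach: the answer itself, the candidate of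
    the vote, and the output.\<close>
  define Z where "Z = {0, M + r_answer, M + r_cand}"
  have X2: "2 \<le> ?X" by (rule word_bound_ge2[OF n])
  interpret R: ram n orc T \<omega> Z ?X using X2 by unfold_locales
  obtain t1 m1 where 1: "exec n orc T \<omega> (Seq (init_prog M) (orbit_prog M)) (m0, 0) t1 (m1, 0)"
    "t1 \<le> 2000000000 * (n * n * (E * E)) * (n * n * (E * E)) * (n * n) * (n * n) * W"
    "bounded_outside {} ?X m1" "\<forall>a. a \<notin> (\<lambda>a. M + a) ` ({3..13} \<union> {24..28}) \<longrightarrow> m1 a = m0 a"
    "m1 (M + r_nn) 0 = n * n" "m1 (M + r_N) 0 = 2 ^ level n E" "m1 (M + r_L) 0 = L"
    "m1 (M + r_count) 0 = length ys" "holds n (m1 (M + r_list)) ys"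
    using exec_orbit_phase[OF M(1) n x, of orc T \<omega> k K] unfolding m0_def W_def ys_def L_def by blast
  have m1: "m1 a = m0 a" if "a < M" for a
  proof -
    have "a \<notin> (\<lambda>a. M + a) ` ({3..13} \<union> {24..28})" using that by auto
    then show ?thesis using 1(4) by blast
  qed
  define S where "S = n * n * (E * E)"
  have S: "n * n \<le> S" "1 \<le> n * n" "E * E \<le> S" using n by (simp_all add: S_def)
  have XS: "?X = 200 * S + K * S" by (simp add: word_bound_def S_def algebra_simps)
  have KS: "K * (E * E) \<le> K * S" "K * 1 \<le> K * S" using S by (intro mult_le_mono order_refl; linarith)+
  have L: "2 ^ L \<le> 128 * S" using level_le_target[of n E] n by (simp add: target_def S_def L_def)
  have "R.runs (sampling_prog M K) m1 0 (20000 * (t0 + 1) * ((n * n + 1) * W * W + T))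
    (\<lambda>m' p'. m' 0 0 = fst (fold vote_step (map (\<lambda>r. orc (ys ! r)) (samples L t0 (map \<omega> [0..<t0 * L]))) (0, 0)))"
    unfolding W_def
  proof (rule R.runs_sampling_prog[where E = E], goal_cases)
    case 1
    then show ?case by (rule Z_def)
  next
    case 10
    have "m1 0 = m0 0" using m1[of 0] M by simp
    then show ?case by (simp add: m0_def input_def fun_eq_iff)
  next
    case 11
    have "M + r_answer \<notin> (\<lambda>a. M + a) ` ({3..13} \<union> {24..28})" by auto
    then have "m1 (M + r_answer) = m0 (M + r_answer)" using 1(4) by blast
    then show ?case using M by (simp add: m0_def input_def fun_eq_iff)
  next
    case 12
    have "M + r_cand \<notin> (\<lambda>a. M + a) ` ({3..13} \<union> {24..28})" by auto
    then have "m1 (M + r_cand) = m0 (M + r_cand)" using 1(4) by blast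
    then show ?case using M by (simp add: m0_def input_def fun_eq_iff)
  next
    case 3
    then show ?case using XS S by linarith
  next
    case 4
    then show ?case using XS S KS by linarith
  next
    case 5
    then show ?case using XS S KS by linarith
  next
    case 16
    then show ?case using XS L by linarith
  next
    case 18
    then show ?case by (simp add: t0_def)
  qed (use M 1 m1 large T sampled_orbit_props[OF x] in \<open>auto simp: m0_def input_def ys_def L_def\<close>)
  moreover have "bounded_outside Z ?X m1" using 1(3) by (auto simp: bounded_outside_def)
  ultimately obtain t2 m2 p2 where 2: "exec n orc T \<omega> (sampling_prog M K) (m1, 0) t2 (m2, p2)"
    "t2 \<le> 20000 * (t0 + 1) * ((n * n + 1) * W * W + T)"
    "m2 0 0 = fst (fold vote_step (map (\<lambda>r. orc (ys ! r)) (samples L t0 (map \<omega> [0..<t0 * L]))) (0, 0))"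
    unfolding R.runs_def by blast
  let ?e = "Op Sub (reg M r_N) (reg M r_count)"
  have test: "val ?e m1 = 0" using 1(6,8) large by (simp add: ys_def)
  have f: "fits {} ?X ?e" by simp
  have ct: "cost ?e m1 + bitlength (val ?e m1) \<le> 20 * W"
    using cost_le[OF 1(3) f X2] bitlength_val_le[OF 1(3) f X2] by (simp add: W_def)
  have ex: "exec n orc T \<omega> (main_prog M A K) (m0, 0) (t1 + (cost ?e m1 + bitlength (val ?e m1) + t2)) (m2, p2)"
    unfolding main_prog_def
    by (rule exec.exec_Seq[OF 1(1)], rule exec.exec_If) (use test 2(1) in simp)
  define R where "R = S * S * (n * n) * (n * n) * W"
  have "1 * 1 * 1 * 1 * W \<le> R" unfolding R_def
    using S by (intro mult_le_mono order_refl) linarith+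
  then have "cost ?e m1 + bitlength (val ?e m1) \<le> 20 * R" using ct by linarith
  moreover have "t1 \<le> 2000000000 * R" using 1(2) by (simp add: R_def S_def mult_ac)
  moreover have "t2 \<le> 40000 * (t0 + 1) * (n * n * W * W + T)"
  proof -
    have "(n * n + 1) * W * W \<le> (2 * (n * n)) * W * W" using S(2) by (intro mult_le_mono order_refl) linarith
    moreover have "2 * (n * n) * W * W + 2 * T = 2 * (n * n * W * W + T)" by (simp add: algebra_simps)
    ultimately have "(n * n + 1) * W * W + T \<le> 2 * (n * n * W * W + T)"
      using add_mono[of "(n * n + 1) * W * W" "2 * (n * n) * W * W" T "2 * T"] by simp
    then have "20000 * (t0 + 1) * ((n * n + 1) * W * W + T) \<le> 20000 * (t0 + 1) * (2 * (n * n * W * W + T))"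
      by (rule mult_le_mono2)
    also have "\<dots> = 40000 * (t0 + 1) * (n * n * W * W + T)" by (simp add: algebra_simps)
    finally show ?thesis using 2(2) by (rule order_trans[rotated])
  qed
  ultimately have "t1 + (cost ?e m1 + bitlength (val ?e m1) + t2) \<le> 2000000020 * R + 40000 * (t0 + 1) * (n * n * W * W + T)"
    by linarith
  note time = this[unfolded R_def S_def]
  show ?thesis by (intro exI conjI, rule ex, rule time) (simp add: result_def 2(3) ys_def)
qed

section \<open>Success probability\<close>

lemma choose_two_le: "n choose 2 \<le> n * n"
proof -
  have "n * (n - 1) div 2 \<le> n * (n - 1)" by simp
  also have "\<dots> \<le> n * n" by simp
  finally show ?thesis by (simp add: choose_two)
qed

text \<open>\<open>Y\<close> will be the set of inputs with at least \<open>N\<close> graphs found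
  and \<open>W x\<close> the first \<open>N\<close> of them. Neither depends on \<open>S\<close>, so
  a union bound over \<open>Y\<close> applies.\<close>

lemma random_subset_hits:
  fixes W :: "graph \<Rightarrow> graph set" and \<epsilon> :: real
  assumes eps: "0 < \<epsilon>" "\<epsilon> \<le> 1/2" and n: "1 \<le> n" and Y: "Y \<subseteq> graphs n"
    and W: "\<And>x. x \<in> Y \<Longrightarrow> W x \<subseteq> graphs n \<and> card (W x) = N" and N: "64 * (real n)\<^sup>2 / \<epsilon>\<^sup>2 \<le> N"
  shows "measure_pmf.prob (random_subset n (1/2 + \<epsilon>)) {S. \<forall>x\<in>Y. real (card (W x - S)) \<le> (1/2 - \<epsilon>/2) * N}
    \<ge> 1 - 2 powr (- (real n)\<^sup>2)"
proof -
  define u where "u = card (graphs n)"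
  define s where "s = nat \<lfloor>(1/2 + \<epsilon>) * 2 ^ (n choose 2)\<rfloor>"
  define A where "A = {S. S \<subseteq> graphs n \<and> card S = s}"
  define \<tau> where "\<tau> = 1/2 - \<epsilon>/2"
  let ?G = "{S. \<forall>x\<in>Y. real (card (W x - S)) \<le> \<tau> * N}"
  let ?B = "\<lambda>x. {S. S \<subseteq> graphs n \<and> card S = s \<and> \<tau> * card (W x) < card (W x - S)}"
  have u: "u = 2 ^ (n choose 2)" by (simp add: u_def card_graphs)
  have u0: "0 < u" by (simp add: u)
  have sr: "real s \<le> (1/2 + \<epsilon>) * u" "(1/2 + \<epsilon>) * u - 1 \<le> real s"
  proof -
    have "0 \<le> (1/2 + \<epsilon>) * 2 ^ (n choose 2)" using eps by simp
    then have "real s = of_int \<lfloor>(1/2 + \<epsilon>) * 2 ^ (n choose 2)\<rfloor>" by (simp add: s_def)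
    then show "real s \<le> (1/2 + \<epsilon>) * u" "(1/2 + \<epsilon>) * u - 1 \<le> real s"
      using of_int_floor_le[of "(1/2 + \<epsilon>) * 2 ^ (n choose 2) :: real"]
        real_of_int_floor_ge_diff_one[of "(1/2 + \<epsilon>) * 2 ^ (n choose 2) :: real"] by (simp_all add: u)
  qed
  have "(1/2 + \<epsilon>) * real u \<le> 1 * real u" using eps by (intro mult_right_mono) auto
  then have su: "s \<le> u" using sr(1) by linarith
  have cardA: "card A = u choose s" unfolding A_def u_def by (intro n_subsets) simp
  have finA: "finite A" unfolding A_def by simp
  have A0: "0 < card A" using cardA su by (simp add: zero_less_binomial)
  then have Ane: "A \<noteq> {}" by auto
  have bad: "real (card (?B x)) \<le> real (u choose s) * exp (- 2 * (real n)\<^sup>2)" if x: "x \<in> Y" for x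
  proof -
    \<comment> \<open>The very existence of \<open>N\<close> graphs makes \<open>u\<close> at least
      4/\<epsilon>, so rounding down the size of \<open>S\<close> raises the missed fraction by at
      most 1/u \<le> \<epsilon>/4.\<close>
    have "N \<le> u" using card_mono[of "graphs n" "W x"] W[OF x] by (simp add: u_def)
    have "1 \<le> (real n)\<^sup>2" using n by simp
    have "4 / \<epsilon> \<le> 64 * (real n)\<^sup>2 / \<epsilon>\<^sup>2"
    proof -
      have "\<epsilon> * 4 \<le> 64 * 1" using eps by linarith
      also have "\<dots> \<le> 64 * (real n)\<^sup>2" using \<open>1 \<le> (real n)\<^sup>2\<close> by linarith
      finally have "\<epsilon> * 4 / \<epsilon>\<^sup>2 \<le> 64 * (real n)\<^sup>2 / \<epsilon>\<^sup>2" by (intro divide_right_mono) auto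
      then show ?thesis using eps by (simp add: power2_eq_square)
    qed
    then have "4 / \<epsilon> \<le> u" using N \<open>N \<le> u\<close> by linarith
    then have "1 / real u \<le> \<epsilon> / 4" using eps u0 by (simp add: field_simps)
    have q: "(real u - real s) / real u \<le> 1/2 - \<epsilon> + 1 / real u"
    proof -
      have "(real u - real s) / real u \<le> (real u - ((1/2 + \<epsilon>) * u - 1)) / real u"
        using sr(2) by (intro divide_right_mono) auto
      also have "\<dots> = 1/2 - \<epsilon> + 1 / real u" using u0 by (simp add: field_simps)
      finally show ?thesis .
    qed
    \<comment> \<open>Of the margin \<epsilon>/2 between \<tau> and the ideal fraction 1/2 -
      \<epsilon>, rounding takes at most half.\<close>
    then have gap: "\<epsilon> / 4 \<le> \<tau> - (real u - real s) / real u" using \<open>1 / real u \<le> \<epsilon> / 4\<close> unfolding \<tau>_def by linarith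
    then have q\<tau>: "(real u - real s) / real u \<le> \<tau>" using eps by linarith
    have "real (card (?B x)) \<le> real (u choose s) * exp (- (\<tau> - (real u - real s) / real u)\<^sup>2 * card (W x) / 2)"
      using W[OF x] q\<tau> eps by (intro hypergeometric_tail) (auto simp: u_def[symmetric] u0 su \<tau>_def)
    also have "\<dots> \<le> real (u choose s) * exp (- 2 * (real n)\<^sup>2)"
    proof -
      have "2 * (real n)\<^sup>2 = (\<epsilon> / 4)\<^sup>2 * (64 * (real n)\<^sup>2 / \<epsilon>\<^sup>2) / 2" using eps by (simp add: power_divide)
      also have "\<dots> \<le> (\<tau> - (real u - real s) / real u)\<^sup>2 * N / 2"
        using gap eps N by (intro divide_right_mono mult_mono power_mono) auto
      finally show ?thesis using W[OF x] by (intro mult_left_mono) auto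
    qed
    finally show ?thesis .
  qed
  have sub: "A - (\<Union>x\<in>Y. ?B x) \<subseteq> A \<inter> ?G"
  proof
    fix S assume S: "S \<in> A - (\<Union>x\<in>Y. ?B x)"
    have "real (card (W x - S)) \<le> \<tau> * N" if x: "x \<in> Y" for x
    proof -
      have "S \<notin> ?B x" using S x by blast
      then have "\<not> \<tau> * card (W x) < card (W x - S)" using S by (simp add: A_def)
      then show ?thesis using W[OF x] by simp
    qed
    then show "S \<in> A \<inter> ?G" using S by simp
  qed
  have finY: "finite Y" using Y finite_subset finite_graphs by blast
  have "real (card (\<Union>x\<in>Y. ?B x)) \<le> (\<Sum>x\<in>Y. real (card (?B x)))"
    unfolding of_nat_sum[symmetric] of_nat_le_iff by (rule card_UN_le[OF finY])
  also have "\<dots> \<le> (\<Sum>x\<in>Y. real (u choose s) * exp (- 2 * (real n)\<^sup>2))" by (intro sum_mono bad)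
  also have "\<dots> = real (card Y) * (real (u choose s) * exp (- 2 * (real n)\<^sup>2))" by simp
  \<comment> \<open>There are at most e^(n^2) inputs, so the union bound spends half of the
    exponent.\<close>
  also have "\<dots> \<le> exp ((real n)\<^sup>2) * (real (u choose s) * exp (- 2 * (real n)\<^sup>2))"
  proof -
    have "real (card Y) \<le> real u" using card_mono[OF finite_graphs Y] by (simp add: u_def)
    also have "real u = 2 ^ (n choose 2)" by (simp add: u)
    also have "\<dots> \<le> 2 ^ (n * n)" by (intro power_increasing choose_two_le) simp
    also have "\<dots> \<le> exp 1 ^ (n * n)" using exp_ge_add_one_self[of 1] by (intro power_mono) auto
    also have "\<dots> = exp ((real n)\<^sup>2)" by (simp add: exp_of_nat_mult[symmetric] power2_eq_square)
    finally show ?thesis by (intro mult_right_mono) auto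
  qed
  also have "\<dots> = real (card A) * exp (- (real n)\<^sup>2)"
    by (simp add: cardA exp_add[symmetric])
  finally have badU: "real (card (\<Union>x\<in>Y. ?B x)) \<le> real (card A) * exp (- (real n)\<^sup>2)" .
  have "real (card A) - real (card (\<Union>x\<in>Y. ?B x)) \<le> real (card (A - (\<Union>x\<in>Y. ?B x)))"
  proof -
    have fin: "finite (\<Union>x\<in>Y. ?B x)" using finY finA by (auto simp: A_def intro: finite_subset[of _ A])
    have "card A - card (\<Union>x\<in>Y. ?B x) \<le> card (A - (\<Union>x\<in>Y. ?B x))" by (rule diff_card_le_card_Diff[OF fin])
    then show ?thesis by linarith
  qed
  also have "\<dots> \<le> real (card (A \<inter> ?G))" using finA sub by (simp add: card_mono)
  finally have "real (card A) - real (card A) * exp (- (real n)\<^sup>2) \<le> real (card (A \<inter> ?G))" using badU by linarith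
  then have "1 - exp (- (real n)\<^sup>2) \<le> real (card (A \<inter> ?G)) / real (card A)"
    using A0 by (simp add: field_simps)
  also have "\<dots> = measure_pmf.prob (random_subset n (1/2 + \<epsilon>)) ?G"
    unfolding random_subset_def s_def[symmetric] A_def[symmetric] by (rule measure_pmf_of_set[OF Ane finA, symmetric])
  finally have "1 - exp (- (real n)\<^sup>2) \<le> measure_pmf.prob (random_subset n (1/2 + \<epsilon>)) ?G" .
  moreover have "exp (- (real n)\<^sup>2) \<le> 2 powr (- (real n)\<^sup>2)"
  proof -
    have "(real n)\<^sup>2 * ln 2 \<le> (real n)\<^sup>2 * 1" using ln_2_less_1 by (intro mult_left_mono) auto
    then show ?thesis by (simp add: powr_def)
  qed
  ultimately show ?thesis unfolding \<tau>_def by linarith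
qed

text \<open>A sample is wrong with probability at most 1/2 - \<epsilon>/2; the deviation
  \<epsilon>/2 gives the exponent \<epsilon>^2 t / 8, whence the 8 in the bound on \<open>K\<close>
  for an error of at most \<delta>.\<close>

lemma majority_vote_success:
  fixes \<delta> \<epsilon> :: real
  assumes wrong: "real (card {r. r < 2 ^ L \<and> ans r \<noteq> v}) \<le> (1/2 - \<epsilon>/2) * 2 ^ L" and eps: "0 < \<epsilon>" "\<epsilon> \<le> 1/2"
    and \<delta>: "0 < \<delta>" "8 * ln (1 / \<delta>) \<le> K" and t: "K / \<epsilon>\<^sup>2 \<le> real t"
  shows "1 - \<delta> \<le> measure coins {\<omega>. fst (fold vote_step (map ans (samples L t (map \<omega> [0..<t * L]))) (0, 0)) = v}"
proof -
  let ?P = "\<lambda>bs. fst (fold vote_step (map ans (samples L t bs)) (0, 0)) = v"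
  let ?m = "t * L"
  let ?wrong = "\<lambda>bs. length (filter (\<lambda>r. r \<in> {r. ans r \<noteq> v}) (samples L t bs))"
  have "real (card {bs. length bs = ?m \<and> \<not> ?P bs}) \<le> real (card {bs. length bs = ?m \<and> real t \<le> 2 * real (?wrong bs)})"
  proof -
    have "real t \<le> 2 * real (?wrong bs)" if "\<not> ?P bs" for bs
    proof -
      have "count_list (map ans rs) v + length (filter (\<lambda>r. r \<in> {r. ans r \<noteq> v}) rs) = length rs" for rs
        by (induction rs) auto
      from this[of "samples L t bs"] show ?thesis
        using vote_majority[of "map ans (samples L t bs)" v 0] that by fastforce
    qed
    then have "{bs. length bs = ?m \<and> \<not> ?P bs} \<subseteq> {bs. length bs = ?m \<and> real t \<le> 2 * real (?wrong bs)}" by blast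
    then show ?thesis using finite_bits by (simp add: card_mono)
  qed
  also have "\<dots> \<le> 2 ^ ?m * exp (- (1/2 - (1/2 - \<epsilon>/2))\<^sup>2 * t / 2)"
    using wrong eps by (intro samples_majority) auto
  also have "\<dots> \<le> 2 ^ ?m * \<delta>"
  proof -
    have "8 * ln (1 / \<delta>) \<le> \<epsilon>\<^sup>2 * t" using t \<delta> eps by (simp add: field_simps)
    then have "- (1/2 - (1/2 - \<epsilon>/2))\<^sup>2 * t / 2 \<le> ln \<delta>" using \<delta> by (simp add: ln_div power2_eq_square field_simps)
    then have "exp (- (1/2 - (1/2 - \<epsilon>/2))\<^sup>2 * t / 2) \<le> exp (ln \<delta>)" by (simp only: exp_le_cancel_iff)
    then show ?thesis using \<delta>(1) by simp
  qed
  finally have bad: "real (card {bs. length bs = ?m \<and> \<not> ?P bs}) \<le> 2 ^ ?m * \<delta>" .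
  have "card {bs :: bool list. length bs = ?m} = card {bs. length bs = ?m \<and> ?P bs} + card {bs. length bs = ?m \<and> \<not> ?P bs}"
    using finite_bits[of ?m ?P] finite_bits[of ?m "\<lambda>bs. \<not> ?P bs"]
    by (subst card_Un_disjoint[symmetric]) (auto intro: arg_cong[where f = card])
  moreover have "card {bs :: bool list. length bs = ?m} = 2 ^ ?m"
    using card_lists_length_eq[of "UNIV :: bool set" ?m] by simp
  ultimately have "2 ^ ?m = card {bs. length bs = ?m \<and> ?P bs} + card {bs. length bs = ?m \<and> \<not> ?P bs}" by (rule trans[OF sym, rotated])
  then have "real (2 ^ ?m) = real (card {bs. length bs = ?m \<and> ?P bs}) + real (card {bs. length bs = ?m \<and> \<not> ?P bs})"
    by (simp only: of_nat_add)
  moreover have "real (2 ^ ?m) = 2 ^ ?m" by simp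
  ultimately have "real (card {bs. length bs = ?m \<and> ?P bs}) = 2 ^ ?m - real (card {bs. length bs = ?m \<and> \<not> ?P bs})"
    by linarith
  then have "real (card {bs. length bs = ?m \<and> ?P bs}) \<ge> 2 ^ ?m * (1 - \<delta>)" using bad by (simp add: algebra_simps)
  then have "1 - \<delta> \<le> real (card {bs. length bs = ?m \<and> ?P bs}) / 2 ^ ?m" by (simp add: field_simps)
  then show ?thesis using measure_coins_prefix[of ?P ?m] by simp
qed

section \<open>Running time\<close>

text \<open>The solution \<open>e\<close> of \<open>y powr e = 1 + ln y\<close>. It tends to 0, so
  for y = n/\<epsilon> a logarithmic factor becomes n^(o(1)) / \<epsilon>^(o(1)).\<close>

definition log_exponent :: "real \<Rightarrow> real" where
  "log_exponent y = ln (1 + ln y) / ln y"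

lemma powr_log_exponent:
  assumes "1 < y"
  shows "y powr log_exponent y = 1 + ln y"
proof -
  have ln: "ln y > 0" using assms by simp
  then have "log_exponent y * ln y = ln (1 + ln y)" by (simp add: log_exponent_def)
  moreover have "exp (ln (1 + ln y)) = 1 + ln y" using ln by (intro exp_ln) linarith
  moreover have "y \<noteq> 0" using assms by linarith
  ultimately show ?thesis by (simp only: powr_def if_False)
qed

lemma log_exponent_tendsto: "(log_exponent \<longlongrightarrow> 0) at_top"
  unfolding log_exponent_def by real_asymp

lemma bitlength_le_log: "1 \<le> x \<Longrightarrow> real (bitlength x) \<le> 1 + ln (real x) / ln 2"
proof -
  assume "1 \<le> x"
  then have "2 ^ floor_log x \<le> x" by (intro floor_log_exp2_le) simp
  then have "(2 :: real) ^ floor_log x \<le> real x" by (metis of_nat_le_iff of_nat_numeral of_nat_power)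
  then have "ln ((2 :: real) ^ floor_log x) \<le> ln (real x)" using \<open>1 \<le> x\<close> by (intro ln_mono) auto
  then show ?thesis by (simp add: bitlength_def ln_realpow field_simps)
qed

lemma ceiling_inverse_bounds:
  fixes \<epsilon> :: real
  assumes "0 < \<epsilon>" "\<epsilon> \<le> 1/2"
  shows "1 / \<epsilon> \<le> real (nat \<lceil>1 / \<epsilon>\<rceil>)" "real (nat \<lceil>1 / \<epsilon>\<rceil>) \<le> 2 / \<epsilon>" "1 \<le> nat \<lceil>1 / \<epsilon>\<rceil>"
proof -
  have "2 \<le> 1 / \<epsilon>" using assms by (simp add: field_simps)
  then show 1: "1 / \<epsilon> \<le> real (nat \<lceil>1 / \<epsilon>\<rceil>)" by linarith
  have "real (nat \<lceil>1 / \<epsilon>\<rceil>) \<le> 1 / \<epsilon> + 1" using \<open>2 \<le> 1 / \<epsilon>\<close> by linarith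
  also have "\<dots> \<le> 1 / \<epsilon> + 1 / \<epsilon>" using \<open>2 \<le> 1 / \<epsilon>\<close> by linarith
  finally show "real (nat \<lceil>1 / \<epsilon>\<rceil>) \<le> 2 / \<epsilon>" by simp
  show "1 \<le> nat \<lceil>1 / \<epsilon>\<rceil>" using 1 \<open>2 \<le> 1 / \<epsilon>\<close> by linarith
qed

text \<open>Since \<open>E\<close> is at most 2/\<epsilon>, \<open>word_bound\<close> is at most
  \<open>(800 + 4 * K) * y ^ 2\<close> with y = n/\<epsilon>; the summand 2 stems from the
  square.\<close>

definition log_factor :: "nat \<Rightarrow> real" where
  "log_factor K = 1 + (ln (800 + 4 * real K) + 2) / ln 2"

lemma log_factor_ge1: "1 \<le> log_factor K"
  by (simp add: log_factor_def)

lemma bitlength_word_bound: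
  fixes \<epsilon> :: real
  assumes eps: "0 < \<epsilon>" "\<epsilon> \<le> 1/2" and n: "1 \<le> n"
  shows "real (bitlength (word_bound K n (nat \<lceil>1 / \<epsilon>\<rceil>))) \<le> log_factor K * (1 + ln (n / \<epsilon>))"
proof -
  let ?E = "nat \<lceil>1 / \<epsilon>\<rceil>" and ?y = "real n / \<epsilon>"
  note E = ceiling_inverse_bounds[OF eps]
  have X2: "2 \<le> word_bound K n ?E" by (rule word_bound_ge2[OF n E(3)])
  have y: "1 \<le> ?y" using eps n by (simp add: field_simps)
  have "real (word_bound K n ?E) = (200 + real K) * (real n * real ?E)\<^sup>2"
    by (simp add: word_bound_def power2_eq_square)
  also have "\<dots> \<le> (200 + real K) * (real n * (2 / \<epsilon>))\<^sup>2"
    using E by (intro mult_left_mono power_mono) auto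
  also have "\<dots> = (800 + 4 * real K) * ?y\<^sup>2" by (simp add: power2_eq_square field_simps)
  finally have X: "real (word_bound K n ?E) \<le> (800 + 4 * real K) * ?y\<^sup>2" .
  have c0: "0 \<le> ln (800 + 4 * real K)" by simp
  have "real (bitlength (word_bound K n ?E)) \<le> 1 + ln (real (word_bound K n ?E)) / ln 2"
    using X2 by (intro bitlength_le_log) simp
  also have "\<dots> \<le> 1 + ln ((800 + 4 * real K) * ?y\<^sup>2) / ln 2"
    using X X2 by (intro add_left_mono divide_right_mono ln_mono) auto
  also have "ln ((800 + 4 * real K) * ?y\<^sup>2) = ln (800 + 4 * real K) + 2 * ln ?y"
    using y n eps by (subst ln_mult) (auto simp: ln_realpow)
  also have "1 + (ln (800 + 4 * real K) + 2 * ln ?y) / ln 2 \<le> log_factor K * (1 + ln ?y)"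
  proof -
    have "0 \<le> ln ?y" using y by simp
    then have "log_factor K * (1 + ln ?y) - (1 + (ln (800 + 4 * real K) + 2 * ln ?y) / ln 2) =
        ln ?y + (2 + ln (800 + 4 * real K) * ln ?y) / ln 2"
      by (simp add: log_factor_def field_simps)
    moreover have "0 \<le> ln ?y + (2 + ln (800 + 4 * real K) * ln ?y) / ln 2"
      using \<open>0 \<le> ln ?y\<close> c0 by (intro add_nonneg_nonneg divide_nonneg_nonneg mult_nonneg_nonneg) auto
    ultimately show ?thesis by linarith
  qed
  finally show ?thesis .
qed

text \<open>As n \<ge> 1 and \<epsilon> < 1, absolute values in the exponents only enlarge
  \<open>G\<close>, which then dominates the terms for either sign of \<open>a\<close> and
  \<open>b\<close>. Twice \<open>log_exponent\<close> pays for the square of a word length.\<close>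

lemma time_exponents:
  fixes n \<epsilon> a b :: real
  assumes eps: "0 < \<epsilon>" "\<epsilon> \<le> 1/2" and n: "1 \<le> n"
  defines "y \<equiv> n / \<epsilon>"
  defines "G \<equiv> n powr (8 + (\<bar>a\<bar> + 2 * log_exponent y)) / \<epsilon> powr (2 + (\<bar>b\<bar> + 2 * log_exponent y))"
  shows "n ^ 8 / \<epsilon>\<^sup>2 * (1 + ln y)\<^sup>2 \<le> G" "n powr (8 + a) / \<epsilon> powr (4 + b) \<le> G / \<epsilon>\<^sup>2"
proof -
  let ?\<eta> = "log_exponent y"
  have y: "1 < y" using eps n by (simp add: y_def field_simps)
  have na: "1 \<le> n powr \<bar>a\<bar>" using n by (simp add: ge_one_powr_ge_zero)
  have eb: "\<epsilon> powr \<bar>b\<bar> \<le> 1" using eps powr_le1[of "\<bar>b\<bar>" \<epsilon>] by simp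
  have ebp: "0 < \<epsilon> powr \<bar>b\<bar>" using eps by simp
  have ln0: "1 \<le> (1 + ln y)\<^sup>2" using y by simp
  have y\<eta>: "n powr (2 * ?\<eta>) / \<epsilon> powr (2 * ?\<eta>) = (1 + ln y)\<^sup>2"
  proof -
    have "n powr (2 * ?\<eta>) / \<epsilon> powr (2 * ?\<eta>) = y powr (?\<eta> + ?\<eta>)"
      using eps n by (simp add: y_def powr_divide)
    also have "\<dots> = (1 + ln y)\<^sup>2" by (simp only: powr_add powr_log_exponent[OF y] power2_eq_square)
    finally show ?thesis .
  qed
  have n8: "n powr 8 = n ^ 8" "\<epsilon> powr 2 = \<epsilon>\<^sup>2" using n eps by (simp_all add: powr_numeral)
  have "G = n powr 8 / \<epsilon> powr 2 * (n powr \<bar>a\<bar> / \<epsilon> powr \<bar>b\<bar>) * (n powr (2 * ?\<eta>) / \<epsilon> powr (2 * ?\<eta>))"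
    by (simp add: G_def powr_add)
  then have G: "G = n ^ 8 / \<epsilon>\<^sup>2 * (1 + ln y)\<^sup>2 * (n powr \<bar>a\<bar> / \<epsilon> powr \<bar>b\<bar>)"
    unfolding y\<eta> n8 by simp
  have "1 \<le> n powr \<bar>a\<bar> / \<epsilon> powr \<bar>b\<bar>" using na eb ebp by (simp add: field_simps)
  then have "n ^ 8 / \<epsilon>\<^sup>2 * (1 + ln y)\<^sup>2 * 1 \<le> G" unfolding G using n by (intro mult_left_mono) auto
  then show "n ^ 8 / \<epsilon>\<^sup>2 * (1 + ln y)\<^sup>2 \<le> G" by simp
  have "n powr a \<le> n powr \<bar>a\<bar>" using n by (intro powr_mono) auto
  moreover have "\<epsilon> powr \<bar>b\<bar> \<le> \<epsilon> powr b" using eps by (intro powr_mono') auto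
  ultimately have "n powr a / \<epsilon> powr b \<le> n powr \<bar>a\<bar> / \<epsilon> powr \<bar>b\<bar>" using ebp by (intro frac_le) auto
  moreover have "n ^ 8 / \<epsilon>\<^sup>2 * 1 \<le> n ^ 8 / \<epsilon>\<^sup>2 * (1 + ln y)\<^sup>2" using ln0 n by (intro mult_left_mono) auto
  ultimately have "n ^ 8 / \<epsilon>\<^sup>2 * (n powr a / \<epsilon> powr b) \<le> G"
    unfolding G using n by (intro mult_mono) auto
  then have "n ^ 8 / \<epsilon>\<^sup>2 * (n powr a / \<epsilon> powr b) / \<epsilon>\<^sup>2 \<le> G / \<epsilon>\<^sup>2" by (intro divide_right_mono) auto
  moreover have "n powr (8 + a) / \<epsilon> powr (4 + b) = n ^ 8 / \<epsilon>\<^sup>2 * (n powr a / \<epsilon> powr b) / \<epsilon>\<^sup>2"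
  proof -
    have "\<epsilon> powr (4 + b) = \<epsilon> ^ 4 * \<epsilon> powr b" "n powr (8 + a) = n ^ 8 * n powr a"
      using n eps by (simp_all add: powr_add powr_numeral)
    then show ?thesis by (simp add: power4_eq_xxxx power2_eq_square)
  qed
  ultimately show "n powr (8 + a) / \<epsilon> powr (4 + b) \<le> G / \<epsilon>\<^sup>2" by simp
qed

text \<open>By E^2 \<le> 4/\<epsilon>^2, the enumeration contributes 16 * 2100000000 and the samples
  4 * 40000. \<open>C\<close> may have either sign, hence its absolute value.\<close>

definition time_constant :: "nat \<Rightarrow> real \<Rightarrow> real" where
  "time_constant K C = 33600000000 * log_factor K + \<bar>C\<bar> + 160000 * (real K + 1) * ((log_factor K)\<^sup>2 + 1)"

lemma running_time_bounds:
  fixes \<epsilon> a b C :: real and n K T :: nat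
  assumes eps: "0 < \<epsilon>" "\<epsilon> \<le> 1/2" and n: "1 \<le> n"
  defines "y \<equiv> real n / \<epsilon>" and "E \<equiv> nat \<lceil>1 / \<epsilon>\<rceil>"
  defines "W \<equiv> bitlength (word_bound K n E)"
  defines "G \<equiv> real n powr (8 + (\<bar>a\<bar> + 2 * log_exponent y)) / \<epsilon> powr (2 + (\<bar>b\<bar> + 2 * log_exponent y))"
  shows "2100000000 * real (orbit_cost n E W) +
      C * (real n powr (8 + a) / \<epsilon> powr (4 + b)) \<le> time_constant K C * ((G + real T) / \<epsilon>\<^sup>2)" (is ?small)
    and "real (2000000020 * (orbit_cost n E W) +
      40000 * (K * (E * E) + 1) * (n * n * W * W + T)) \<le> time_constant K C * ((G + real T) / \<epsilon>\<^sup>2)" (is ?large)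
proof -
  define c where "c = log_factor K"
  define l where "l = 1 + ln y"
  define R where "R = real (orbit_cost n E W)"
  note E = ceiling_inverse_bounds[OF eps, folded E_def]
  have c: "1 \<le> c" unfolding c_def by (rule log_factor_ge1)
  have y: "1 \<le> y" using eps n by (simp add: y_def field_simps)
  then have l: "1 \<le> l" by (simp add: l_def)
  have W: "real W \<le> c * l" using bitlength_word_bound[OF eps n] unfolding W_def c_def l_def y_def E_def .
  note G = time_exponents[OF eps, of "real n", folded y_def, of a b, folded G_def l_def]
  have G1: "real n ^ 8 / \<epsilon>\<^sup>2 * l\<^sup>2 \<le> G" and G2: "real n powr (8 + a) / \<epsilon> powr (4 + b) \<le> G / \<epsilon>\<^sup>2" using G n by auto
  have e2: "0 < \<epsilon>\<^sup>2" "\<epsilon>\<^sup>2 \<le> 1" using eps by (auto simp: power_le_one)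
  have G0: "0 \<le> G / \<epsilon>\<^sup>2" "0 \<le> G" using eps by (auto simp: G_def)
  have n1: "1 \<le> real n" using n by simp
  have E2: "real E * real E \<le> 4 / \<epsilon>\<^sup>2"
    using mult_mono[OF E(2) E(2)] eps by (simp add: power2_eq_square)
  have "R = real n ^ 8 * ((real E * real E) * (real E * real E)) * real W"
    by (simp add: R_def eval_nat_numeral)
  also have "\<dots> \<le> real n ^ 8 * (4 / \<epsilon>\<^sup>2 * (4 / \<epsilon>\<^sup>2)) * (c * l\<^sup>2)"
  proof -
    have "l * 1 \<le> l * l" using l by (intro mult_left_mono) auto
    then have "c * l \<le> c * l\<^sup>2" using c by (intro mult_left_mono) (auto simp: power2_eq_square)
    then have "real W \<le> c * l\<^sup>2" using W by linarith
    then show ?thesis using E2 by (intro mult_mono) auto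
  qed
  also have "\<dots> = 16 * c * ((real n ^ 8 / \<epsilon>\<^sup>2 * l\<^sup>2) / \<epsilon>\<^sup>2)" by simp
  also have "\<dots> \<le> 16 * c * (G / \<epsilon>\<^sup>2)" using G1 c by (intro mult_left_mono divide_right_mono) auto
  finally have R: "R \<le> 16 * c * (G / \<epsilon>\<^sup>2)" .
  have GT: "G / \<epsilon>\<^sup>2 \<le> (G + real T) / \<epsilon>\<^sup>2" by (intro divide_right_mono) auto
  have "C * (real n powr (8 + a) / \<epsilon> powr (4 + b)) \<le> \<bar>C\<bar> * (real n powr (8 + a) / \<epsilon> powr (4 + b))"
    by (intro mult_right_mono) auto
  also have "\<dots> \<le> \<bar>C\<bar> * (G / \<epsilon>\<^sup>2)" using G2 by (intro mult_left_mono) auto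
  finally have "C * (real n powr (8 + a) / \<epsilon> powr (4 + b)) \<le> \<bar>C\<bar> * (G / \<epsilon>\<^sup>2)" .
  moreover have "2100000000 * R \<le> 33600000000 * c * (G / \<epsilon>\<^sup>2)"
    using mult_left_mono[OF R, of 2100000000] by simp
  ultimately have "2100000000 * R + C * (real n powr (8 + a) / \<epsilon> powr (4 + b)) \<le> (33600000000 * c + \<bar>C\<bar>) * (G / \<epsilon>\<^sup>2)"
    unfolding distrib_right by (rule add_mono[rotated])
  also have "\<dots> \<le> time_constant K C * ((G + real T) / \<epsilon>\<^sup>2)"
    using GT G0 c by (intro mult_mono) (auto simp: time_constant_def c_def)
  finally show ?small unfolding R_def .
  have nW: "real (n * n * W * W) \<le> c\<^sup>2 * G"
  proof -
    have "real (n * n * W * W) = real n ^ 2 * (real W)\<^sup>2" by (simp add: power2_eq_square)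
    also have "\<dots> \<le> real n ^ 8 * (c * l)\<^sup>2"
      using W n1 by (intro mult_mono power_increasing power_mono) auto
    also have "\<dots> = c\<^sup>2 * (real n ^ 8 * l\<^sup>2 * 1)" by (simp add: power_mult_distrib)
    also have "\<dots> \<le> c\<^sup>2 * (real n ^ 8 * l\<^sup>2 * (1 / \<epsilon>\<^sup>2))" using e2 by (intro mult_left_mono) auto
    also have "\<dots> \<le> c\<^sup>2 * G" using G1 by (intro mult_left_mono) auto
    finally show ?thesis .
  qed
  have "real (40000 * (K * (E * E) + 1) * (n * n * W * W + T)) =
      40000 * (real K * (real E * real E) + 1) * (real (n * n * W * W) + real T)" by simp
  also have "\<dots> \<le> 40000 * ((real K + 1) * (4 / \<epsilon>\<^sup>2)) * ((c\<^sup>2 + 1) * (G + real T))"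
  proof (intro mult_mono)
    have "real K * (real E * real E) \<le> real K * (4 / \<epsilon>\<^sup>2)" using E2 by (intro mult_left_mono) auto
    moreover have "1 \<le> 4 / \<epsilon>\<^sup>2" using e2 by (simp add: field_simps)
    ultimately show "real K * (real E * real E) + 1 \<le> (real K + 1) * (4 / \<epsilon>\<^sup>2)"
      unfolding distrib_right mult_1_left by (rule add_mono)
    have "0 \<le> c\<^sup>2 * real T" by simp
    then show "real (n * n * W * W) + real T \<le> (c\<^sup>2 + 1) * (G + real T)" using nW G0
      unfolding distrib_left distrib_right mult_1_left by linarith
  qed auto
  also have "\<dots> = 160000 * (real K + 1) * (c\<^sup>2 + 1) * ((G + real T) / \<epsilon>\<^sup>2)" by simp
  finally have "2000000020 * R + real (40000 * (K * (E * E) + 1) * (n * n * W * W + T)) \<le>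
      33600000000 * c * ((G + real T) / \<epsilon>\<^sup>2) + 160000 * (real K + 1) * (c\<^sup>2 + 1) * ((G + real T) / \<epsilon>\<^sup>2)"
  proof -
    have "2000000020 * R \<le> 2100000000 * R" by (simp add: R_def)
    also have "\<dots> \<le> 2100000000 * (16 * c * (G / \<epsilon>\<^sup>2))" using R by simp
    also have "\<dots> = 33600000000 * c * (G / \<epsilon>\<^sup>2)" by simp
    also have "\<dots> \<le> 33600000000 * c * ((G + real T) / \<epsilon>\<^sup>2)" using GT c by (intro mult_left_mono) auto
    finally have "2000000020 * R \<le> 33600000000 * c * ((G + real T) / \<epsilon>\<^sup>2)" .
    moreover assume "real (40000 * (K * (E * E) + 1) * (n * n * W * W + T)) \<le> 160000 * (real K + 1) * (c\<^sup>2 + 1) * ((G + real T) / \<epsilon>\<^sup>2)"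
    ultimately show ?thesis by (rule add_mono)
  qed
  also have "\<dots> = (33600000000 * c + 160000 * (real K + 1) * (c\<^sup>2 + 1)) * ((G + real T) / \<epsilon>\<^sup>2)"
    by (simp only: distrib_right)
  also have "\<dots> \<le> time_constant K C * ((G + real T) / \<epsilon>\<^sup>2)"
    using G0 by (intro mult_right_mono) (auto simp: time_constant_def c_def intro: divide_nonneg_nonneg)
  finally show ?large unfolding R_def by (simp only: of_nat_add of_nat_mult of_nat_numeral)
qed

abbreviation (input) time_bound :: "nat \<Rightarrow> real \<Rightarrow> nat \<Rightarrow> real \<Rightarrow> real \<Rightarrow> real \<Rightarrow> nat \<Rightarrow> real" where
  "time_bound K C n \<epsilon> a b T \<equiv>
     time_constant K C * ((real n powr (8 + a) / \<epsilon> powr (2 + b) + real T) / \<epsilon>\<^sup>2)"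

text \<open>The last premise is the only link to the random set. If the orbit list stays short, no
  query is made and the answer is right for all coins.\<close>

lemma main_prog_computes:
  fixes n k K T :: nat and \<epsilon> \<delta> a b C :: real and h O' :: "graph \<Rightarrow> 'd" and enc :: "'d \<Rightarrow> nat"
  assumes M: "3 \<le> M" "mentions A \<subseteq> {..<M}" and n: "1 \<le> n" and eps: "0 < \<epsilon>" "\<epsilon> \<le> 1/2"
    and \<delta>: "0 < \<delta>" "8 * ln (1 / \<delta>) \<le> real K"
    and h: "iso_invariant n h" and A: "\<And>x. x \<in> graphs n \<Longrightarrow>
      det_computes A (input (params n k \<epsilon> @ [card (cliques n k x)]) x) (enc (h x))
        (C * (real n powr (8 + a) / \<epsilon> powr (4 + b)))"
    and O: "oracle_for n D h S O'" "simulable n enc O' T" and x: "x \<in> graphs n"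
  defines "E \<equiv> nat \<lceil>1 / \<epsilon>\<rceil>" and "y \<equiv> real n / \<epsilon>"
  assumes S: "2 ^ level n E \<le> length (sampled_orbit n E x) \<Longrightarrow>
    real (card (set (take (2 ^ level n E) (sampled_orbit n E x)) - S)) \<le> (1/2 - \<epsilon>/2) * 2 ^ level n E"
  shows "rand_computes \<delta> n (enc \<circ> O') T (main_prog M A K) (input (params n k \<epsilon>) x) (enc (h x))
    (time_bound K C n \<epsilon> (\<bar>a\<bar> + 2 * log_exponent y) (\<bar>b\<bar> + 2 * log_exponent y) T)"
proof -
  let ?L = "level n E" and ?ys = "sampled_orbit n E x" and ?v = "enc (h x)" and ?P = "main_prog M A K"
  let ?m = "input (params n k \<epsilon>) x"
  let ?B = "time_bound K C n \<epsilon> (\<bar>a\<bar> + 2 * log_exponent y) (\<bar>b\<bar> + 2 * log_exponent y) T"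
  have E: "1 \<le> E" "1 / \<epsilon> \<le> real E" unfolding E_def using ceiling_inverse_bounds[OF eps] by auto
  have params: "params n k \<epsilon> = [n, min k (n + 1), E]" by (simp add: params_def E_def)
  interpret coins: prob_space coins by (rule prob_space_coins)
  show ?thesis
  proof (cases "length ?ys < 2 ^ ?L")
    case True
    have ex: "\<exists>t s. exec n (enc \<circ> O') T \<omega> ?P (?m, 0) t s \<and> real t \<le> ?B \<and> result s = ?v" for \<omega>
    proof -
      obtain t s where "exec n (enc \<circ> O') T \<omega> ?P (?m, 0) t s" "result s = ?v"
        "real t \<le> 2100000000 * real (orbit_cost n E (bitlength (word_bound K n E))) +
          C * (real n powr (8 + a) / \<epsilon> powr (4 + b))"
        using exec_main_small[OF M n E(1) x True A[OF x, unfolded params], of "enc \<circ> O'" T \<omega> K] unfolding params by blast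
      then show ?thesis
        using running_time_bounds(1)[OF eps n, where K = K and a = a and b = b and C = C and T = T, folded E_def y_def]
        by (blast intro: order_trans)
    qed
    then have "{\<omega>. \<exists>t s. exec n (enc \<circ> O') T \<omega> ?P (?m, 0) t s \<and> result s = ?v} = UNIV" by blast
    moreover have "space coins = UNIV" by (simp add: coins_def space_PiM)
    ultimately have "measure coins {\<omega>. \<exists>t s. exec n (enc \<circ> O') T \<omega> ?P (?m, 0) t s \<and> result s = ?v} = 1"
      using coins.prob_space by simp
    then have "1 - \<delta> \<le> measure coins {\<omega>. \<exists>t s. exec n (enc \<circ> O') T \<omega> ?P (?m, 0) t s \<and> result s = ?v}"
      using \<delta>(1) by linarith
    moreover have "\<exists>t s. exec n (enc \<circ> O') T \<omega> ?P (?m, 0) t s \<and> real t \<le> ?B" for \<omega> using ex by blast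
    ultimately show ?thesis unfolding rand_computes_def by blast
  next
    case False
    then have large: "2 ^ ?L \<le> length ?ys" by simp
    define ans where "ans r = enc (O' (?ys ! r))" for r
    let ?vote = "\<lambda>\<omega>. fst (fold vote_step (map ans (samples ?L (K * (E * E)) (map \<omega> [0..<K * (E * E) * ?L]))) (0, 0))"
    have ys: "distinct ?ys" "set ?ys \<subseteq> orbit n x" using sampled_orbit_props[OF x] by auto
    \<comment> \<open>Simulability thus yields a bound on the size of the answers besides the price
      of a query.\<close>
    have T: "(enc \<circ> O') y < 2 ^ T" if y: "y \<in> graphs n" for y
    proof -
      have "bitlength (enc (O' y)) \<le> T" using O(2) y det_computes_bitlength unfolding simulable_def by blast
      then have "(2 :: nat) ^ bitlength (enc (O' y)) \<le> 2 ^ T" by (intro power_increasing) auto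
      with less_two_power_bitlength show ?thesis unfolding comp_def by (rule less_le_trans)
    qed
    have ex: "\<exists>t s. exec n (enc \<circ> O') T \<omega> ?P (?m, 0) t s \<and> real t \<le> ?B \<and> result s = ?vote \<omega>" for \<omega>
    proof -
      obtain t s where ts: "exec n (enc \<circ> O') T \<omega> ?P (?m, 0) t s" "result s = ?vote \<omega>"
        "t \<le> 2000000020 * (orbit_cost n E (bitlength (word_bound K n E))) +
          40000 * (K * (E * E) + 1) * (n * n * bitlength (word_bound K n E) * bitlength (word_bound K n E) + T)"
        using exec_main_large[where orc = "enc \<circ> O'" and \<omega> = \<omega> and A = A and K = K and k = k, OF M(1) n E(1) x large T] unfolding params ans_def comp_def by blast
      from ts(3) have "real t \<le> real (2000000020 * (orbit_cost n E (bitlength (word_bound K n E))) +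
          40000 * (K * (E * E) + 1) * (n * n * bitlength (word_bound K n E) * bitlength (word_bound K n E) + T))"
        by (rule of_nat_mono)
      also have "\<dots> \<le> ?B"
        by (rule running_time_bounds(2)[OF eps n, folded E_def y_def])
      finally show ?thesis using ts(1,2) by blast
    qed
    \<comment> \<open>The run for given coins is unique, so success is a property of the
      vote.\<close>
    have "{\<omega>. \<exists>t s. exec n (enc \<circ> O') T \<omega> ?P (?m, 0) t s \<and> result s = ?v} = {\<omega>. ?vote \<omega> = ?v}"
      using ex exec_determ by (metis (mono_tags, lifting))
    moreover have "1 - \<delta> \<le> measure coins {\<omega>. ?vote \<omega> = ?v}"
    proof (rule majority_vote_success[where \<epsilon> = \<epsilon> and K = "real K"])
      \<comment> \<open>On the orbit \<open>h\<close> has the constant value \<open>h x\<close>, and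
        on \<open>S\<close> the oracle agrees with \<open>h\<close>; a wrong answer thus exposes a
        graph outside \<open>S\<close>.\<close>
      have "(\<lambda>r. ?ys ! r) ` {r. r < 2 ^ ?L \<and> ans r \<noteq> ?v} \<subseteq> set (take (2 ^ ?L) ?ys) - S"
      proof
        fix z assume "z \<in> (\<lambda>r. ?ys ! r) ` {r. r < 2 ^ ?L \<and> ans r \<noteq> ?v}"
        then obtain r where r: "z = ?ys ! r" "r < 2 ^ ?L" "ans r \<noteq> ?v" by blast
        then have "r < length ?ys" using large by simp
        then have "z \<in> orbit n x" using ys(2) r(1) by auto
        then have "h z = h x" by (rule iso_invariant_orbit[OF h x])
        then have "z \<notin> S" using O(1) r(1,3) unfolding oracle_for_def ans_def by metis
        moreover have "z \<in> set (take (2 ^ ?L) ?ys)"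
          using r(1,2) \<open>r < length ?ys\<close> by (auto simp: in_set_conv_nth intro!: exI[of _ r])
        ultimately show "z \<in> set (take (2 ^ ?L) ?ys) - S" by simp
      qed
      moreover have "inj_on (\<lambda>r. ?ys ! r) {r. r < 2 ^ ?L \<and> ans r \<noteq> ?v}"
        using ys(1) large by (auto simp: inj_on_def nth_eq_iff_index_eq)
      ultimately have "card {r. r < 2 ^ ?L \<and> ans r \<noteq> ?v} \<le> card (set (take (2 ^ ?L) ?ys) - S)"
        by (intro card_inj_on_le[where f = "\<lambda>r. ?ys ! r"]) auto
      then show "real (card {r. r < 2 ^ ?L \<and> ans r \<noteq> ?v}) \<le> (1/2 - \<epsilon>/2) * 2 ^ ?L"
        using S[OF large] by linarith
      have "(1 / \<epsilon>) * (1 / \<epsilon>) \<le> real E * real E" using E eps by (intro mult_mono) auto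
      then have "real K * ((1 / \<epsilon>) * (1 / \<epsilon>)) \<le> real K * (real E * real E)" by (intro mult_left_mono) auto
      then show "real K / \<epsilon>\<^sup>2 \<le> real (K * (E * E))" by (simp add: power2_eq_square)
    qed (use eps \<delta> in auto)
    ultimately show ?thesis using ex unfolding rand_computes_def by (metis (no_types, lifting))
  qed
qed

lemma target_ge:
  fixes \<epsilon> :: real
  assumes "0 < \<epsilon>" "\<epsilon> \<le> 1/2"
  shows "64 * (real n)\<^sup>2 / \<epsilon>\<^sup>2 \<le> real (2 ^ level n (nat \<lceil>1 / \<epsilon>\<rceil>))"
proof -
  let ?E = "nat \<lceil>1 / \<epsilon>\<rceil>"
  have "(1 / \<epsilon>) * (1 / \<epsilon>) \<le> real ?E * real ?E"
    using ceiling_inverse_bounds(1)[OF assms] ceiling_inverse_bounds(1)[OF assms] of_nat_0_le_iff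
    by (rule mult_mono) (use assms in simp)
  then have "64 * (real n)\<^sup>2 * ((1 / \<epsilon>) * (1 / \<epsilon>)) \<le> 64 * (real n)\<^sup>2 * (real ?E * real ?E)" by (intro mult_left_mono) auto
  also have "\<dots> = real (target n ?E)" by (simp add: target_def power2_eq_square)
  also have "\<dots> \<le> real (2 ^ level n ?E)" by (rule of_nat_mono[OF target_le_level])
  finally show ?thesis by (simp add: power2_eq_square)
qed

theorem theorem1:
  fixes k :: "nat \<Rightarrow> nat" and D :: "'d set" and enc :: "'d \<Rightarrow> nat"
    and \<epsilon> :: "nat \<Rightarrow> real" and H :: "nat \<Rightarrow> graph \<Rightarrow> 'd"
    and A :: com and a b :: "nat \<Rightarrow> real" and C :: real
  assumes eps_range: "\<forall>\<^sub>F n in sequentially. 0 < \<epsilon> n \<and> \<epsilon> n \<le> 1/2"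
    and eps_omega: "\<epsilon> \<in> \<omega>(\<lambda>n. real n powr (3/2) / sqrt (fact n))"
    and H_range: "\<And>n x. x \<in> graphs n \<Longrightarrow> H n x \<in> D"
    and H_invariant: "\<And>n. iso_invariant n (H n)"
    and enc_inj: "inj_on enc (\<Union>n. H n ` graphs n)"
    and exponents: "a \<longlonglongrightarrow> 0" "b \<longlonglongrightarrow> 0"
    and H_time: "\<forall>\<^sub>F n in sequentially. \<forall>x\<in>graphs n.
      det_computes A (input (params n (k n) (\<epsilon> n) @ [card (cliques n (k n) x)]) x) (enc (H n x))
        (C * (real n powr (8 + a n) / \<epsilon> n powr (4 + b n)))"
  shows "\<forall>\<delta>>0. \<exists>P a' b' C' c. a' \<longlonglongrightarrow> 0 \<and> b' \<longlonglongrightarrow> 0 \<and> c > 0 \<and>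
    (\<forall>\<^sub>F n in sequentially.
      measure_pmf.prob (random_subset n (1/2 + \<epsilon> n))
        {S. \<forall>O' T. oracle_for n D (H n) S O' \<and> simulable n enc O' T \<longrightarrow>
          (\<forall>x\<in>graphs n.
            rand_computes \<delta> n (enc \<circ> O') T P (input (params n (k n) (\<epsilon> n)) x) (enc (H n x))
              (C' * ((real n powr (8 + a' n) / \<epsilon> n powr (2 + b' n) + real T) / (\<epsilon> n)\<^sup>2)))}
      \<ge> 1 - 2 powr (- c * (real n)\<^sup>2))"
proof (intro allI impI)
  fix \<delta> :: real assume \<delta>: "0 < \<delta>"
  \<comment> \<open>Above the input and output arrays and everything in \<open>A\<close>;
    \<open>insert 0\<close> keeps the maximum defined if \<open>A\<close> mentions no array.\<close>
  define M where "M = max 3 (Suc (Max (insert 0 (mentions A))))"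
  \<comment> \<open>For \<delta> \<ge> 1 the logarithm is not positive and \<open>K\<close> is
    0.\<close>
  define K where "K = nat \<lceil>8 * ln (1 / \<delta>)\<rceil>"
  define \<eta> where "\<eta> n = 2 * log_exponent (real n / \<epsilon> n)" for n
  have M: "3 \<le> M" "mentions A \<subseteq> {..<M}"
    using Max_ge[of "insert 0 (mentions A)"] finite_mentions[of A] by (force simp: M_def less_Suc_eq_le le_max_iff_disj)+
  have K: "8 * ln (1 / \<delta>) \<le> real K" unfolding K_def by linarith
  \<comment> \<open>This forces the argument of \<open>log_exponent\<close> to infinity, however
    \<epsilon> behaves below 1/2.\<close>
  have "\<forall>\<^sub>F n in sequentially. real n \<le> real n / \<epsilon> n"
    using eps_range
  proof eventually_elim
    case (elim n)
    then have "real n * \<epsilon> n \<le> real n * 1" by (intro mult_left_mono) auto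
    then show ?case using elim by (simp add: pos_le_divide_eq)
  qed
  then have "filterlim (\<lambda>n. real n / \<epsilon> n) at_top sequentially"
    by (rule filterlim_at_top_mono[OF filterlim_real_sequentially])
  then have "(\<lambda>n. log_exponent (real n / \<epsilon> n)) \<longlonglongrightarrow> 0"
    by (rule filterlim_compose[OF log_exponent_tendsto])
  then have \<eta>: "\<eta> \<longlonglongrightarrow> 0" unfolding \<eta>_def by (rule tendsto_mult_right_zero)
  have lim: "(\<lambda>n. \<bar>a n\<bar> + \<eta> n) \<longlonglongrightarrow> 0" "(\<lambda>n. \<bar>b n\<bar> + \<eta> n) \<longlonglongrightarrow> 0"
    using tendsto_add[OF tendsto_rabs_zero[OF exponents(1)] \<eta>] tendsto_add[OF tendsto_rabs_zero[OF exponents(2)] \<eta>] by simp_all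
  let ?good = "\<lambda>P a' b' C' n. {S. \<forall>O' T. oracle_for n D (H n) S O' \<and> simulable n enc O' T \<longrightarrow>
          (\<forall>x\<in>graphs n.
            rand_computes \<delta> n (enc \<circ> O') T P (input (params n (k n) (\<epsilon> n)) x) (enc (H n x))
              (C' * ((real n powr (8 + a' n) / \<epsilon> n powr (2 + b' n) + real T) / (\<epsilon> n)\<^sup>2)))}"
  show "\<exists>P a' b' C' c. a' \<longlonglongrightarrow> 0 \<and> b' \<longlonglongrightarrow> 0 \<and> c > 0 \<and>
    (\<forall>\<^sub>F n in sequentially.
      measure_pmf.prob (random_subset n (1/2 + \<epsilon> n))
        (?good P a' b' C' n)
      \<ge> 1 - 2 powr (- c * (real n)\<^sup>2))"
  proof (intro exI conjI, rule lim(1), rule lim(2), rule zero_less_one)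
    show "\<forall>\<^sub>F n in sequentially.
      measure_pmf.prob (random_subset n (1/2 + \<epsilon> n))
        (?good (main_prog M A K) (\<lambda>n. \<bar>a n\<bar> + \<eta> n) (\<lambda>n. \<bar>b n\<bar> + \<eta> n) (time_constant K C) n)
      \<ge> 1 - 2 powr (- 1 * (real n)\<^sup>2)"
      using eps_range H_time eventually_ge_at_top[of 1]
    proof eventually_elim
      case (elim n)
      then have eps: "0 < \<epsilon> n" "\<epsilon> n \<le> 1/2" and A: "\<And>x. x \<in> graphs n \<Longrightarrow>
        det_computes A (input (params n (k n) (\<epsilon> n) @ [card (cliques n (k n) x)]) x) (enc (H n x))
        (C * (real n powr (8 + a n) / \<epsilon> n powr (4 + b n)))" and n: "1 \<le> n" by auto
      let ?E = "nat \<lceil>1 / \<epsilon> n\<rceil>"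
      let ?N = "2 ^ level n ?E :: nat"
      let ?W = "\<lambda>x. set (take ?N (sampled_orbit n ?E x))"
      let ?Y = "{x \<in> graphs n. ?N \<le> length (sampled_orbit n ?E x)}"
      \<comment> \<open>An event about \<open>S\<close> alone that implies the good event for all
        oracles and all \<open>T\<close> simultaneously.\<close>
      let ?hit = "{S. \<forall>x\<in>?Y. real (card (?W x - S)) \<le> (1/2 - \<epsilon> n / 2) * real ?N}"
      have "?W x \<subseteq> graphs n \<and> card (?W x) = ?N" if "x \<in> ?Y" for x
        using that sampled_orbit_props[of x n ?E] set_take_subset[of ?N "sampled_orbit n ?E x"]
          distinct_card[of "take ?N (sampled_orbit n ?E x)"] by auto
      then have "1 - 2 powr (- (real n)\<^sup>2) \<le> measure_pmf.prob (random_subset n (1/2 + \<epsilon> n)) ?hit"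
        by (intro random_subset_hits[OF eps n] target_ge[OF eps]) auto
      also have "\<dots> \<le> measure_pmf.prob (random_subset n (1/2 + \<epsilon> n))
        (?good (main_prog M A K) (\<lambda>n. \<bar>a n\<bar> + \<eta> n) (\<lambda>n. \<bar>b n\<bar> + \<eta> n) (time_constant K C) n)"
      proof (intro measure_pmf.finite_measure_mono subsetI CollectI allI impI ballI)
        fix S O' T x
        assume "S \<in> ?hit" and O: "oracle_for n D (H n) S O' \<and> simulable n enc O' T" and x: "x \<in> graphs n"
        then have "real (card (?W x - S)) \<le> (1/2 - \<epsilon> n / 2) * 2 ^ level n ?E"
          if "?N \<le> length (sampled_orbit n ?E x)" using that by simp
        then show "rand_computes \<delta> n (enc \<circ> O') T (main_prog M A K) (input (params n (k n) (\<epsilon> n)) x) (enc (H n x))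
              (time_bound K C n (\<epsilon> n) (\<bar>a n\<bar> + \<eta> n) (\<bar>b n\<bar> + \<eta> n) T)"
          unfolding \<eta>_def using O by (intro main_prog_computes[OF M n eps \<delta> K H_invariant A _ _ x]) auto
      qed simp
      finally show ?case by simp
    qed
  qed
qed

end
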